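(* Let $H$ be a separable (centered) Gaussian Hilbert space, $p\in[1,\infty]$, and $u,v>0$ with $\frac1u+\frac1v=1$. Then for any $\varphi,\psi\in L^p(\Omega,\mathcal F(H),P)$, $\Gamma(1/\sqrt u)\varphi\diamond\Gamma(1/\sqrt v)\psi\in L^p(\Omega,\mathcal F(H),P)$ and $$\Big\|\Gamma\big(\tfrac1{\sqrt u}\big)\varphi\diamond\Gamma\big(\tfrac1{\sqrt v}\big)\psi\Big\|_p\le\|\varphi\|_p\,\|\psi\|_p.$$
   Context: $(\Omega,\mathcal F,P)$ is a probability space; a centered Gaussian Hilbert space $H$ is a closed subspace of $L^2(\Omega,\mathcal F,P)$ all of whose elements are centered normal random variables; $\mathcal F(H)$ is the $\sigma$-algebra generated by $H$; $\|\cdot\|_p$ is the norm of $L^p(\Omega,\mathcal F(H),P)$. Chaos decomposition: $F_n$ is the set of polynomials of degree $\le n$ in finitely many elements of $H$, $G_0=\mathbb C$, $G_n=\overline{F_n}\ominus\overline{F_{n-1}}$, and $L^2(\Omega,\mathcal F(H),P)=\bigoplus_n G_n$; $P_n$ is the projection onto $G_n$. Wick product: $\varphi\diamond\psi=P_{m+n}(\varphi\psi)$ for $\varphi\in G_m,\psi\in G_n$, extended bilinearly by $\varphi\diamond\psi=\sum_k\sum_{i+j=k}f_i\diamond g_j$ for $\varphi=\sum f_n,\psi=\sum g_n$, $f_n,g_n\in G_n$. Second quantization: $\Gamma(c)\sum f_n=\sum c^nf_n$; for real $|c|\le1$ it extends uniquely to a norm-one operator on every $L^p$, $1\le p\le\infty$.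 For $1/u+1/v=1$ the map $(\varphi,\psi)\mapsto\Gamma(1/\sqrt u)\varphi\diamond\Gamma(1/\sqrt v)\psi$ is bounded $L^2\times L^2\to L^2$ and extends uniquely continuously to $L^1\times L^1\to L^1$; for $L^p$ arguments the expression denotes this extension. *)

theory Defs
  imports "HOL-Probability.Probability"
begin

definition L2c :: "'a measure \<Rightarrow> ('a \<Rightarrow> complex) set" where
  "L2c M = {f. f \<in> borel_measurable M \<and> integrable M (\<lambda>x. (cmod (f x))\<^sup>2)}"

definition inner2 :: "'a measure \<Rightarrow> ('a \<Rightarrow> complex) \<Rightarrow> ('a \<Rightarrow> complex) \<Rightarrow> complex" where
  "inner2 M f g = (\<integral>x. f x * cnj (g x) \<partial>M)"

definition dist2 :: "'a measure \<Rightarrow> ('a \<Rightarrow> complex) \<Rightarrow> ('a \<Rightarrow> complex) \<Rightarrow> real" where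
  "dist2 M f g = (\<integral>x. (cmod (f x - g x))\<^sup>2 \<partial>M)"

definition dist1 :: "'a measure \<Rightarrow> ('a \<Rightarrow> complex) \<Rightarrow> ('a \<Rightarrow> complex) \<Rightarrow> real" where
  "dist1 M f g = (\<integral>x. cmod (f x - g x) \<partial>M)"

definition centered_normal :: "'a measure \<Rightarrow> ('a \<Rightarrow> real) \<Rightarrow> bool" where
  "centered_normal M X \<longleftrightarrow> X \<in> borel_measurable M \<and>
     ((AE x in M. X x = 0) \<or> (\<exists>\<sigma>>0. distributed M lborel X (\<lambda>t. ennreal (normal_density 0 \<sigma> t))))"

definition L2r :: "'a measure \<Rightarrow> ('a \<Rightarrow> real) set" where
  "L2r M = {X. X \<in> borel_measurable M \<and> integrable M (\<lambda>x. (X x)\<^sup>2)}"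

definition gaussian_hilbert_space :: "'a measure \<Rightarrow> ('a \<Rightarrow> real) set \<Rightarrow> bool" where
  "gaussian_hilbert_space M H \<longleftrightarrow>
     H \<subseteq> L2r M \<and>
     (\<forall>X\<in>H. centered_normal M X) \<and>
     (\<lambda>x. 0) \<in> H \<and>
     (\<forall>X\<in>H. \<forall>Y\<in>H. (\<lambda>x. X x + Y x) \<in> H) \<and>
     (\<forall>X\<in>H. \<forall>c::real. (\<lambda>x. c * X x) \<in> H) \<and>
     (\<forall>Xs X. (\<forall>n. Xs n \<in> H) \<longrightarrow> X \<in> L2r M \<longrightarrow>
        (\<lambda>n. \<integral>x. (Xs n x - X x)\<^sup>2 \<partial>M) \<longlonglongrightarrow> 0 \<longrightarrow> X \<in> H)"

definition separable_ghs :: "'a measure \<Rightarrow> ('a \<Rightarrow> real) set \<Rightarrow> bool" where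
  "separable_ghs M H \<longleftrightarrow> (\<exists>D. countable D \<and> D \<subseteq> H \<and>
     (\<forall>X\<in>H. \<forall>e>0. \<exists>Y\<in>D. (\<integral>x. (X x - Y x)\<^sup>2 \<partial>M) < e))"

definition FH :: "'a measure \<Rightarrow> ('a \<Rightarrow> real) set \<Rightarrow> 'a measure" where
  "FH M H = sigma (space M) (\<Union>X\<in>H. {X -` B \<inter> space M | B. B \<in> sets borel})"

text \<open>Elements of L^p are taken up to a.e. equality: f is in L^p(F(H)) iff it is a.e. equal
  to an F(H)-measurable function with finite p-norm.\<close>

definition lp_norm :: "'a measure \<Rightarrow> ennreal \<Rightarrow> ('a \<Rightarrow> complex) \<Rightarrow> real" where
  "lp_norm M p f = (if p = \<infinity> then enn2real (esssup M (\<lambda>x. ennreal (cmod (f x))))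
                    else (\<integral>x. cmod (f x) powr (enn2real p) \<partial>M) powr (1 / enn2real p))"

definition in_Lp :: "'a measure \<Rightarrow> ('a \<Rightarrow> real) set \<Rightarrow> ennreal \<Rightarrow> ('a \<Rightarrow> complex) \<Rightarrow> bool" where
  "in_Lp M H p f \<longleftrightarrow> f \<in> borel_measurable M \<and>
     (\<exists>g \<in> borel_measurable (FH M H). AE x in M. f x = g x) \<and>
     (if p = \<infinity> then esssup M (\<lambda>x. ennreal (cmod (f x))) < \<infinity>
      else integrable M (\<lambda>x. cmod (f x) powr (enn2real p)))"

definition monomials :: "('a \<Rightarrow> real) set \<Rightarrow> nat \<Rightarrow> ('a \<Rightarrow> complex) set" where
  "monomials H n = {(\<lambda>x. \<Prod>i<j. complex_of_real (Xs i x)) | (j::nat) (Xs::nat \<Rightarrow> 'a \<Rightarrow> real). j \<le> n \<and> (\<forall>i<j. Xs i \<in> H)}"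

definition Fpoly :: "('a \<Rightarrow> real) set \<Rightarrow> nat \<Rightarrow> ('a \<Rightarrow> complex) set" where
  "Fpoly H n = {(\<lambda>x. \<Sum>i<m. c i * mon i x) | (m::nat) (c::nat \<Rightarrow> complex) (mon::nat \<Rightarrow> 'a \<Rightarrow> complex).
                  \<forall>i<m. mon i \<in> monomials H n}"

definition Fbar :: "'a measure \<Rightarrow> ('a \<Rightarrow> real) set \<Rightarrow> nat \<Rightarrow> ('a \<Rightarrow> complex) set" where
  "Fbar M H n = {f \<in> L2c M. \<forall>e>0. \<exists>g\<in>Fpoly H n. dist2 M f g < e}"

definition chaos :: "'a measure \<Rightarrow> ('a \<Rightarrow> real) set \<Rightarrow> nat \<Rightarrow> ('a \<Rightarrow> complex) set" where
  "chaos M H n = (if n = 0 then Fbar M H 0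
                  else {f \<in> Fbar M H n. \<forall>g\<in>Fbar M H (n - 1). inner2 M f g = 0})"

text \<open>Orthogonal projection P_n onto G_n (a representative, determined up to a.e. equality).\<close>

definition chaos_proj :: "'a measure \<Rightarrow> ('a \<Rightarrow> real) set \<Rightarrow> nat \<Rightarrow> ('a \<Rightarrow> complex) \<Rightarrow> ('a \<Rightarrow> complex)" where
  "chaos_proj M H n f = (SOME g. g \<in> chaos M H n \<and>
       (\<forall>h\<in>chaos M H n. inner2 M (\<lambda>x. f x - g x) h = 0))"

text \<open>For L2 arguments: the series sum_k sum_{i+j=k} (a^i P_i phi) \<diamond> (b^j P_j psi), where
  f_i \<diamond> g_j = P_{i+j}(f_i g_j), converges in L2 to chi.\<close>

definition wick_partial :: "'a measure \<Rightarrow> ('a \<Rightarrow> real) set \<Rightarrow> real \<Rightarrow> real \<Rightarrow>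
    ('a \<Rightarrow> complex) \<Rightarrow> ('a \<Rightarrow> complex) \<Rightarrow> nat \<Rightarrow> 'a \<Rightarrow> complex" where
  "wick_partial M H a b \<phi> \<psi> N = (\<lambda>x. \<Sum>k\<le>N. \<Sum>i\<le>k.
       chaos_proj M H k (\<lambda>y. (complex_of_real a ^ i * chaos_proj M H i \<phi> y) *
                             (complex_of_real b ^ (k - i) * chaos_proj M H (k - i) \<psi> y)) x)"

definition wick2_rel :: "'a measure \<Rightarrow> ('a \<Rightarrow> real) set \<Rightarrow> real \<Rightarrow> real \<Rightarrow>
    ('a \<Rightarrow> complex) \<Rightarrow> ('a \<Rightarrow> complex) \<Rightarrow> ('a \<Rightarrow> complex) \<Rightarrow> bool" where
  "wick2_rel M H a b \<phi> \<psi> w \<longleftrightarrow> w \<in> L2c M \<and>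
     (\<lambda>N. dist2 M (wick_partial M H a b \<phi> \<psi> N) w) \<longlonglongrightarrow> 0"

text \<open>Value of the unique continuous extension L1 x L1 -> L1 at (phi, psi): chi is an L1
  limit of the L2 Wick expressions along L2(F(H)) sequences converging in L1 to phi, psi.\<close>

definition wick_ext_rel :: "'a measure \<Rightarrow> ('a \<Rightarrow> real) set \<Rightarrow> real \<Rightarrow> real \<Rightarrow>
    ('a \<Rightarrow> complex) \<Rightarrow> ('a \<Rightarrow> complex) \<Rightarrow> ('a \<Rightarrow> complex) \<Rightarrow> bool" where
  "wick_ext_rel M H a b \<phi> \<psi> w \<longleftrightarrow> w \<in> borel_measurable M \<and> integrable M w \<and>
     (\<exists>\<phi>s \<psi>s ws. (\<forall>n. in_Lp M H 2 (\<phi>s n) \<and> in_Lp M H 2 (\<psi>s n) \<and>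
                        wick2_rel M H a b (\<phi>s n) (\<psi>s n) (ws n)) \<and>
        (\<lambda>n. dist1 M (\<phi>s n) \<phi>) \<longlonglongrightarrow> 0 \<and>
        (\<lambda>n. dist1 M (\<psi>s n) \<psi>) \<longlonglongrightarrow> 0 \<and>
        (\<lambda>n. dist1 M (ws n) w) \<longlonglongrightarrow> 0)"

end

theory Submission
  imports Defs
begin

text \<open>
  Write \<open>a = 1 / sqrt u\<close>, \<open>b = 1 / sqrt v\<close>, so that \<open>a\<^sup>2 + b\<^sup>2 = 1\<close>. The operation
  \<open>\<Gamma>(a)\<phi> \<diamond> \<Gamma>(b)\<psi>\<close> is the Mehler-type integral
  \<open>W(\<phi>, \<psi>)(\<xi>) = E[\<phi>(a \<xi> + b \<eta>) \<psi>(b \<xi> - a \<eta>)]\<close>, where \<open>\<eta>\<close> is an independent copy of the Gaussian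
  path \<open>\<xi>\<close>. Since \<open>(\<xi>, \<eta>) \<mapsto> (a \<xi> + b \<eta>, b \<xi> - a \<eta>)\<close> preserves the law, Jensen's inequality gives
  \<open>\<parallel>W(\<phi>, \<psi>)\<parallel>\<^sub>p \<le> \<parallel>\<phi>\<parallel>\<^sub>p \<parallel>\<psi>\<parallel>\<^sub>p\<close>. To identify \<open>W\<close> with the Wick expression, note that for
  \<open>f \<in> G\<^sub>i\<close>, \<open>g \<in> G\<^sub>j\<close> the function \<open>W(f, g)\<close> differs from \<open>a\<^sup>i b\<^sup>j f g\<close> by lower order terms and is
  orthogonal to polynomials of degree less than \<open>i + j\<close>, so it is \<open>a\<^sup>i b\<^sup>j P\<^sub>i\<^sub>+\<^sub>j(f g)\<close>. Both sides satisfy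
  \<open>E[w e\<^sup>i\<^sup>h] = E[\<phi> e\<^sup>i\<^sup>a\<^sup>h] E[\<psi> e\<^sup>i\<^sup>b\<^sup>h]\<close> for all \<open>h \<in> H\<close>, an identity that is stable under
  convergence in \<open>L\<^sup>1\<close> and determines \<open>w\<close>.
\<close>

section \<open>Fourier uniqueness on path spaces\<close>

text \<open>What is known about \<open>w\<close> in the theorem is weak: there are some
  approximating sequences whose Wick expressions converge to it in L1. Its value must therefore be
  pinned down by a property that mentions neither chaos projections nor the sequences, and for this
  the exponentials are chosen as test functions. Two obstacles shape the rest. Exponentials of
  elements of \<open>H\<close> see only what is measurable for F(H), so every limit has to be
  recognised as a function of the path, up to null sets, before uniqueness can be invoked. Moreover
  a pointwise product of two chaos elements must be square integrable before
  \<open>chaos_proj\<close> says anything about it. This is secured by a norm bound for products of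
  polynomials whose constant depends on the degrees only; such constants never reach the final
  estimate, which comes from the integral operator alone. That a value exists at all is a separate
  matter: for polynomials only finitely many terms of the Wick series are nonzero, and polynomials
  turn out to be dense in L1.\<close>

lemma cis_measurable [measurable (raw)]:
  assumes [measurable]: "f \<in> borel_measurable N"
  shows "(\<lambda>x. cis (f x)) \<in> borel_measurable N"
  unfolding cis_conv_exp by measurable

text \<open>The value at \<open>t = 0\<close> is the total mass, so both measures have the same mass
  \<open>c\<close> and can be scaled to probability measures by the same factor, where Levy's
  uniqueness theorem applies; \<open>c = 0\<close> leaves two null measures.\<close>

lemma finite_measure_eqI_char:
  fixes M1 M2 :: "real measure"
  assumes "finite_measure M1" "finite_measure M2"
    and sets: "sets M1 = sets borel" "sets M2 = sets borel"
    and eq: "\<And>t. (\<integral>x. cis (t * x) \<partial>M1) = (\<integral>x. cis (t * x) \<partial>M2)"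
  shows "M1 = M2"
proof -
  interpret M1: finite_measure M1 by fact
  interpret M2: finite_measure M2 by fact
  have [simp]: "space M1 = UNIV" "space M2 = UNIV"
    using sets_eq_imp_space_eq[OF sets(1)] sets_eq_imp_space_eq[OF sets(2)] by simp_all
  define c where "c = measure M1 UNIV"
  have c2: "measure M2 UNIV = c"
    using eq[of 0] by (simp add: c_def)
  show ?thesis
  proof (cases "c = 0")
    case True
    have "emeasure M1 A = emeasure M2 A" for A
    proof -
      have "emeasure M1 UNIV = 0" "emeasure M2 UNIV = 0"
        using True c2 by (auto simp: c_def M1.emeasure_eq_measure M2.emeasure_eq_measure)
      then show ?thesis
        by (metis emeasure_eq_0 emeasure_notin_sets sets.top subset_UNIV
             \<open>space M1 = UNIV\<close> \<open>space M2 = UNIV\<close>)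
    qed
    then show ?thesis using sets by (intro measure_eqI) auto
  next
    case False
    then have c: "c > 0" by (simp add: c_def less_le)
    have main: "real_distribution (scale_measure (ennreal (1 / c)) N)"
      "char (scale_measure (ennreal (1 / c)) N) t = (1 / c) *\<^sub>R (\<integral>x. cis (t * x) \<partial>N)"
      if N: "finite_measure N" "sets N = sets borel" "measure N UNIV = c" for N :: "real measure" and t
    proof -
      interpret N: finite_measure N by fact
      have [simp]: "space N = UNIV" using sets_eq_imp_space_eq[OF N(2)] by simp
      have "emeasure N UNIV = ennreal c"
        using N(3) by (simp add: N.emeasure_eq_measure)
      then have "prob_space (scale_measure (ennreal (1 / c)) N)"
        using c by (intro prob_spaceI) (simp add: emeasure_scale_measure space_scale_measure ennreal_mult[symmetric])
      then show "real_distribution (scale_measure (ennreal (1 / c)) N)"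
        using N(2) by (simp add: real_distribution_def real_distribution_axioms_def)
      have eqd: "scale_measure (ennreal (1 / c)) N = density N (\<lambda>_. ennreal (1 / c))"
        by (intro measure_eqI) (auto simp: emeasure_density nn_integral_cmult)
      have meas: "(\<lambda>x. cis (t * x)) \<in> borel_measurable N"
        unfolding measurable_cong_sets[OF N(2) refl] by measurable
      show "char (scale_measure (ennreal (1 / c)) N) t = (1 / c) *\<^sub>R (\<integral>x. cis (t * x) \<partial>N)"
        unfolding char_def eqd
        using c meas by (subst integral_density) (auto simp: cis_conv_exp)
    qed
    have "scale_measure (ennreal (1 / c)) M1 = scale_measure (ennreal (1 / c)) M2"
    proof (intro Levy_uniqueness main ext)
      fix t
      show "char (scale_measure (ennreal (1 / c)) M1) t = char (scale_measure (ennreal (1 / c)) M2) t"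
        using main(2)[of M1 t] main(2)[of M2 t] assms c2 by (simp add: c_def)
    qed (use assms c2 in \<open>auto simp: c_def\<close>)
    then have "scale_measure (ennreal c) (scale_measure (ennreal (1 / c)) M1)
       = scale_measure (ennreal c) (scale_measure (ennreal (1 / c)) M2)" by simp
    then show ?thesis using c by (simp add: ennreal_mult[symmetric])
  qed
qed

text \<open>With a nonnegative weight as density, the law of \<open>X\<close> is a finite measure
  whose Fourier transform at \<open>t\<close> combines the cosine and sine integrals. The gain is an
  exchange: trigonometric functions of one coordinate become an indicator of it, while the weight
  may carry all other coordinates.\<close>

lemma weighted_distr_eqI_char:
  fixes X1 :: "'a \<Rightarrow> real" and X2 :: "'b \<Rightarrow> real"
  assumes [measurable]: "X1 \<in> borel_measurable N1" "X2 \<in> borel_measurable N2"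
    and i: "integrable N1 w1" "integrable N2 w2"
    and nn: "\<And>x. w1 x \<ge> (0::real)" "\<And>x. w2 x \<ge> (0::real)"
    and eq: "\<And>t. (\<integral>x. w1 x * cos (t * X1 x) \<partial>N1) = (\<integral>x. w2 x * cos (t * X2 x) \<partial>N2)"
      "\<And>t. (\<integral>x. w1 x * sin (t * X1 x) \<partial>N1) = (\<integral>x. w2 x * sin (t * X2 x) \<partial>N2)"
    and B: "B \<in> sets borel"
  shows "(\<integral>x. indicator B (X1 x) * w1 x \<partial>N1) = (\<integral>x. indicator B (X2 x) * w2 x \<partial>N2)"
proof -
  have [measurable]: "w1 \<in> borel_measurable N1" "w2 \<in> borel_measurable N2"
    using i by auto
  have fin: "finite_measure (distr (density N w) borel X)"
    if "integrable N w" "X \<in> borel_measurable N" "\<And>x. w x \<ge> 0"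
    for N :: "'c measure" and w :: "'c \<Rightarrow> real" and X :: "'c \<Rightarrow> real"
  proof -
    have "finite_measure (density N w)"
      using that by (intro finite_measureI) (simp add: emeasure_density nn_integral_eq_integral)
    then show ?thesis using that by (intro finite_measure.finite_measure_distr) auto
  qed
  have val: "(\<integral>x. cis (t * x) \<partial>distr (density N w) borel X)
      = Complex (\<integral>x. w x * cos (t * X x) \<partial>N) (\<integral>x. w x * sin (t * X x) \<partial>N)"
    if iw: "integrable N w" and [measurable]: "X \<in> borel_measurable N" and "\<And>x. w x \<ge> 0"
    for N :: "'c measure" and w :: "'c \<Rightarrow> real" and X :: "'c \<Rightarrow> real" and t
  proof -
    have [measurable]: "w \<in> borel_measurable N" using iw by auto
    have "(\<integral>x. cis (t * x) \<partial>distr (density N w) borel X) = (\<integral>x. w x *\<^sub>R cis (t * X x) \<partial>N)"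
      using that by (subst integral_distr, simp, simp, subst integral_density) auto
    moreover have "integrable N (\<lambda>x. w x *\<^sub>R cis (t * X x))"
      by (rule Bochner_Integration.integrable_bound[OF iw]) (auto simp: mult.commute[of t])
    ultimately show ?thesis
      by (simp add: complex_eq_iff flip: integral_Re integral_Im)
  qed
  have "distr (density N1 w1) borel X1 = distr (density N2 w2) borel X2" (is "?D1 = ?D2")
    using assms by (intro finite_measure_eqI_char fin) (auto simp: val eq)
  then have "(\<integral>x. indicator B x \<partial>?D1) = (\<integral>x. indicator B x \<partial>?D2 :: real)" by simp
  then show ?thesis using B nn
    by (subst (asm) (1 2) integral_distr, simp, simp, simp, simp, subst (asm) (1 2) integral_density)
       (auto simp: mult.commute)
qed

lemma prod_indicator:
  assumes "finite J"
  shows "(\<Prod>i\<in>J. indicator (A i) (z i)) = (if \<forall>i\<in>J. z i \<in> A i then 1 else 0 :: real)"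
  using assms by induction auto

text \<open>
  Multivariate uniqueness of characteristic functions is reduced to one dimension by replacing
  exponentials by indicators one coordinate at a time. The exponentials enter through the factors
  \<open>1 + cos (f x + c)\<close>, which are nonnegative, so that only positive measures occur.
\<close>

locale char_matched =
  N1: finite_measure N1 + N2: finite_measure N2
  for N1 :: "'a measure" and N2 :: "'b measure" and P :: "(('a \<Rightarrow> real) \<times> ('b \<Rightarrow> real)) set" +
  assumes P_meas: "\<And>f g. (f, g) \<in> P \<Longrightarrow> f \<in> borel_measurable N1 \<and> g \<in> borel_measurable N2"
    and P_add: "\<And>f g f' g'. (f, g) \<in> P \<Longrightarrow> (f', g') \<in> P \<Longrightarrow> ((\<lambda>x. f x + f' x), (\<lambda>x. g x + g' x)) \<in> P"
    and P_scale: "\<And>f g c. (f, g) \<in> P \<Longrightarrow> ((\<lambda>x. c * f x), (\<lambda>x. c * g x)) \<in> P"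
    and char_eq: "\<And>f g. (f, g) \<in> P \<Longrightarrow> (\<integral>x. cis (f x) \<partial>N1) = (\<integral>x. cis (g x) \<partial>N2)"
begin

text \<open>Each entry holds a matched pair, so that one list describes corresponding weights on
  both spaces.\<close>

definition wt1 :: "((('a \<Rightarrow> real) \<times> ('b \<Rightarrow> real)) \<times> real) list \<Rightarrow> 'a \<Rightarrow> real"
  where "wt1 ws x = (\<Prod>((f, g), c)\<leftarrow>ws. 1 + cos (f x + c))"
definition wt2 :: "((('a \<Rightarrow> real) \<times> ('b \<Rightarrow> real)) \<times> real) list \<Rightarrow> 'b \<Rightarrow> real"
  where "wt2 ws x = (\<Prod>((f, g), c)\<leftarrow>ws. 1 + cos (g x + c))"
definition ind1 :: "((('a \<Rightarrow> real) \<times> ('b \<Rightarrow> real)) \<times> real set) list \<Rightarrow> 'a \<Rightarrow> real"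
  where "ind1 bs x = (\<Prod>((f, g), B)\<leftarrow>bs. indicator B (f x))"
definition ind2 :: "((('a \<Rightarrow> real) \<times> ('b \<Rightarrow> real)) \<times> real set) list \<Rightarrow> 'b \<Rightarrow> real"
  where "ind2 bs x = (\<Prod>((f, g), B)\<leftarrow>bs. indicator B (g x))"

lemma wt_simps:
  "wt1 [] x = 1" "wt2 [] y = 1"
  "wt1 (((f, g), c) # ws) x = (1 + cos (f x + c)) * wt1 ws x"
  "wt2 (((f, g), c) # ws) y = (1 + cos (g y + c)) * wt2 ws y"
  "ind1 [] x = 1" "ind2 [] y = 1"
  "ind1 (((f, g), B) # bs) x = indicator B (f x) * ind1 bs x"
  "ind2 (((f, g), B) # bs) y = indicator B (g y) * ind2 bs y"
  by (simp_all add: wt1_def wt2_def ind1_def ind2_def)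

lemma wt_bounds: "0 \<le> wt1 ws x" "wt1 ws x \<le> 2 ^ length ws" "0 \<le> wt2 ws y" "wt2 ws y \<le> 2 ^ length ws"
proof -
  have "0 \<le> 1 + cos t" "1 + cos t \<le> 2" for t :: real
    using cos_ge_minus_one[of t] cos_le_one[of t] by linarith+
  then have "0 \<le> wt1 ws x \<and> wt1 ws x \<le> 2 ^ length ws \<and> 0 \<le> wt2 ws y \<and> wt2 ws y \<le> 2 ^ length ws"
    by (induction ws) (auto simp: wt_simps intro!: mult_mono)
  then show "0 \<le> wt1 ws x" "wt1 ws x \<le> 2 ^ length ws" "0 \<le> wt2 ws y" "wt2 ws y \<le> 2 ^ length ws"
    by auto
qed

lemma ind_bounds: "0 \<le> ind1 bs x" "ind1 bs x \<le> 1" "0 \<le> ind2 bs y" "ind2 bs y \<le> 1"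
proof -
  have "0 \<le> ind1 bs x \<and> ind1 bs x \<le> 1 \<and> 0 \<le> ind2 bs y \<and> ind2 bs y \<le> 1"
    by (induction bs) (auto simp: wt_simps split: split_indicator)
  then show "0 \<le> ind1 bs x" "ind1 bs x \<le> 1" "0 \<le> ind2 bs y" "ind2 bs y \<le> 1" by auto
qed

lemma wt_measurable:
  assumes "fst ` set ws \<subseteq> P"
  shows "wt1 ws \<in> borel_measurable N1" "wt2 ws \<in> borel_measurable N2"
proof -
  have "wt1 ws \<in> borel_measurable N1 \<and> wt2 ws \<in> borel_measurable N2"
    using assms
  proof (induction ws)
    case Nil
    then show ?case by (simp add: wt_simps[abs_def])
  next
    case (Cons a ws)
    obtain f g c where a: "a = ((f, g), c)" by (metis prod.exhaust)
    have [measurable]: "f \<in> borel_measurable N1" "g \<in> borel_measurable N2"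
      using Cons P_meas[of f g] by (auto simp: a)
    have [measurable]: "wt1 ws \<in> borel_measurable N1" "wt2 ws \<in> borel_measurable N2"
      using Cons by auto
    show ?case unfolding a wt_simps[abs_def] by measurable
  qed
  then show "wt1 ws \<in> borel_measurable N1" "wt2 ws \<in> borel_measurable N2" by auto
qed

lemma ind_measurable:
  assumes "\<forall>(p, B)\<in>set bs. p \<in> P \<and> B \<in> sets borel"
  shows "ind1 bs \<in> borel_measurable N1" "ind2 bs \<in> borel_measurable N2"
proof -
  have "ind1 bs \<in> borel_measurable N1 \<and> ind2 bs \<in> borel_measurable N2"
    using assms
  proof (induction bs)
    case Nil
    then show ?case by (simp add: wt_simps[abs_def])
  next
    case (Cons a bs)
    obtain f g B where a: "a = ((f, g), B)" by (metis prod.exhaust)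
    have [measurable]: "f \<in> borel_measurable N1" "g \<in> borel_measurable N2" "B \<in> sets borel"
      using Cons P_meas[of f g] by (auto simp: a)
    have [measurable]: "ind1 bs \<in> borel_measurable N1" "ind2 bs \<in> borel_measurable N2"
      using Cons by auto
    show ?case unfolding a wt_simps[abs_def] by measurable
  qed
  then show "ind1 bs \<in> borel_measurable N1" "ind2 bs \<in> borel_measurable N2" by auto
qed

text \<open>Euler's formula writes a factor \<open>1 + cos (f' x + c)\<close> as a combination of 1
  and the exponentials of \<open>f'\<close> and \<open>- f'\<close>. Absorbing it replaces
  \<open>f\<close> by \<open>f + s f'\<close> with \<open>s\<close> among 0, 1 and -1; since
  \<open>P\<close> is closed under these shifts, the induction keeps \<open>f\<close> and
  \<open>g\<close> arbitrary.\<close>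

lemma integral_cis_wt_eq:
  assumes "fst ` set ws \<subseteq> P" "(f, g) \<in> P"
  shows "(\<integral>x. cis (f x) * of_real (wt1 ws x) \<partial>N1) = (\<integral>x. cis (g x) * of_real (wt2 ws x) \<partial>N2)"
  using assms
proof (induction ws arbitrary: f g)
  case Nil
  then show ?case by (simp add: wt_simps char_eq)
next
  case (Cons a ws)
  obtain f' g' c where a: "a = ((f', g'), c)" by (metis prod.exhaust)
  have P': "(f', g') \<in> P" and ws: "fst ` set ws \<subseteq> P" using Cons by (auto simp: a)
  define u where "u s = ((\<lambda>x. f x + s * f' x))" for s
  define v where "v s = ((\<lambda>x. g x + s * g' x))" for s
  have uv: "(u s, v s) \<in> P" for s
    unfolding u_def v_def using P' Cons.prems by (intro P_add P_scale)
  have i1: "integrable N1 (\<lambda>x. cis (u s x) * of_real (wt1 ws x))" for s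
    using wt_measurable[OF ws] uv[of s, THEN P_meas] wt_bounds[of ws]
    by (intro N1.integrable_const_bound[of _ "2 ^ length ws"] AE_I2 borel_measurable_times cis_measurable)
       (auto simp: norm_mult)
  have i2: "integrable N2 (\<lambda>x. cis (v s x) * of_real (wt2 ws x))" for s
    using wt_measurable[OF ws] uv[of s, THEN P_meas] wt_bounds[of ws]
    by (intro N2.integrable_const_bound[of _ "2 ^ length ws"] AE_I2 borel_measurable_times cis_measurable)
       (auto simp: norm_mult)
  have cosE: "complex_of_real (1 + cos (y + c)) = 1 + cis c / 2 * cis y + cis (- c) / 2 * cis (- y)" for y
    by (simp add: complex_eq_iff cos_add field_simps)
  have e1: "cis (f x) * of_real (wt1 (a # ws) x) = cis (u 0 x) * of_real (wt1 ws x)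
     + cis c / 2 * (cis (u 1 x) * of_real (wt1 ws x)) + cis (- c) / 2 * (cis (u (-1) x) * of_real (wt1 ws x))" for x
    unfolding a wt_simps of_real_mult cosE u_def by (simp add: algebra_simps cis_mult flip: cis_divide)
  have e2: "cis (g x) * of_real (wt2 (a # ws) x) = cis (v 0 x) * of_real (wt2 ws x)
     + cis c / 2 * (cis (v 1 x) * of_real (wt2 ws x)) + cis (- c) / 2 * (cis (v (-1) x) * of_real (wt2 ws x))" for x
    unfolding a wt_simps of_real_mult cosE v_def by (simp add: algebra_simps cis_mult flip: cis_divide)
  show ?case
    unfolding e1 e2
    using i1 i2 by (simp add: Cons.IH[OF ws uv])
qed

text \<open>Each step gains one indicator at the price of one more cosine factor in the weight,
  which is why \<open>ws\<close> stays arbitrary in the induction.\<close>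

lemma integral_ind_wt_eq:
  assumes "\<forall>(p, B)\<in>set bs. p \<in> P \<and> B \<in> sets borel" "fst ` set ws \<subseteq> P" "P \<noteq> {}"
  shows "(\<integral>x. ind1 bs x * wt1 ws x \<partial>N1) = (\<integral>x. ind2 bs x * wt2 ws x \<partial>N2)"
  using assms
proof (induction bs arbitrary: ws)
  case Nil
  obtain f g where "(f, g) \<in> P" using Nil by auto
  from P_scale[OF this, of 0] have "((\<lambda>x. 0), (\<lambda>x. 0)) \<in> P" by simp
  from integral_cis_wt_eq[OF Nil(2) this] show ?case by (simp add: wt_simps)
next
  case (Cons a bs)
  obtain f g B where a: "a = ((f, g), B)" by (metis prod.exhaust)
  have P: "(f, g) \<in> P" and B: "B \<in> sets borel" and bs: "\<forall>(p, B)\<in>set bs. p \<in> P \<and> B \<in> sets borel"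
    using Cons.prems by (auto simp: a)
  have meas: "ind1 bs \<in> borel_measurable N1" "ind2 bs \<in> borel_measurable N2"
    using ind_measurable[OF bs] by auto
  have I1: "integrable N1 (\<lambda>x. ind1 bs x * wt1 ws x)" if "fst ` set ws \<subseteq> P" for ws
    using meas wt_measurable[OF that] wt_bounds[of ws] ind_bounds[of bs]
    by (intro N1.integrable_const_bound[of _ "2 ^ length ws"] AE_I2 borel_measurable_times)
       (auto simp: abs_mult intro!: mult_le_one[where 'a=real] order_trans[OF mult_left_le_one_le])
  have I2: "integrable N2 (\<lambda>x. ind2 bs x * wt2 ws x)" if "fst ` set ws \<subseteq> P" for ws
    using meas wt_measurable[OF that] wt_bounds[of ws] ind_bounds[of bs]
    by (intro N2.integrable_const_bound[of _ "2 ^ length ws"] AE_I2 borel_measurable_times)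
       (auto simp: abs_mult intro!: mult_le_one[where 'a=real] order_trans[OF mult_left_le_one_le])
  \<comment> \<open>Write the cosine as \<open>(1 + cos y) - 1\<close>: both terms are weights of
    the admissible shape, and the induction hypothesis covers each.\<close>
  have cosc: "(\<integral>x. ind1 bs x * wt1 ws x * cos (t * f x + c) \<partial>N1)
      = (\<integral>x. ind2 bs x * wt2 ws x * cos (t * g x + c) \<partial>N2)" for t c
  proof -
    let ?ws = "(((\<lambda>x. t * f x), (\<lambda>x. t * g x)), c) # ws"
    have ws': "fst ` set ?ws \<subseteq> P" using Cons.prems P_scale[OF P] by auto
    have "(\<integral>x. ind1 bs x * wt1 ws x * cos (t * f x + c) \<partial>N1)
       = (\<integral>x. ind1 bs x * wt1 ?ws x - ind1 bs x * wt1 ws x \<partial>N1)"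
      by (intro Bochner_Integration.integral_cong) (auto simp: wt_simps algebra_simps)
    also have "\<dots> = (\<integral>x. ind1 bs x * wt1 ?ws x \<partial>N1) - (\<integral>x. ind1 bs x * wt1 ws x \<partial>N1)"
      using I1[OF ws'] I1[OF Cons.prems(2)] by (rule Bochner_Integration.integral_diff)
    also have "\<dots> = (\<integral>x. ind2 bs x * wt2 ?ws x \<partial>N2) - (\<integral>x. ind2 bs x * wt2 ws x \<partial>N2)"
      using Cons.IH[OF bs ws' \<open>P \<noteq> {}\<close>] Cons.IH[OF bs Cons.prems(2) \<open>P \<noteq> {}\<close>] by simp
    also have "\<dots> = (\<integral>x. ind2 bs x * wt2 ?ws x - ind2 bs x * wt2 ws x \<partial>N2)"
      using I2[OF ws'] I2[OF Cons.prems(2)] by (rule Bochner_Integration.integral_diff[symmetric])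
    also have "\<dots> = (\<integral>x. ind2 bs x * wt2 ws x * cos (t * g x + c) \<partial>N2)"
      by (intro Bochner_Integration.integral_cong) (auto simp: wt_simps algebra_simps)
    finally show ?thesis .
  qed
  have "(\<integral>x. indicator B (f x) * (ind1 bs x * wt1 ws x) \<partial>N1) = (\<integral>x. indicator B (g x) * (ind2 bs x * wt2 ws x) \<partial>N2)"
  proof (rule weighted_distr_eqI_char)
    fix t
    show "(\<integral>x. ind1 bs x * wt1 ws x * cos (t * f x) \<partial>N1) = (\<integral>x. ind2 bs x * wt2 ws x * cos (t * g x) \<partial>N2)"
      using cosc[of t 0] by simp
    \<comment> \<open>A sine is a cosine with phase \<open>- (pi / 2)\<close>; the phases carried by
      the weights serve this case.\<close>
    have sin_cos: "sin y = cos (y + - (pi / 2))" for y :: real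
      by (simp add: cos_diff)
    show "(\<integral>x. ind1 bs x * wt1 ws x * sin (t * f x) \<partial>N1) = (\<integral>x. ind2 bs x * wt2 ws x * sin (t * g x) \<partial>N2)"
      unfolding sin_cos by (rule cosc)
  qed (simp_all add: P_meas[OF P] B I1[OF Cons.prems(2)] I2[OF Cons.prems(2)] wt_bounds ind_bounds)
  then show ?case by (simp add: a wt_simps mult.assoc)
qed

text \<open>A cylinder set involves only finitely many coordinates and its indicator is a product of
  one-dimensional ones, so the preceding identity with the empty weight list gives its measure. The
  index set \<open>I\<close> may be of any size, as is needed for families indexed by all of
  \<open>H\<close>.\<close>

theorem distr_PiM_eq:
  assumes P: "\<And>i. i \<in> I \<Longrightarrow> (Z1 i, Z2 i) \<in> P" and "P \<noteq> {}"
  shows "distr N1 (PiM I (\<lambda>_. borel)) (\<lambda>x. \<lambda>i\<in>I. Z1 i x) = distr N2 (PiM I (\<lambda>_. borel)) (\<lambda>x. \<lambda>i\<in>I. Z2 i x)"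
proof -
  have [measurable]: "(\<lambda>x. \<lambda>i\<in>I. Z1 i x) \<in> measurable N1 (PiM I (\<lambda>_. borel))"
    "(\<lambda>x. \<lambda>i\<in>I. Z2 i x) \<in> measurable N2 (PiM I (\<lambda>_. borel))"
    using P P_meas by (auto intro!: measurable_restrict)
  show ?thesis
  proof (rule measure_eqI_PiM_infinite)
    show "finite_measure (distr N1 (Pi\<^sub>M I (\<lambda>_. borel)) (\<lambda>x. \<lambda>i\<in>I. Z1 i x))"
      by (intro N1.finite_measure_distr) measurable
    fix A :: "'c \<Rightarrow> real set" and J assume J: "finite J" "J \<subseteq> I" and A: "\<And>i. i \<in> J \<Longrightarrow> A i \<in> sets borel"
    obtain js where js: "set js = J" "distinct js" using finite_distinct_list[OF J(1)] by auto
    define bs where "bs = map (\<lambda>i. ((Z1 i, Z2 i), A i)) js"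
    have bs: "\<forall>(p, B)\<in>set bs. p \<in> P \<and> B \<in> sets borel"
      using P A J js by (auto simp: bs_def)
    have [measurable]: "prod_emb I (\<lambda>_. borel) J (Pi\<^sub>E J A) \<in> sets (PiM I (\<lambda>_. borel))"
      using J A by (intro sets_PiM_I) auto
    have restr: "(\<lambda>i\<in>I. z i) \<in> prod_emb I (\<lambda>_. borel) J (Pi\<^sub>E J A) \<longleftrightarrow> (\<forall>i\<in>J. z i \<in> A i)" for z
      using J(2) by (auto simp: prod_emb_def space_PiM PiE_iff restrict_restrict Int_absorb1 subset_eq)
    have i1: "ind1 bs x = indicator (prod_emb I (\<lambda>_. borel) J (Pi\<^sub>E J A)) (\<lambda>i\<in>I. Z1 i x)" for x
    proof -
      have "ind1 bs x = (\<Prod>i\<in>J. indicator (A i) (Z1 i x))"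
        using js by (simp add: ind1_def bs_def comp_def flip: prod.distinct_set_conv_list)
      also have "\<dots> = indicator (prod_emb I (\<lambda>_. borel) J (Pi\<^sub>E J A)) (\<lambda>i\<in>I. Z1 i x)"
        unfolding prod_indicator[OF J(1)] using restr by (simp add: indicator_def)
      finally show ?thesis .
    qed
    have i2: "ind2 bs x = indicator (prod_emb I (\<lambda>_. borel) J (Pi\<^sub>E J A)) (\<lambda>i\<in>I. Z2 i x)" for x
    proof -
      have "ind2 bs x = (\<Prod>i\<in>J. indicator (A i) (Z2 i x))"
        using js by (simp add: ind2_def bs_def comp_def flip: prod.distinct_set_conv_list)
      also have "\<dots> = indicator (prod_emb I (\<lambda>_. borel) J (Pi\<^sub>E J A)) (\<lambda>i\<in>I. Z2 i x)"
        unfolding prod_indicator[OF J(1)] using restr by (simp add: indicator_def)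
      finally show ?thesis .
    qed
    have "(\<integral>x. indicator (prod_emb I (\<lambda>_. borel) J (Pi\<^sub>E J A)) (\<lambda>i\<in>I. Z1 i x) \<partial>N1)
        = (\<integral>x. indicator (prod_emb I (\<lambda>_. borel) J (Pi\<^sub>E J A)) (\<lambda>i\<in>I. Z2 i x) \<partial>N2 :: real)"
      using integral_ind_wt_eq[OF bs, of "[]"] assms(2) by (simp add: wt_simps i1 i2)
    then have "(\<integral>x. indicator (prod_emb I (\<lambda>_. borel) J (Pi\<^sub>E J A)) x \<partial>distr N1 (Pi\<^sub>M I (\<lambda>_. borel)) (\<lambda>x. \<lambda>i\<in>I. Z1 i x))
        = (\<integral>x. indicator (prod_emb I (\<lambda>_. borel) J (Pi\<^sub>E J A)) x \<partial>distr N2 (Pi\<^sub>M I (\<lambda>_. borel)) (\<lambda>x. \<lambda>i\<in>I. Z2 i x) :: real)"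
      by (subst (1 2) integral_distr) auto
    then have "measure (distr N1 (Pi\<^sub>M I (\<lambda>_. borel)) (\<lambda>x. \<lambda>i\<in>I. Z1 i x)) (prod_emb I (\<lambda>_. borel) J (Pi\<^sub>E J A))
      = measure (distr N2 (Pi\<^sub>M I (\<lambda>_. borel)) (\<lambda>x. \<lambda>i\<in>I. Z2 i x)) (prod_emb I (\<lambda>_. borel) J (Pi\<^sub>E J A))"
      by (simp add: prod_emb_def space_PiM Int_absorb2)
    then show "emeasure (distr N1 (Pi\<^sub>M I (\<lambda>_. borel)) (\<lambda>x. \<lambda>i\<in>I. Z1 i x)) (prod_emb I (\<lambda>_. borel) J (Pi\<^sub>E J A))
      = emeasure (distr N2 (Pi\<^sub>M I (\<lambda>_. borel)) (\<lambda>x. \<lambda>i\<in>I. Z2 i x)) (prod_emb I (\<lambda>_. borel) J (Pi\<^sub>E J A))"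
      by (subst (1 2) finite_measure.emeasure_eq_measure)
         (auto intro!: N1.finite_measure_distr N2.finite_measure_distr)
  qed auto
qed

end

section \<open>Square integrable functions\<close>

text \<open>\<open>dist2\<close> is a squared distance; its root obeys the triangle inequality and
  is therefore the quantity used in the estimates.\<close>

definition norm2 :: "'a measure \<Rightarrow> ('a \<Rightarrow> complex) \<Rightarrow> real" where
  "norm2 M f = sqrt (\<integral>x. (cmod (f x))\<^sup>2 \<partial>M)"

lemma norm2_nonneg [simp]: "0 \<le> norm2 M f"
  by (simp add: norm2_def)

lemma norm2_sq: "(norm2 M f)\<^sup>2 = (\<integral>x. (cmod (f x))\<^sup>2 \<partial>M)"
  by (simp add: norm2_def)

lemma dist2_norm2: "dist2 M f g = (norm2 M (\<lambda>x. f x - g x))\<^sup>2"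
  by (simp add: norm2_sq dist2_def)

lemma L2cD: "f \<in> L2c M \<Longrightarrow> f \<in> borel_measurable M" "f \<in> L2c M \<Longrightarrow> integrable M (\<lambda>x. (cmod (f x))\<^sup>2)"
  by (auto simp: L2c_def)

lemma L2c_cmult: assumes "f \<in> L2c M" shows "(\<lambda>x. c * f x) \<in> L2c M"
  using assms by (auto simp: L2c_def norm_mult power_mult_distrib)

lemma borel_measurable_cnj [measurable (raw)]:
  assumes "f \<in> borel_measurable M"
  shows "(\<lambda>x. cnj (f x)) \<in> borel_measurable M"
  using assms by (rule measurable_compose) (intro borel_measurable_continuous_onI continuous_intros)

lemma L2c_cnj: assumes "f \<in> L2c M" shows "(\<lambda>x. cnj (f x)) \<in> L2c M"
  using assms by (auto simp: L2c_def)

lemma L2c_add: assumes "f \<in> L2c M" "g \<in> L2c M" shows "(\<lambda>x. f x + g x) \<in> L2c M"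
proof -
  have [measurable]: "f \<in> borel_measurable M" "g \<in> borel_measurable M" using assms by (auto dest: L2cD)
  have "integrable M (\<lambda>x. 2 * (cmod (f x))\<^sup>2 + 2 * (cmod (g x))\<^sup>2)"
    using assms by (auto simp: L2c_def)
  moreover have "(cmod (f x + g x))\<^sup>2 \<le> 2 * (cmod (f x))\<^sup>2 + 2 * (cmod (g x))\<^sup>2" for x
  proof -
    have "(cmod (f x + g x))\<^sup>2 \<le> (cmod (f x) + cmod (g x))\<^sup>2"
      by (intro power_mono norm_triangle_ineq) auto
    also have "\<dots> \<le> 2 * (cmod (f x))\<^sup>2 + 2 * (cmod (g x))\<^sup>2"
      using sum_squares_bound[of "cmod (f x)" "cmod (g x)"] by (simp add: power2_sum)
    finally show ?thesis .
  qed
  ultimately have "integrable M (\<lambda>x. (cmod (f x + g x))\<^sup>2)"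
    by (elim Bochner_Integration.integrable_bound) auto
  then show ?thesis by (simp add: L2c_def)
qed

lemma L2c_diff: assumes "f \<in> L2c M" "g \<in> L2c M" shows "(\<lambda>x. f x - g x) \<in> L2c M"
  using L2c_add[OF assms(1) L2c_cmult[OF assms(2), of "-1"]] by simp

lemma L2c_zero: "(\<lambda>x. 0) \<in> L2c M"
  by (simp add: L2c_def)

lemma integrable_mult_cis:
  fixes f :: "'a \<Rightarrow> complex"
  assumes f: "integrable M f" and [measurable]: "h \<in> borel_measurable M"
  shows "integrable M (\<lambda>x. f x * cis (h x))"
proof -
  have [measurable]: "f \<in> borel_measurable M" using f by auto
  show ?thesis by (rule Bochner_Integration.integrable_bound[OF f]) (auto simp: norm_mult)
qed

lemma integrable_mult_L2c:
  assumes "f \<in> L2c M" "g \<in> L2c M"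
  shows "integrable M (\<lambda>x. f x * g x)"
proof -
  have [measurable]: "f \<in> borel_measurable M" "g \<in> borel_measurable M" using assms by (auto dest: L2cD)
  have "integrable M (\<lambda>x. (cmod (f x))\<^sup>2 + (cmod (g x))\<^sup>2)"
    using assms by (auto simp: L2c_def)
  moreover have "cmod (f x * g x) \<le> (cmod (f x))\<^sup>2 + (cmod (g x))\<^sup>2" for x
  proof -
    have "2 * (cmod (f x) * cmod (g x)) \<le> (cmod (f x))\<^sup>2 + (cmod (g x))\<^sup>2"
      using sum_squares_bound[of "cmod (f x)" "cmod (g x)"] by simp
    moreover have "0 \<le> cmod (f x) * cmod (g x)" by simp
    ultimately show ?thesis unfolding norm_mult by linarith
  qed
  ultimately show ?thesis by (elim Bochner_Integration.integrable_bound) auto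
qed

lemma integrable_mult_cnj_L2c:
  assumes "f \<in> L2c M" "g \<in> L2c M"
  shows "integrable M (\<lambda>x. f x * cnj (g x))"
  using integrable_mult_L2c[OF assms(1) L2c_cnj[OF assms(2)]] .

lemma inner2_add_left: "f \<in> L2c M \<Longrightarrow> g \<in> L2c M \<Longrightarrow> h \<in> L2c M \<Longrightarrow>
    inner2 M (\<lambda>x. f x + g x) h = inner2 M f h + inner2 M g h"
  by (simp add: inner2_def distrib_right integrable_mult_cnj_L2c)

lemma inner2_diff_left: "f \<in> L2c M \<Longrightarrow> g \<in> L2c M \<Longrightarrow> h \<in> L2c M \<Longrightarrow>
    inner2 M (\<lambda>x. f x - g x) h = inner2 M f h - inner2 M g h"
  by (simp add: inner2_def left_diff_distrib integrable_mult_cnj_L2c)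

lemma inner2_cmult_left: "inner2 M (\<lambda>x. c * f x) h = c * inner2 M f h"
  by (simp add: inner2_def mult.assoc)

lemma inner2_commute: "inner2 M f g = cnj (inner2 M g f)"
  unfolding inner2_def by (subst Bochner_Integration.integral_cnj[symmetric]) (simp add: mult.commute)

lemma inner2_self: "inner2 M f f = of_real ((norm2 M f)\<^sup>2)"
  unfolding inner2_def norm2_sq by (simp only: complex_norm_square flip: integral_complex_of_real)

lemma inner2_cong_AE:
  assumes "AE x in M. f x = f' x" "AE x in M. g x = g' x"
    "f \<in> borel_measurable M" "f' \<in> borel_measurable M" "g \<in> borel_measurable M" "g' \<in> borel_measurable M"
  shows "inner2 M f g = inner2 M f' g'"
  unfolding inner2_def using assms by (intro integral_cong_AE) auto

lemma norm2_cong_AE: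
  assumes "AE x in M. f x = f' x" "f \<in> borel_measurable M" "f' \<in> borel_measurable M"
  shows "norm2 M f = norm2 M f'"
  unfolding norm2_def using assms by (intro arg_cong[where f=sqrt] integral_cong_AE) auto

lemma norm2_cmult: "norm2 M (\<lambda>x. c * f x) = cmod c * norm2 M f"
  by (simp add: norm2_def norm_mult power_mult_distrib real_sqrt_mult)

lemma norm2_minus_commute: "norm2 M (\<lambda>x. f x - g x) = norm2 M (\<lambda>x. g x - f x)"
  by (simp add: norm2_def norm_minus_commute)

lemma norm2_cnj: "norm2 M (\<lambda>x. cnj (f x)) = norm2 M f"
  by (simp add: norm2_def)

lemma norm2_zero [simp]: "norm2 M (\<lambda>x. 0) = 0"
  by (simp add: norm2_def)

lemma integral_mult_le_norm2:
  assumes "f \<in> L2c M" "g \<in> L2c M"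
  shows "(\<integral>x. cmod (f x) * cmod (g x) \<partial>M) \<le> norm2 M f * norm2 M g"
proof -
  have [measurable]: "f \<in> borel_measurable M" "g \<in> borel_measurable M" using assms by (auto dest: L2cD)
  have i: "integrable M (\<lambda>x. cmod (f x) * cmod (g x))"
    using integrable_norm[OF integrable_mult_L2c[OF assms]] by (simp add: norm_mult)
  have "(\<integral>\<^sup>+x. cmod (f x) * cmod (g x) \<partial>M)\<^sup>2
      \<le> (\<integral>\<^sup>+x. (cmod (f x))\<^sup>2 \<partial>M) * (\<integral>\<^sup>+x. (cmod (g x))\<^sup>2 \<partial>M)"
    using Cauchy_Schwarz_nn_integral[of "\<lambda>x. ennreal (cmod (f x))" M "\<lambda>x. ennreal (cmod (g x))"]
    by (simp add: ennreal_mult ennreal_power)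
  also have "\<dots> = ennreal ((norm2 M f * norm2 M g)\<^sup>2)"
    using assms by (simp add: nn_integral_eq_integral L2cD norm2_sq ennreal_mult power_mult_distrib)
  finally have "ennreal ((\<integral>x. cmod (f x) * cmod (g x) \<partial>M)\<^sup>2) \<le> ennreal ((norm2 M f * norm2 M g)\<^sup>2)"
    using i by (simp add: nn_integral_eq_integral ennreal_power)
  then have "(\<integral>x. cmod (f x) * cmod (g x) \<partial>M)\<^sup>2 \<le> (norm2 M f * norm2 M g)\<^sup>2"
    by (subst (asm) ennreal_le_iff) auto
  then show ?thesis
    by (rule power2_le_imp_le) simp
qed

lemma norm_integral_mult_le:
  assumes "f \<in> L2c M" "g \<in> L2c M"
  shows "cmod (\<integral>x. f x * g x \<partial>M) \<le> norm2 M f * norm2 M g"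
  by (rule order_trans[OF integral_norm_bound])
     (use integral_mult_le_norm2[OF assms] in \<open>simp add: norm_mult\<close>)

lemma norm_inner2_le:
  assumes "f \<in> L2c M" "g \<in> L2c M"
  shows "cmod (inner2 M f g) \<le> norm2 M f * norm2 M g"
  using norm_integral_mult_le[OF assms(1) L2c_cnj[OF assms(2)]] by (simp add: inner2_def norm2_cnj)

lemma norm2_add_sq:
  assumes "f \<in> L2c M" "g \<in> L2c M"
  shows "(norm2 M (\<lambda>x. f x + g x))\<^sup>2 = (norm2 M f)\<^sup>2 + (norm2 M g)\<^sup>2 + 2 * Re (inner2 M f g)"
proof -
  have "(\<integral>x. (cmod (f x + g x))\<^sup>2 \<partial>M) = (\<integral>x. (cmod (f x))\<^sup>2 + (cmod (g x))\<^sup>2 + 2 * Re (f x * cnj (g x)) \<partial>M)"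
    by (intro Bochner_Integration.integral_cong refl)
       (simp only: cmod_power2, simp add: power2_eq_square algebra_simps)
  also have "\<dots> = (\<integral>x. (cmod (f x))\<^sup>2 \<partial>M) + (\<integral>x. (cmod (g x))\<^sup>2 \<partial>M) + 2 * (\<integral>x. Re (f x * cnj (g x)) \<partial>M)"
    using assms integrable_Re[OF integrable_mult_cnj_L2c[OF assms]]
    by (simp add: L2cD del: times_complex.sel)
  also have "(\<integral>x. Re (f x * cnj (g x)) \<partial>M) = Re (inner2 M f g)"
    unfolding inner2_def using integrable_mult_cnj_L2c[OF assms] by (rule integral_Re)
  finally show ?thesis by (simp add: norm2_sq)
qed

lemma norm2_triangle:
  assumes "f \<in> L2c M" "g \<in> L2c M"
  shows "norm2 M (\<lambda>x. f x + g x) \<le> norm2 M f + norm2 M g"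
proof (rule power2_le_imp_le)
  have "Re (inner2 M f g) \<le> norm2 M f * norm2 M g"
    using norm_inner2_le[OF assms] complex_Re_le_cmod order_trans by blast
  then show "(norm2 M (\<lambda>x. f x + g x))\<^sup>2 \<le> (norm2 M f + norm2 M g)\<^sup>2"
    unfolding norm2_add_sq[OF assms] by (simp add: power2_sum)
qed simp

lemma norm2_triangle_diff:
  assumes "f \<in> L2c M" "g \<in> L2c M" "h \<in> L2c M"
  shows "norm2 M (\<lambda>x. f x - h x) \<le> norm2 M (\<lambda>x. f x - g x) + norm2 M (\<lambda>x. g x - h x)"
  using norm2_triangle[OF L2c_diff[OF assms(1,2)] L2c_diff[OF assms(2,3)]] by simp

lemma norm2_triangle_minus:
  assumes "f \<in> L2c M" "g \<in> L2c M"
  shows "norm2 M (\<lambda>x. f x - g x) \<le> norm2 M f + norm2 M g"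
  using norm2_triangle[OF assms(1) L2c_cmult[OF assms(2), of "-1"]] norm2_cmult[of M "-1" g] by simp

lemma norm2_eq_0_AE:
  assumes "f \<in> L2c M"
  shows "norm2 M f = 0 \<longleftrightarrow> (AE x in M. f x = 0)"
proof -
  have "norm2 M f = 0 \<longleftrightarrow> (AE x in M. (cmod (f x))\<^sup>2 = 0)"
    unfolding norm2_def real_sqrt_eq_0_iff
    by (rule integral_nonneg_eq_0_iff_AE) (use assms in \<open>auto simp: L2cD\<close>)
  then show ?thesis by simp
qed

lemma inner2_tendsto:
  assumes "\<And>n. f n \<in> L2c M" "g \<in> L2c M" "h \<in> L2c M" "(\<lambda>n. norm2 M (\<lambda>x. f n x - g x)) \<longlonglongrightarrow> 0"
  shows "(\<lambda>n. inner2 M (f n) h) \<longlonglongrightarrow> inner2 M g h"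
proof (rule LIM_zero_cancel, rule Lim_null_comparison)
  show "\<forall>\<^sub>F n in sequentially. norm (inner2 M (f n) h - inner2 M g h) \<le> norm2 M (\<lambda>x. f n x - g x) * norm2 M h"
    using norm_inner2_le[OF L2c_diff[OF assms(1,2)] assms(3)] assms
    by (auto simp: inner2_diff_left)
  show "(\<lambda>n. norm2 M (\<lambda>x. f n x - g x) * norm2 M h) \<longlonglongrightarrow> 0"
    using tendsto_mult_left_zero[OF assms(4)] .
qed

lemma norm2_tendsto:
  assumes "\<And>n. f n \<in> L2c M" "g \<in> L2c M" "(\<lambda>n. norm2 M (\<lambda>x. f n x - g x)) \<longlonglongrightarrow> 0"
  shows "(\<lambda>n. norm2 M (f n)) \<longlonglongrightarrow> norm2 M g"
proof (rule LIM_zero_cancel, rule Lim_null_comparison[OF _ assms(3)])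
  have "\<bar>norm2 M (f n) - norm2 M g\<bar> \<le> norm2 M (\<lambda>x. f n x - g x)" for n
    using norm2_triangle_diff[OF assms(1)[of n] assms(2) L2c_zero]
      norm2_triangle_diff[OF assms(2) assms(1)[of n] L2c_zero] norm2_minus_commute[of M g "f n"]
    by simp
  then show "\<forall>\<^sub>F n in sequentially. norm (norm2 M (f n) - norm2 M g) \<le> norm2 M (\<lambda>x. f n x - g x)"
    by simp
qed

text \<open>The scalar lets one lemma serve both sums (\<open>c = -1\<close>) and the combination
  \<open>w - c * (f * g)\<close> that occurs for products of chaos elements.\<close>

lemma norm2_diff_tendsto:
  assumes "\<And>n. f n \<in> L2c M" "\<And>n. f' n \<in> L2c M" "g \<in> L2c M" "g' \<in> L2c M"
    "(\<lambda>n. norm2 M (\<lambda>x. f n x - g x)) \<longlonglongrightarrow> 0" "(\<lambda>n. norm2 M (\<lambda>x. f' n x - g' x)) \<longlonglongrightarrow> 0"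
  shows "(\<lambda>n. norm2 M (\<lambda>x. (f n x - c * f' n x) - (g x - c * g' x))) \<longlonglongrightarrow> 0"
proof (rule Lim_null_comparison)
  have "norm2 M (\<lambda>x. (f n x - c * f' n x) - (g x - c * g' x)) \<le> norm2 M (\<lambda>x. f n x - g x) + cmod c * norm2 M (\<lambda>x. f' n x - g' x)" for n
    using norm2_triangle_minus[OF L2c_diff[OF assms(1,3)] L2c_cmult[OF L2c_diff[OF assms(2,4)], of c], of n n]
      norm2_cmult[of M c "\<lambda>x. f' n x - g' x"]
    by (simp add: algebra_simps)
  then show "\<forall>\<^sub>F n in sequentially. norm (norm2 M (\<lambda>x. (f n x - c * f' n x) - (g x - c * g' x)))
      \<le> norm2 M (\<lambda>x. f n x - g x) + cmod c * norm2 M (\<lambda>x. f' n x - g' x)"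
    by simp
  show "(\<lambda>n. norm2 M (\<lambda>x. f n x - g x) + cmod c * norm2 M (\<lambda>x. f' n x - g' x)) \<longlonglongrightarrow> 0"
    using tendsto_add[OF assms(5) tendsto_mult_right_zero[OF assms(6), of "cmod c"]] by simp
qed

section \<open>Completeness of L2 and orthogonal projections\<close>

context prob_space
begin

lemma L2c_const: "(\<lambda>x. c) \<in> L2c M"
  by (simp add: L2c_def)

lemma L2c_integrable: assumes "f \<in> L2c M" shows "integrable M f"
  using integrable_mult_L2c[OF assms L2c_const[of 1]] by simp

lemma L2c_bounded: assumes "f \<in> borel_measurable M" "\<And>x. cmod (f x) \<le> B" shows "f \<in> L2c M"
proof -
  have "integrable M (\<lambda>x. (cmod (f x))\<^sup>2)"
    using assms by (intro integrable_const_bound[of _ "B\<^sup>2"]) (auto intro!: power_mono AE_I2)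
  then show ?thesis using assms by (simp add: L2c_def)
qed

lemma norm2_const: "norm2 M (\<lambda>x. c) = cmod c"
  by (simp add: norm2_def prob_space)

lemma norm1_le_norm2: assumes "f \<in> L2c M" shows "(\<integral>x. cmod (f x) \<partial>M) \<le> norm2 M f"
  using integral_mult_le_norm2[OF assms L2c_const[of 1]] by (simp add: norm2_const)

text \<open>Riesz-Fischer: on a probability space an L2 Cauchy sequence is L1 Cauchy, so a
  subsequence converges almost everywhere, and Fatou's lemma along that subsequence carries the
  Cauchy bounds over to the limit.\<close>

lemma L2c_complete:
  assumes f: "\<And>n. f n \<in> L2c M"
    and cauchy: "\<And>e. e > 0 \<Longrightarrow> \<exists>N. \<forall>m\<ge>N. \<forall>n\<ge>N. norm2 M (\<lambda>x. f m x - f n x) < e"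
  obtains g where "g \<in> L2c M" "(\<lambda>n. norm2 M (\<lambda>x. f n x - g x)) \<longlonglongrightarrow> 0"
proof -
  have [measurable]: "f n \<in> borel_measurable M" for n using f by (auto dest: L2cD)
  obtain r where r: "strict_mono r" "AE x in M. Cauchy (\<lambda>i. f (r i) x)"
  proof (rule cauchy_L1_AE_cauchy_subseq)
    show "integrable M (f n)" for n using f L2c_integrable by auto
    fix e :: real assume "e > 0"
    then obtain N where N: "\<forall>m\<ge>N. \<forall>n\<ge>N. norm2 M (\<lambda>x. f m x - f n x) < e" using cauchy by blast
    then have "\<forall>i\<ge>N. \<forall>j\<ge>N. LINT x|M. norm (f i x - f j x) < e"
      using norm1_le_norm2[OF L2c_diff[OF f f]] by (meson le_less_trans)
    then show "\<exists>N. \<forall>i\<ge>N. \<forall>j\<ge>N. LINT x|M. norm (f i x - f j x) < e" ..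
  qed blast
  define g where "g x = lim (\<lambda>i. f (r i) x)" for x
  have [measurable]: "g \<in> borel_measurable M" unfolding g_def by measurable
  have lim: "AE x in M. (\<lambda>i. f (r i) x) \<longlonglongrightarrow> g x"
    using r(2) by eventually_elim (simp add: g_def Cauchy_convergent convergent_LIMSEQ_iff[symmetric])
  have bound: "(\<integral>\<^sup>+x. ennreal ((cmod (f n x - g x))\<^sup>2) \<partial>M) \<le> ennreal (e\<^sup>2)"
    if N: "\<forall>m\<ge>N. \<forall>n\<ge>N. norm2 M (\<lambda>x. f m x - f n x) < e" and n: "n \<ge> N" for n N e
  proof -
    have "(\<integral>\<^sup>+x. ennreal ((cmod (f n x - g x))\<^sup>2) \<partial>M) = (\<integral>\<^sup>+x. liminf (\<lambda>i. ennreal ((cmod (f n x - f (r i) x))\<^sup>2)) \<partial>M)"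
    proof (rule nn_integral_cong_AE)
      show "AE x in M. ennreal ((cmod (f n x - g x))\<^sup>2) = liminf (\<lambda>i. ennreal ((cmod (f n x - f (r i) x))\<^sup>2))"
        using lim
      proof eventually_elim
        case (elim x)
        have "(\<lambda>i. ennreal ((cmod (f n x - f (r i) x))\<^sup>2)) \<longlonglongrightarrow> ennreal ((cmod (f n x - g x))\<^sup>2)"
          by (intro tendsto_intros elim)
        then show ?case by (rule lim_imp_Liminf[symmetric, rotated]) simp
      qed
    qed
    also have "\<dots> \<le> liminf (\<lambda>i. \<integral>\<^sup>+x. ennreal ((cmod (f n x - f (r i) x))\<^sup>2) \<partial>M)"
      by (rule nn_integral_liminf) simp
    also have "\<dots> \<le> liminf (\<lambda>i. ennreal (e\<^sup>2))"
    proof (rule Liminf_mono, rule eventually_sequentiallyI[of N])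
      fix i assume "N \<le> i"
      then have "r i \<ge> N" using seq_suble[OF r(1), of i] by simp
      then have "norm2 M (\<lambda>x. f n x - f (r i) x) < e" using N n by blast
      then have "(norm2 M (\<lambda>x. f n x - f (r i) x))\<^sup>2 \<le> e\<^sup>2" by (intro power_mono) auto
      then show "(\<integral>\<^sup>+x. ennreal ((cmod (f n x - f (r i) x))\<^sup>2) \<partial>M) \<le> ennreal (e\<^sup>2)"
        using L2cD(2)[OF L2c_diff[OF f[of n] f[of "r i"]]]
        by (simp add: nn_integral_eq_integral norm2_sq ennreal_leI)
    qed
    also have "\<dots> = ennreal (e\<^sup>2)" by (simp add: Liminf_const)
    finally show ?thesis .
  qed
  have diffL2: "(\<lambda>x. f n x - g x) \<in> L2c M" if "\<forall>m\<ge>N. \<forall>n\<ge>N. norm2 M (\<lambda>x. f m x - f n x) < e" "n \<ge> N" for n N e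
    unfolding L2c_def mem_Collect_eq
    by (intro conjI integrableI_nonneg) (use bound[OF that] le_less_trans in \<open>auto intro: le_less_trans\<close>)
  obtain N1 where N1: "\<forall>m\<ge>N1. \<forall>n\<ge>N1. norm2 M (\<lambda>x. f m x - f n x) < 1" using cauchy[of 1] by auto
  have g: "g \<in> L2c M"
    using L2c_diff[OF f diffL2[OF N1 order_refl], of N1] by simp
  have "(\<lambda>n. norm2 M (\<lambda>x. f n x - g x)) \<longlonglongrightarrow> 0"
  proof (rule LIMSEQ_I)
    fix e :: real assume e: "e > 0"
    then obtain N where N: "\<forall>m\<ge>N. \<forall>n\<ge>N. norm2 M (\<lambda>x. f m x - f n x) < e / 2" using cauchy[of "e / 2"] by auto
    have "norm2 M (\<lambda>x. f n x - g x) < e" if "n \<ge> N" for n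
    proof -
      have "ennreal ((norm2 M (\<lambda>x. f n x - g x))\<^sup>2) \<le> ennreal ((e / 2)\<^sup>2)"
        using bound[OF N that] L2cD(2)[OF L2c_diff[OF f[of n] g]] by (simp add: nn_integral_eq_integral norm2_sq)
      then have "norm2 M (\<lambda>x. f n x - g x) \<le> e / 2"
        using e by (subst (asm) ennreal_le_iff) (auto intro: power2_le_imp_le)
      then show ?thesis using e by simp
    qed
    then show "\<exists>no. \<forall>n\<ge>no. norm (norm2 M (\<lambda>x. f n x - g x) - 0) < e" by auto
  qed
  with g show ?thesis by (rule that)
qed

definition closed_subspace :: "('a \<Rightarrow> complex) set \<Rightarrow> bool" where
  "closed_subspace V \<longleftrightarrow> V \<subseteq> L2c M \<and> (\<lambda>x. 0) \<in> V \<and>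
     (\<forall>f\<in>V. \<forall>g\<in>V. (\<lambda>x. f x + g x) \<in> V) \<and> (\<forall>f\<in>V. \<forall>c. (\<lambda>x. c * f x) \<in> V) \<and>
     (\<forall>f g. (\<forall>n. f n \<in> V) \<longrightarrow> g \<in> L2c M \<longrightarrow> (\<lambda>n. norm2 M (\<lambda>x. f n x - g x)) \<longlonglongrightarrow> 0 \<longrightarrow> g \<in> V)"

lemma closed_subspaceD:
  assumes "closed_subspace V"
  shows "f \<in> V \<Longrightarrow> f \<in> L2c M" "(\<lambda>x. 0) \<in> V" "f \<in> V \<Longrightarrow> g \<in> V \<Longrightarrow> (\<lambda>x. f x + g x) \<in> V"
    "f \<in> V \<Longrightarrow> (\<lambda>x. c * f x) \<in> V"
    "(\<And>n. F n \<in> V) \<Longrightarrow> g \<in> L2c M \<Longrightarrow> (\<lambda>n. norm2 M (\<lambda>x. F n x - g x)) \<longlonglongrightarrow> 0 \<Longrightarrow> g \<in> V"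
  using assms unfolding closed_subspace_def by blast+

lemma closed_subspace_diff:
  assumes "closed_subspace V" "f \<in> V" "g \<in> V" shows "(\<lambda>x. f x - g x) \<in> V"
  using closed_subspaceD(3)[OF assms(1,2) closed_subspaceD(4)[OF assms(1,3), of "-1"]] by simp

lemma closed_subspace_sum:
  assumes "closed_subspace V" "\<And>i. i \<in> I \<Longrightarrow> f i \<in> V" shows "(\<lambda>x. \<Sum>i\<in>I. f i x) \<in> V"
  using assms(2)
  by (induction I rule: infinite_finite_induct) (auto intro: closed_subspaceD(2,3)[OF assms(1)])

lemma parallelogram:
  assumes "f \<in> L2c M" "g \<in> L2c M"
  shows "(norm2 M (\<lambda>x. f x + g x))\<^sup>2 + (norm2 M (\<lambda>x. f x - g x))\<^sup>2 = 2 * (norm2 M f)\<^sup>2 + 2 * (norm2 M g)\<^sup>2"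
  using norm2_add_sq[OF assms] norm2_add_sq[OF assms(1) L2c_cmult[OF assms(2), of "-1"]]
    norm2_cmult[of M "-1" g] inner2_commute[of M f] inner2_cmult_left[of M "-1" g f]
  by (simp add: algebra_simps inner2_commute[of M f])

lemma projection_exists:
  assumes V: "closed_subspace V" and \<phi>: "\<phi> \<in> L2c M"
  obtains g where "g \<in> V" "\<And>h. h \<in> V \<Longrightarrow> inner2 M (\<lambda>x. \<phi> x - g x) h = 0"
proof -
  note VL = closed_subspaceD(1)[OF V]
  define d where "d = (INF g\<in>V. norm2 M (\<lambda>x. \<phi> x - g x))"
  have bdd: "bdd_below ((\<lambda>g. norm2 M (\<lambda>x. \<phi> x - g x)) ` V)"
    by (intro bdd_belowI[of _ 0]) auto
  have V0: "V \<noteq> {}" using closed_subspaceD(2)[OF V] by auto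
  have d_le: "d \<le> norm2 M (\<lambda>x. \<phi> x - g x)" if "g \<in> V" for g
    unfolding d_def using bdd that by (rule cINF_lower)
  have d0: "0 \<le> d" unfolding d_def using V0 by (intro cINF_greatest) auto
  have "\<exists>g\<in>V. norm2 M (\<lambda>x. \<phi> x - g x) < d + 1 / Suc n" for n
    using cINF_less_iff[OF V0 bdd, of "d + 1 / Suc n"] unfolding d_def by simp
  then obtain g where gV: "\<And>n. g n \<in> V" and g: "\<And>n. norm2 M (\<lambda>x. \<phi> x - g n x) < d + 1 / Suc n"
    by metis
  have gL: "g n \<in> L2c M" for n using gV VL by auto
  have lim0: "(\<lambda>n. d + 1 / real (Suc n)) \<longlonglongrightarrow> d"
    using tendsto_add[OF tendsto_const[of d] LIMSEQ_inverse_real_of_nat] by (simp add: inverse_eq_divide)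
  \<comment> \<open>The midpoint of \<open>g m\<close> and \<open>g n\<close> lies in
    \<open>V\<close>, so its distance from \<open>\<phi>\<close> is at least \<open>d\<close>; the
    parallelogram law then forces \<open>g m - g n\<close> to be small.\<close>
  have key: "(norm2 M (\<lambda>x. g m x - g n x))\<^sup>2 \<le> 2 * ((d + 1 / Suc m)\<^sup>2 - d\<^sup>2) + 2 * ((d + 1 / Suc n)\<^sup>2 - d\<^sup>2)" for m n
  proof -
    have mid: "(\<lambda>x. (1/2) * (g m x + g n x)) \<in> V"
      by (intro closed_subspaceD(3,4)[OF V] gV)
    have "norm2 M (\<lambda>x. (\<phi> x - g m x) + (\<phi> x - g n x)) = 2 * norm2 M (\<lambda>x. \<phi> x - (1/2) * (g m x + g n x))"
      using norm2_cmult[of M 2 "\<lambda>x. \<phi> x - (1/2) * (g m x + g n x)"] by (simp add: algebra_simps)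
    then have ge: "4 * d\<^sup>2 \<le> (norm2 M (\<lambda>x. (\<phi> x - g m x) + (\<phi> x - g n x)))\<^sup>2"
      using power_mono[OF d_le[OF mid] d0, of 2] by (simp add: power_mult_distrib)
    have gn: "(norm2 M (\<lambda>x. \<phi> x - g n x))\<^sup>2 \<le> (d + 1 / Suc n)\<^sup>2" for n
      using g[of n] by (intro power_mono) auto
    have eq: "norm2 M (\<lambda>x. g m x - g n x) = norm2 M (\<lambda>x. (\<phi> x - g m x) - (\<phi> x - g n x))"
      by (subst norm2_minus_commute) (simp add: algebra_simps)
    have arith: "(T::real) \<le> 2 * (a - D) + 2 * (b - D)"
      if "4 * (D::real) \<le> S" "(A::real) \<le> a" "(B::real) \<le> b" "(S::real) + T = 2 * A + 2 * B" for A B D S T a b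
      using that by argo
    show ?thesis
      unfolding eq by (rule arith[OF ge gn gn parallelogram[OF L2c_diff[OF \<phi> gL] L2c_diff[OF \<phi> gL]]])
  qed
  obtain p where p: "p \<in> L2c M" "(\<lambda>n. norm2 M (\<lambda>x. g n x - p x)) \<longlonglongrightarrow> 0"
  proof (rule L2c_complete[OF gL])
    fix e :: real assume e: "e > 0"
    have "(\<lambda>n. (d + 1 / Suc n)\<^sup>2 - d\<^sup>2) \<longlonglongrightarrow> d\<^sup>2 - d\<^sup>2"
      by (intro tendsto_intros lim0)
    then have "\<forall>\<^sub>F n in sequentially. (d + 1 / Suc n)\<^sup>2 - d\<^sup>2 < e\<^sup>2 / 4"
      by (rule order_tendstoD) (use e in auto)
    then obtain N where N: "\<And>n. n \<ge> N \<Longrightarrow> (d + 1 / Suc n)\<^sup>2 - d\<^sup>2 < e\<^sup>2 / 4"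
      by (auto simp: eventually_sequentially)
    have "norm2 M (\<lambda>x. g m x - g n x) < e" if "m \<ge> N" "n \<ge> N" for m n
      using key[of m n] N[OF that(1)] N[OF that(2)] e by (intro power2_less_imp_less[of _ e]) auto
    then show "\<exists>N. \<forall>m\<ge>N. \<forall>n\<ge>N. norm2 M (\<lambda>x. g m x - g n x) < e" by auto
  qed
  have pV: "p \<in> V" using closed_subspaceD(5)[OF V gV p] .
  have pd: "norm2 M (\<lambda>x. \<phi> x - p x) = d"
  proof (rule antisym)
    have "norm2 M (\<lambda>x. \<phi> x - p x) \<le> (d + 1 / Suc n) + norm2 M (\<lambda>x. g n x - p x)" for n
      using norm2_triangle_diff[OF \<phi> gL[of n] p(1)] g[of n] by simp
    then show "norm2 M (\<lambda>x. \<phi> x - p x) \<le> d"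
      using tendsto_add[OF lim0 p(2)] by (intro LIMSEQ_le_const[of _ d]) auto
  qed (rule d_le[OF pV])
  have "inner2 M (\<lambda>x. \<phi> x - p x) h = 0" if h: "h \<in> V" for h
  proof (rule ccontr)
    define z where "z = inner2 M (\<lambda>x. \<phi> x - p x) h"
    assume "inner2 M (\<lambda>x. \<phi> x - p x) h \<noteq> 0"
    then have z: "cmod z > 0" by (simp add: z_def)
    have hL: "h \<in> L2c M" using h VL by auto
    have fL: "(\<lambda>x. \<phi> x - p x) \<in> L2c M" using \<phi> p L2c_diff by auto
    \<comment> \<open>Moving from \<open>p\<close> by \<open>t * z\<close> times \<open>h\<close>
      changes the squared distance by \<open>- 2 t |z|^2\<close> plus a second-order term. This
      \<open>t\<close> keeps the second-order term below \<open>t |z|^2\<close>, and the added 1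
      keeps the denominator positive when \<open>h\<close> has norm zero.\<close>
    define t where "t = 1 / ((norm2 M h)\<^sup>2 + 1)"
    have t: "t > 0" "t * (norm2 M h)\<^sup>2 < 1"
      by (auto simp: t_def add_nonneg_pos divide_less_eq)
    have "(\<lambda>x. p x + (t * z) * h x) \<in> V"
      by (intro closed_subspaceD(3,4)[OF V] pV h)
    from power_mono[OF d_le[OF this] d0, of 2]
    have "d\<^sup>2 \<le> (norm2 M (\<lambda>x. (\<phi> x - p x) + (- t * z) * h x))\<^sup>2"
      by (simp add: algebra_simps)
    also have "\<dots> = d\<^sup>2 + (t * cmod z * norm2 M h)\<^sup>2 + 2 * Re (inner2 M (\<lambda>x. \<phi> x - p x) (\<lambda>x. (- t * z) * h x))"
      unfolding norm2_add_sq[OF fL L2c_cmult[OF hL]] norm2_cmult pd using t by (simp add: norm_mult power_mult_distrib)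
    also have "inner2 M (\<lambda>x. \<phi> x - p x) (\<lambda>x. (- t * z) * h x) = cnj ((- t * z) * cnj z)"
      unfolding z_def by (subst inner2_commute) (simp only: inner2_cmult_left inner2_commute[of M h])
    also have "Re (cnj ((- t * z) * cnj z)) = - t * (cmod z)\<^sup>2"
      by (simp only: cmod_power2) (simp add: power2_eq_square algebra_simps)
    finally have "2 * t * (cmod z)\<^sup>2 \<le> (t * (norm2 M h)\<^sup>2) * t * (cmod z)\<^sup>2"
      by (simp add: power2_eq_square algebra_simps)
    also have "\<dots> \<le> 1 * t * (cmod z)\<^sup>2"
      using t by (intro mult_right_mono) auto
    finally show False using t z by (simp add: mult_le_cancel_right)
  qed
  with pV show ?thesis by (rule that)
qed

end

section \<open>Gaussian spaces and their laws\<close>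

lemma powr_tangent_le:
  fixes a b p :: real
  assumes "a \<ge> 0" "b \<ge> 0" "p \<ge> 1"
  shows "b powr p + p * b powr (p - 1) * (a - b) \<le> a powr p"
proof (cases "p = 1")
  \<comment> \<open>Since \<open>0 powr 0 = 0\<close>, the slope at \<open>b = 0\<close> vanishes
    and the claim reduces to \<open>0 \<le> a\<close>.\<close>
  case True
  then show ?thesis using assms by (cases "b = 0") auto
next
  case False
  then have p: "p > 1" using assms by simp
  \<comment> \<open>Multiplied by \<open>p\<close>, Young's inequality with the conjugate exponents
    \<open>p\<close> and \<open>p / (p - 1)\<close> becomes the tangent inequality at
    \<open>b\<close> for the convex function \<open>x powr p\<close>.\<close>
  have "a * b powr (p - 1) \<le> a powr p / p + (b powr (p - 1)) powr (p / (p - 1)) / (p / (p - 1))"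
    using p assms by (intro Youngs_inequality) (auto simp: field_simps)
  also have "(b powr (p - 1)) powr (p / (p - 1)) = b powr p"
    using p by (simp add: powr_powr)
  finally have "p * (a * b powr (p - 1)) \<le> p * (a powr p / p + b powr p / (p / (p - 1)))"
    using p by (intro mult_left_mono) auto
  also have "\<dots> = a powr p + b powr p * (p - 1)"
    using p by (simp add: field_simps)
  finally have "p * (a * b powr (p - 1)) \<le> a powr p + b powr p * (p - 1)" .
  moreover have "b powr (p - 1) * b = b powr p"
    using assms by (cases "b = 0") (auto simp: powr_diff)
  ultimately show ?thesis by (simp add: algebra_simps)
qed

text \<open>The tangent is taken at \<open>b = |E f|\<close>. Its slope is nonnegative, so
  \<open>b \<le> E |f|\<close> suffices to compare. If the right side is finite, \<open>f\<close> is
  integrable by \<open>|f| \<le> 1 + |f|^p\<close>; otherwise the claim is trivial.\<close>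

lemma (in prob_space) norm_integral_powr_le:
  fixes f :: "'a \<Rightarrow> complex"
  assumes [measurable]: "f \<in> borel_measurable M" and p: "p \<ge> 1"
  shows "ennreal (cmod (\<integral>x. f x \<partial>M) powr p) \<le> (\<integral>\<^sup>+x. ennreal (cmod (f x) powr p) \<partial>M)"
proof (cases "(\<integral>\<^sup>+x. ennreal (cmod (f x) powr p) \<partial>M) = \<infinity>")
  case False
  then have ip: "integrable M (\<lambda>x. cmod (f x) powr p)"
    by (intro integrableI_nonneg) (auto simp: less_top)
  have "cmod (f x) \<le> 1 + cmod (f x) powr p" for x
  proof (cases "cmod (f x) \<le> 1")
    case False
    then have "cmod (f x) powr 1 \<le> cmod (f x) powr p" using p by (intro powr_mono) auto
    then show ?thesis using False by simp
  qed (auto intro: add_increasing2)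
  then have i1: "integrable M (\<lambda>x. cmod (f x))"
    by (intro Bochner_Integration.integrable_bound[OF Bochner_Integration.integrable_add[OF integrable_const[of 1] ip]]) auto
  define b where "b = cmod (\<integral>x. f x \<partial>M)"
  have b: "b \<ge> 0" "b \<le> (\<integral>x. cmod (f x) \<partial>M)" by (auto simp: b_def)
  have "b powr p \<le> b powr p + p * b powr (p - 1) * ((\<integral>x. cmod (f x) \<partial>M) - b)"
    using b p by auto
  also have "\<dots> = (\<integral>x. b powr p + p * b powr (p - 1) * (cmod (f x) - b) \<partial>M)"
    using i1 by (simp add: prob_space)
  also have "\<dots> \<le> (\<integral>x. cmod (f x) powr p \<partial>M)"
    using i1 ip b p by (intro integral_mono powr_tangent_le) auto
  finally show ?thesis
    using ip by (simp add: nn_integral_eq_integral b_def ennreal_leI)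
qed auto

lemma integral_cis_pair:
  assumes "prob_space N1" "prob_space N2"
    and [measurable]: "f \<in> borel_measurable N1" "g \<in> borel_measurable N2"
  shows "(\<integral>z. cis (f (fst z) + g (snd z)) \<partial>(N1 \<Otimes>\<^sub>M N2)) = (\<integral>x. cis (f x) \<partial>N1) * (\<integral>y. cis (g y) \<partial>N2)"
proof -
  interpret N1: prob_space N1 by fact
  interpret N2: prob_space N2 by fact
  interpret P: pair_prob_space N1 N2 ..
  have "integrable (N1 \<Otimes>\<^sub>M N2) (\<lambda>z. cis (f (fst z) + g (snd z)))"
    by (intro P.integrable_const_bound[of _ 1]) (simp, measurable)
  from P.integral_fst'[OF this, symmetric] show ?thesis
    by (simp flip: cis_mult)
qed

section \<open>Moments and characteristic functions of Gaussian variables\<close>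

locale gaussian_space = prob_space M for M :: "'a measure" +
  fixes H :: "('a \<Rightarrow> real) set"
  assumes ghs: "gaussian_hilbert_space M H"
begin

lemma H_meas [measurable_dest]: "h \<in> H \<Longrightarrow> h \<in> borel_measurable M"
  and H_sq: "h \<in> H \<Longrightarrow> integrable M (\<lambda>x. (h x)\<^sup>2)"
  and H_normal: "h \<in> H \<Longrightarrow> centered_normal M h"
  and H_zero: "(\<lambda>x. 0) \<in> H"
  and H_add: "g \<in> H \<Longrightarrow> h \<in> H \<Longrightarrow> (\<lambda>x. g x + h x) \<in> H"
  and H_scale: "h \<in> H \<Longrightarrow> (\<lambda>x. c * h x) \<in> H"
  using ghs unfolding gaussian_hilbert_space_def L2r_def by blast+

lemma H_lin: "g \<in> H \<Longrightarrow> h \<in> H \<Longrightarrow> (\<lambda>x. a * g x + b * h x) \<in> H"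
  by (intro H_add H_scale)

lemma H_mult_integrable: assumes "g \<in> H" "h \<in> H" shows "integrable M (\<lambda>x. g x * h x)"
proof -
  have [measurable]: "g \<in> borel_measurable M" "h \<in> borel_measurable M" using assms H_meas by auto
  have "integrable M (\<lambda>x. (g x)\<^sup>2 + (h x)\<^sup>2)" using assms H_sq by auto
  moreover have "\<bar>g x * h x\<bar> \<le> (g x)\<^sup>2 + (h x)\<^sup>2" for x
  proof -
    have "2 * \<bar>g x\<bar> * \<bar>h x\<bar> \<le> (g x)\<^sup>2 + (h x)\<^sup>2" using sum_squares_bound[of "\<bar>g x\<bar>" "\<bar>h x\<bar>"] by simp
    moreover have "0 \<le> \<bar>g x\<bar> * \<bar>h x\<bar>" by simp
    ultimately show ?thesis unfolding abs_mult by linarith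
  qed
  ultimately show ?thesis by (elim Bochner_Integration.integrable_bound) auto
qed

definition var :: "('a \<Rightarrow> real) \<Rightarrow> real" where "var h = (\<integral>x. (h x)\<^sup>2 \<partial>M)"
definition cov :: "('a \<Rightarrow> real) \<Rightarrow> ('a \<Rightarrow> real) \<Rightarrow> real" where "cov g h = (\<integral>x. g x * h x \<partial>M)"

lemma var_nonneg: "0 \<le> var h" by (simp add: var_def)

lemma var_lin: assumes "g \<in> H" "h \<in> H"
  shows "var (\<lambda>x. a * g x + b * h x) = a\<^sup>2 * var g + 2 * a * b * cov g h + b\<^sup>2 * var h"
proof -
  have "var (\<lambda>x. a * g x + b * h x) = (\<integral>x. a\<^sup>2 * (g x)\<^sup>2 + 2 * a * b * (g x * h x) + b\<^sup>2 * (h x)\<^sup>2 \<partial>M)"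
    unfolding var_def by (intro Bochner_Integration.integral_cong) (auto simp: power2_eq_square algebra_simps)
  also have "\<dots> = a\<^sup>2 * var g + 2 * a * b * cov g h + b\<^sup>2 * var h"
    using assms H_sq H_mult_integrable by (simp add: var_def cov_def)
  finally show ?thesis .
qed

lemma var_scale: "var (\<lambda>x. a * h x) = a\<^sup>2 * var h"
  by (simp add: var_def power_mult_distrib)

lemma gaussian_cases:
  assumes "h \<in> H"
  obtains (zero) "AE x in M. h x = 0"
  | (pos) \<sigma> where "\<sigma> > 0" "distributed M lborel h (normal_density 0 \<sigma>)"
  using H_normal[OF assms] unfolding centered_normal_def by blast

lemma moment_integrable:
  assumes "h \<in> H" shows "integrable M (\<lambda>x. h x ^ k)"
  using assms
proof (cases rule: gaussian_cases)
  case zero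
  have "integrable M (\<lambda>x. h x ^ k) \<longleftrightarrow> integrable M (\<lambda>x. 0 ^ k :: real)"
    using zero assms[THEN H_meas] by (intro integrable_cong_AE) auto
  then show ?thesis by simp
next
  case (pos \<sigma>)
  then show ?thesis
    using integrable_normal_moment[OF pos(1), of 0 k] by (subst distributed_integrable[OF pos(2), symmetric]) auto
qed

lemma moment_abs_integrable:
  assumes "h \<in> H" shows "integrable M (\<lambda>x. \<bar>h x\<bar> ^ k)"
  using integrable_abs[OF moment_integrable[OF assms, of k]] by (simp add: power_abs)

text \<open>Writing the moments through \<open>var h\<close> instead of a standard deviation
  includes the degenerate variable, for which \<open>0 ^ 0 = 1\<close> gives the right value at
  \<open>k = 0\<close>.\<close>

lemma moment_even:
  assumes "h \<in> H" shows "(\<integral>x. h x ^ (2 * k) \<partial>M) = fact (2 * k) / (2 ^ k * fact k) * var h ^ k"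
  using assms
proof (cases rule: gaussian_cases)
  case zero
  have "(\<integral>x. h x ^ k \<partial>M) = (\<integral>x. 0 ^ k \<partial>M)" for k
    using zero assms[THEN H_meas] by (intro integral_cong_AE) auto
  from this[of "2 * k"] this[of 2] show ?thesis
    by (cases "k = 0") (auto simp: var_def prob_space power_0_left)
next
  case (pos \<sigma>)
  have e: "(\<integral>x. h x ^ (2 * k) \<partial>M) = fact (2 * k) / ((2 / \<sigma>\<^sup>2) ^ k * fact k)" for k
    using integral_normal_moment_even[OF pos(1), of 0 k]
    by (subst distributed_integral[OF pos(2), symmetric]) auto
  have "var h = \<sigma>\<^sup>2" using e[of 1] by (simp add: var_def fact_2)
  then show ?thesis unfolding e using pos(1) by (simp add: power_divide)
qed

text \<open>The form in which normality enters the comparison of joint laws: as \<open>H\<close> is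
  closed under linear combinations, laws on path space are compared through variances alone.\<close>

lemma char_H:
  assumes "h \<in> H" shows "(\<integral>x. cis (h x) \<partial>M) = of_real (exp (- var h / 2))"
  using assms
proof (cases rule: gaussian_cases)
  case zero
  have [measurable]: "h \<in> borel_measurable M" using assms H_meas by auto
  have "(\<integral>x. cis (h x) \<partial>M) = (\<integral>x. 1 \<partial>M)"
    using zero by (intro integral_cong_AE) auto
  moreover have "var h = (\<integral>x. 0 \<partial>M)"
    unfolding var_def using zero by (intro integral_cong_AE) auto
  ultimately show ?thesis by (simp add: prob_space)
next
  case (pos \<sigma>)
  have [measurable]: "h \<in> borel_measurable M" using assms H_meas by auto
  have "var h = \<sigma>\<^sup>2"
    using moment_even[OF assms, of 1] integral_normal_moment_even[OF pos(1), of 0 1]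
      distributed_integral[OF pos(2), of "\<lambda>x. x\<^sup>2"] by (simp add: var_def fact_2)
  have D: "distributed M lborel (\<lambda>x. h x / \<sigma>) std_normal_density"
    using pos normal_standard_normal_convert[OF pos(1), of h 0] by simp
  have "(\<integral>x. cis (h x) \<partial>M) = (\<integral>x. cis (\<sigma> * (h x / \<sigma>)) \<partial>M)"
    using pos(1) by simp
  also have "\<dots> = (\<integral>y. cis (\<sigma> * y) \<partial>distr M lborel (\<lambda>x. h x / \<sigma>))"
    by (subst integral_distr) auto
  also have "distr M lborel (\<lambda>x. h x / \<sigma>) = std_normal_distribution"
    using D by (simp add: distributed_def)
  also have "(\<integral>y. cis (\<sigma> * y) \<partial>std_normal_distribution) = char std_normal_distribution \<sigma>"
    by (simp add: char_def cis_conv_exp)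
  finally show ?thesis
    by (simp add: char_std_normal_distribution \<open>var h = \<sigma>\<^sup>2\<close>)
qed

text \<open>With \<open>N = Suc n\<close>, the squared Taylor remainder is at most
  \<open>h x ^ (2 * N) / (fact N)\<^sup>2\<close>. The even moments turn its mean into a binomial
  coefficient \<open>2 * N choose N\<close> times \<open>var h ^ N / (2 ^ N * fact N)\<close>, and
  bounding that coefficient by \<open>2 ^ (2 * N)\<close> leaves a term of an exponential series.
  Through this limit, orthogonality to polynomials passes to exponentials.\<close>

lemma cis_taylor_norm2:
  assumes h: "h \<in> H"
  shows "(\<lambda>n. norm2 M (\<lambda>x. cis (h x) - (\<Sum>k\<le>n. (\<i> * h x) ^ k / fact k))) \<longlonglongrightarrow> 0"
proof -
  have [measurable]: "h \<in> borel_measurable M" using assms H_meas by auto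
  have le: "(norm2 M (\<lambda>x. cis (h x) - (\<Sum>k\<le>n. (\<i> * h x) ^ k / fact k)))\<^sup>2
      \<le> inverse (fact (Suc n)) * (2 * var h) ^ Suc n" (is "?N n \<le> _") for n
  proof -
    have pw: "(cmod (cis (h x) - (\<Sum>k\<le>n. (\<i> * h x) ^ k / fact k)))\<^sup>2 \<le> h x ^ (2 * Suc n) / (fact (Suc n))\<^sup>2" for x
    proof -
      have "(cmod (cis (h x) - (\<Sum>k\<le>n. (\<i> * h x) ^ k / fact k)))\<^sup>2 \<le> (\<bar>h x\<bar> ^ Suc n / fact (Suc n))\<^sup>2"
        unfolding cis_conv_exp by (intro power_mono iexp_approx1) auto
      also have "\<dots> = h x ^ (2 * Suc n) / (fact (Suc n))\<^sup>2"
        by (simp only: power_divide power_even_abs power_mult[symmetric] mult.commute[of "Suc n"])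
           (simp add: power_even_abs)
      finally show ?thesis .
    qed
    have "?N n \<le> (\<integral>x. h x ^ (2 * Suc n) / (fact (Suc n))\<^sup>2 \<partial>M)"
      unfolding norm2_sq
      using moment_integrable[OF h, of "2 * Suc n"] pw
      by (intro integral_mono_AE' AE_I2) (auto simp del: mult_Suc_right)
    also have "\<dots> = fact (2 * Suc n) / (2 ^ Suc n * fact (Suc n)) * var h ^ Suc n / (fact (Suc n))\<^sup>2"
      using moment_even[OF h, of "Suc n"] by (simp del: mult_Suc_right fact_Suc power_Suc)
    also have "\<dots> = real (2 * Suc n choose Suc n) * (var h ^ Suc n / (2 ^ Suc n * fact (Suc n)))"
    proof -
      have "fact (2 * N) / (2 ^ N * fact N) * v ^ N / (fact N)\<^sup>2 = real (2 * N choose N) * (v ^ N / (2 ^ N * fact N))"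
        for N and v :: real
        using binomial_fact[of N "2 * N", where 'a=real] by (simp add: power2_eq_square field_simps)
      then show ?thesis .
    qed
    also have "\<dots> \<le> 2 ^ (2 * Suc n) * (var h ^ Suc n / (2 ^ Suc n * fact (Suc n)))"
      using binomial_le_pow2[of "2 * Suc n" "Suc n"] var_nonneg[of h]
      by (intro mult_right_mono) (simp_all only: of_nat_le_iff[symmetric, where 'a=real] of_nat_power of_nat_numeral, auto)
    also have "\<dots> = inverse (fact (Suc n)) * (2 * var h) ^ Suc n"
      by (simp add: power_mult power_mult_distrib field_simps flip: power_add del: fact_Suc) (simp add: power_mult_distrib flip: mult_2 power_mult power_Suc)
    finally show ?thesis .
  qed
  have "(\<lambda>n. inverse (fact n) * (2 * var h) ^ n) \<longlonglongrightarrow> 0"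
    by (rule summable_LIMSEQ_zero[OF summable_exp])
  then have "(\<lambda>n. inverse (fact (Suc n)) * (2 * var h) ^ Suc n) \<longlonglongrightarrow> 0"
    by (rule LIMSEQ_Suc)
  then have "?N \<longlonglongrightarrow> 0"
    by (rule Lim_null_comparison[rotated]) (use le in auto)
  from tendsto_real_sqrt[OF this] show ?thesis by simp
qed

section \<open>Path space and the laws of mixed paths\<close>

abbreviation paths :: "(('a \<Rightarrow> real) \<Rightarrow> real) measure" where "paths \<equiv> PiM H (\<lambda>_. borel)"

text \<open>
  A point of \<open>\<Omega>\<close> is viewed as the path \<open>h \<mapsto> h x\<close>; unlike \<open>\<Omega>\<close> itself, the space of paths admits
  the linear combinations needed below.
\<close>

definition path :: "'a \<Rightarrow> ('a \<Rightarrow> real) \<Rightarrow> real" where "path x = (\<lambda>h\<in>H. h x)"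

definition mix :: "real \<Rightarrow> real \<Rightarrow> (('a \<Rightarrow> real) \<Rightarrow> real) \<Rightarrow> (('a \<Rightarrow> real) \<Rightarrow> real) \<Rightarrow> (('a \<Rightarrow> real) \<Rightarrow> real)"
  where "mix a b \<xi> \<eta> = (\<lambda>h\<in>H. a * \<xi> h + b * \<eta> h)"

lemma path_apply [simp]: "h \<in> H \<Longrightarrow> path x h = h x" by (simp add: path_def)
lemma mix_apply [simp]: "h \<in> H \<Longrightarrow> mix a b \<xi> \<eta> h = a * \<xi> h + b * \<eta> h" by (simp add: mix_def)

lemma path_measurable [measurable]: "path \<in> measurable M paths"
  unfolding path_def by (intro measurable_restrict H_meas)

lemma mix_measurable [measurable (raw)]:
  assumes [measurable]: "f \<in> measurable N paths" "g \<in> measurable N paths"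
  shows "(\<lambda>z. mix a b (f z) (g z)) \<in> measurable N paths"
proof -
  have "(\<lambda>z. f z h) \<in> borel_measurable N" "(\<lambda>z. g z h) \<in> borel_measurable N" if "h \<in> H" for h
    using that by measurable
  then show ?thesis
    unfolding mix_def by (intro measurable_restrict borel_measurable_add borel_measurable_times) auto
qed

text \<open>The matrix with rows \<open>(a, b)\<close> and \<open>(b, -a)\<close> is a reflection,
  hence its own inverse. This is why a change of variables by it can be undone with the same
  formula.\<close>

lemma mix_rotate:
  assumes "a\<^sup>2 + b\<^sup>2 = 1"
  shows "mix a b (mix a b (path x) \<eta>) (mix b (-a) (path x) \<eta>) = path x"
proof
  fix h
  have "a * (a * h x + b * \<eta> h) + b * (b * h x - a * \<eta> h) = (a\<^sup>2 + b\<^sup>2) * h x"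
    by (simp add: power2_eq_square algebra_simps)
  then show "mix a b (mix a b (path x) \<eta>) (mix b (-a) (path x) \<eta>) h = path x h"
    using assms by (simp add: mix_def path_def)
qed

text \<open>A functional \<open>g\<close> of the first path plus \<open>g'\<close> of the second is
  a sum of independent centered Gaussians on both sides, so only variances matter:
  \<open>var (a g + b g') + var (b g - a g') = var g + var g'\<close>, because the covariance terms
  cancel.\<close>

lemma rotation_law:
  assumes ab: "a\<^sup>2 + b\<^sup>2 = 1"
  shows "distr (M \<Otimes>\<^sub>M M) (paths \<Otimes>\<^sub>M paths) (\<lambda>(x, y). (mix a b (path x) (path y), mix b (-a) (path x) (path y)))
       = distr (M \<Otimes>\<^sub>M M) (paths \<Otimes>\<^sub>M paths) (\<lambda>(x, y). (path x, path y))"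
proof -
  interpret MM: pair_prob_space M M ..
  \<comment> \<open>A pair of paths is coded as one real family over \<open>H\<close> and a Boolean,
    with \<open>True\<close> for the first path, so that \<open>distr_PiM_eq\<close> applies;
    \<open>\<Phi>\<close> unpacks the pair again.\<close>
  define Z1 where "Z1 = (\<lambda>(h :: 'a \<Rightarrow> real, s) (z :: 'a \<times> 'a).
    if s then a * h (fst z) + b * h (snd z) else b * h (fst z) - a * h (snd z))"
  define Z2 where "Z2 = (\<lambda>(h :: 'a \<Rightarrow> real, s) (z :: 'a \<times> 'a). if s then h (fst z) else h (snd z))"
  \<comment> \<open>Uniqueness needs a class closed under sums. As \<open>H\<close> is linear, every
    combination of coordinates of the two paths collapses to one \<open>g\<close> for the first path
    and one \<open>g'\<close> for the second.\<close>
  define P where "P = (\<lambda>(g, g'). (\<lambda>z. (a * g (fst z) + b * g' (fst z)) + (b * g (snd z) + (- a) * g' (snd z)),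
      \<lambda>z :: 'a \<times> 'a. g (fst z) + g' (snd z))) ` (H \<times> H)"
  define I where "I = H \<times> (UNIV :: bool set)"
  have P_I: "((\<lambda>z. (a * g (fst z) + b * g' (fst z)) + (b * g (snd z) + (- a) * g' (snd z))), (\<lambda>z. g (fst z) + g' (snd z))) \<in> P"
    if "g \<in> H" "g' \<in> H" for g g' using that unfolding P_def by force
  interpret char_matched "M \<Otimes>\<^sub>M M" "M \<Otimes>\<^sub>M M" P
  proof
    fix u v assume uv: "(u, v) \<in> P"
    then obtain g g' where g: "g \<in> H" "g' \<in> H"
      "u = (\<lambda>z. (a * g (fst z) + b * g' (fst z)) + (b * g (snd z) + (- a) * g' (snd z)))" "v = (\<lambda>z. g (fst z) + g' (snd z))"
      unfolding P_def by auto
    have [measurable]: "g \<in> borel_measurable M" "g' \<in> borel_measurable M" using g H_meas by auto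
    show "u \<in> borel_measurable (M \<Otimes>\<^sub>M M) \<and> v \<in> borel_measurable (M \<Otimes>\<^sub>M M)"
      unfolding g by measurable
    show "((\<lambda>x. c * u x), (\<lambda>x. c * v x)) \<in> P" for c
      using P_I[OF H_scale[OF g(1), of c] H_scale[OF g(2), of c]] unfolding g by (simp add: algebra_simps)
    show "(\<integral>x. cis (u x) \<partial>(M \<Otimes>\<^sub>M M)) = (\<integral>x. cis (v x) \<partial>(M \<Otimes>\<^sub>M M))"
    proof -
      have e: "var (\<lambda>x. a * g x + b * g' x) + var (\<lambda>x. b * g x + (- a) * g' x) = (a\<^sup>2 + b\<^sup>2) * var g + (a\<^sup>2 + b\<^sup>2) * var g'"
        unfolding var_lin[OF g(1,2)] by (simp add: algebra_simps)
      have "(\<integral>x. cis (u x) \<partial>(M \<Otimes>\<^sub>M M)) = of_real (exp (- (var (\<lambda>x. a * g x + b * g' x) + var (\<lambda>x. b * g x + (- a) * g' x)) / 2))"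
        unfolding g using prob_space_axioms
        by (subst integral_cis_pair[where f="\<lambda>x. a * g x + b * g' x" and g="\<lambda>x. b * g x + (- a) * g' x"], simp, simp, measurable)
           (subst char_H, intro H_lin g, subst char_H, intro H_lin g, simp add: exp_add[symmetric] add_divide_distrib flip: of_real_mult)
      also have "\<dots> = of_real (exp (- (var g + var g') / 2))" unfolding e ab by simp
      also have "\<dots> = (\<integral>x. cis (v x) \<partial>(M \<Otimes>\<^sub>M M))"
        unfolding g using prob_space_axioms
        by (subst integral_cis_pair, simp, simp, measurable)
           (subst char_H, rule g, subst char_H, rule g, simp add: exp_add[symmetric] diff_divide_distrib flip: of_real_mult)
      finally show ?thesis .
    qed
    fix u' v' assume uv: "(u', v') \<in> P"
    then obtain k k' where k: "k \<in> H" "k' \<in> H"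
      "u' = (\<lambda>z. (a * k (fst z) + b * k' (fst z)) + (b * k (snd z) + (- a) * k' (snd z)))" "v' = (\<lambda>z. k (fst z) + k' (snd z))"
      unfolding P_def by auto
    show "((\<lambda>x. u x + u' x), (\<lambda>x. v x + v' x)) \<in> P"
      using P_I[OF H_add[OF g(1) k(1)] H_add[OF g(2) k(2)]] unfolding g k by (simp add: algebra_simps)
  qed
  have Zm: "Z1 i \<in> borel_measurable (M \<Otimes>\<^sub>M M) \<and> Z2 i \<in> borel_measurable (M \<Otimes>\<^sub>M M)" if iI: "i \<in> I" for i
  proof -
    obtain h s where i: "i = (h, s)" "h \<in> H" using iI by (auto simp: I_def)
    have [measurable]: "h \<in> borel_measurable M" using i H_meas by auto
    show ?thesis unfolding i Z1_def Z2_def by (cases s) (simp; measurable)+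
  qed
  have Zr [measurable]: "(\<lambda>x. \<lambda>i\<in>I. Z1 i x) \<in> measurable (M \<Otimes>\<^sub>M M) (PiM I (\<lambda>_. borel))"
     "(\<lambda>x. \<lambda>i\<in>I. Z2 i x) \<in> measurable (M \<Otimes>\<^sub>M M) (PiM I (\<lambda>_. borel))"
    using Zm by (auto intro!: measurable_restrict)
  have eq: "distr (M \<Otimes>\<^sub>M M) (PiM I (\<lambda>_. borel)) (\<lambda>x. \<lambda>i\<in>I. Z1 i x) = distr (M \<Otimes>\<^sub>M M) (PiM I (\<lambda>_. borel)) (\<lambda>x. \<lambda>i\<in>I. Z2 i x)"
  proof (rule distr_PiM_eq)
    show "P \<noteq> {}" using H_zero P_def by auto
    fix i assume "i \<in> I"
    then obtain h s where i: "i = (h, s)" "h \<in> H" by (auto simp: I_def)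
    show "(Z1 i, Z2 i) \<in> P"
      using P_I[OF i(2) H_zero] P_I[OF H_zero i(2)] unfolding i Z1_def Z2_def by (cases s) (auto simp: algebra_simps)
  qed
  define \<Phi> where "\<Phi> = (\<lambda>\<zeta> :: ('a \<Rightarrow> real) \<times> bool \<Rightarrow> real. ((\<lambda>h\<in>H. \<zeta> (h, True)), (\<lambda>h\<in>H. \<zeta> (h, False))))"
  have [measurable]: "\<Phi> \<in> measurable (PiM I (\<lambda>_. borel)) (paths \<Otimes>\<^sub>M paths)"
    unfolding \<Phi>_def by (intro measurable_Pair measurable_restrict measurable_component_singleton) (auto simp: I_def)
  have e1: "\<Phi> (\<lambda>i\<in>I. Z1 i z) = (case z of (x, y) \<Rightarrow> (mix a b (path x) (path y), mix b (-a) (path x) (path y)))" for z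
    by (auto simp: \<Phi>_def Z1_def mix_def path_def I_def fun_eq_iff split: prod.splits)
  have e2: "\<Phi> (\<lambda>i\<in>I. Z2 i z) = (case z of (x, y) \<Rightarrow> (path x, path y))" for z
    by (auto simp: \<Phi>_def Z2_def mix_def path_def I_def fun_eq_iff split: prod.splits)
  show ?thesis
    using arg_cong[OF eq, of "\<lambda>D. distr D (paths \<Otimes>\<^sub>M paths) \<Phi>"]
    by (simp add: distr_distr comp_def e1 e2)
qed


abbreviation r2 :: real where "r2 \<equiv> 1 / sqrt 2"

text \<open>In both families the three members are centered with the same variances and pairwise correlation \<open>1 / 2\<close>.\<close>

lemma trilinear_law:
  "distr (M \<Otimes>\<^sub>M (M \<Otimes>\<^sub>M (M \<Otimes>\<^sub>M M))) (paths \<Otimes>\<^sub>M (paths \<Otimes>\<^sub>M paths))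
     (\<lambda>(w, x, y, z). (mix r2 r2 (path w) (path x), mix r2 r2 (path w) (path y), mix r2 r2 (path w) (path z)))
   = distr (M \<Otimes>\<^sub>M (M \<Otimes>\<^sub>M M)) (paths \<Otimes>\<^sub>M (paths \<Otimes>\<^sub>M paths))
     (\<lambda>(x, y, z). (mix r2 r2 (path x) (path y), mix r2 r2 (path x) (path z), mix r2 r2 (path y) (path z)))"
proof -
  define r where "r = r2"
  interpret M2: pair_prob_space M M ..
  have M2: "prob_space (M \<Otimes>\<^sub>M M)" by (rule M2.prob_space_axioms)
  interpret M3: pair_prob_space M "M \<Otimes>\<^sub>M M" ..
  have M3: "prob_space (M \<Otimes>\<^sub>M (M \<Otimes>\<^sub>M M))" by (rule M3.prob_space_axioms)
  interpret M4: pair_prob_space M "M \<Otimes>\<^sub>M (M \<Otimes>\<^sub>M M)" ..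
  let ?M4 = "M \<Otimes>\<^sub>M (M \<Otimes>\<^sub>M (M \<Otimes>\<^sub>M M))" and ?M3 = "M \<Otimes>\<^sub>M (M \<Otimes>\<^sub>M M)"
  \<comment> \<open>\<open>U\<close> and \<open>V\<close> apply \<open>g0\<close>,
    \<open>g1\<close>, \<open>g2\<close> to the three mixed paths and regroup by independent copies,
    as \<open>integral_cis_pair\<close> requires. In \<open>U\<close> the common copy collects all
    three functions; in \<open>V\<close> each copy collects two.\<close>
  define U where "U = (\<lambda>(g0, g1, g2) (q :: 'a \<times> 'a \<times> 'a \<times> 'a). ((r * g0 (fst q) + r * g1 (fst q)) + r * g2 (fst q)) +
     (r * g0 (fst (snd q)) + (r * g1 (fst (snd (snd q))) + r * g2 (snd (snd (snd q))))))"
  define V where "V = (\<lambda>(g0, g1, g2) (q :: 'a \<times> 'a \<times> 'a). (r * g0 (fst q) + r * g1 (fst q)) +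
     ((r * g0 (fst (snd q)) + r * g2 (fst (snd q))) + (r * g1 (snd (snd q)) + r * g2 (snd (snd q)))))"
  define P where "P = (\<lambda>g. (U g, V g)) ` (H \<times> H \<times> H)"
  define I where "I = H \<times> {0, 1, 2 :: nat}"
  have P_I: "(U (g0, g1, g2), V (g0, g1, g2)) \<in> P" if "g0 \<in> H" "g1 \<in> H" "g2 \<in> H" for g0 g1 g2
    using that unfolding P_def by auto
  interpret char_matched ?M4 ?M3 P
  proof
    fix u v assume uv: "(u, v) \<in> P"
    then obtain g0 g1 g2 where g: "g0 \<in> H" "g1 \<in> H" "g2 \<in> H" and e: "u = U (g0, g1, g2)" "v = V (g0, g1, g2)"
      unfolding P_def by auto
    have [measurable]: "g0 \<in> borel_measurable M" "g1 \<in> borel_measurable M" "g2 \<in> borel_measurable M"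
      using g H_meas by auto
    show "u \<in> borel_measurable ?M4 \<and> v \<in> borel_measurable ?M3"
      unfolding e U_def V_def prod.case by measurable
    show "((\<lambda>x. c * u x), (\<lambda>x. c * v x)) \<in> P" for c
      using P_I[OF H_scale[OF g(1), of c] H_scale[OF g(2), of c] H_scale[OF g(3), of c]] unfolding e U_def V_def
      by (simp add: algebra_simps)
    show "(\<integral>x. cis (u x) \<partial>?M4) = (\<integral>x. cis (v x) \<partial>?M3)"
    proof -
      have cov_add: "cov (\<lambda>x. r * g0 x + r * g1 x) g2 = r * cov g0 g2 + r * cov g1 g2"
        using H_mult_integrable[OF g(1,3)] H_mult_integrable[OF g(2,3)] by (simp add: cov_def distrib_right mult.assoc)
      have v3: "var (\<lambda>x. r * g0 x + r * g1 x + r * g2 x)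
          = r\<^sup>2 * (var g0 + var g1 + var g2 + 2 * cov g0 g1 + 2 * cov g0 g2 + 2 * cov g1 g2)"
        using var_lin[OF H_lin[OF g(1,2), of r r] g(3), of 1 r] unfolding var_lin[OF g(1,2)] cov_add
        by (simp add: algebra_simps power2_eq_square)
      have "(\<integral>x. cis (u x) \<partial>?M4) = (\<integral>x. cis (r * g0 x + r * g1 x + r * g2 x) \<partial>M) *
          ((\<integral>x. cis (r * g0 x) \<partial>M) * ((\<integral>x. cis (r * g1 x) \<partial>M) * (\<integral>x. cis (r * g2 x) \<partial>M)))"
        unfolding e U_def prod.case
        by (subst integral_cis_pair[OF prob_space_axioms M3, of "\<lambda>x. r * g0 x + r * g1 x + r * g2 x"
              "\<lambda>q. r * g0 (fst q) + (r * g1 (fst (snd q)) + r * g2 (snd (snd q)))"], measurable,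
            subst integral_cis_pair[OF prob_space_axioms M2, of "\<lambda>x. r * g0 x"
              "\<lambda>q. r * g1 (fst q) + r * g2 (snd q)"], measurable,
            subst integral_cis_pair[OF prob_space_axioms prob_space_axioms, of "\<lambda>x. r * g1 x"
              "\<lambda>q. r * g2 q"], measurable)
      also have "\<dots> = of_real (exp (- (var (\<lambda>x. r * g0 x + r * g1 x + r * g2 x)
           + (var (\<lambda>x. r * g0 x) + (var (\<lambda>x. r * g1 x) + var (\<lambda>x. r * g2 x)))) / 2))"
        using g by (subst char_H, intro H_lin H_add H_scale g, subst char_H, intro H_scale g, subst char_H, intro H_scale g,
            subst char_H, intro H_scale g) (simp add: add_divide_distrib diff_divide_distrib flip: of_real_mult exp_add)
      also have "\<dots> = of_real (exp (- (var (\<lambda>x. r * g0 x + r * g1 x)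
           + (var (\<lambda>x. r * g0 x + r * g2 x) + var (\<lambda>x. r * g1 x + r * g2 x))) / 2))"
        unfolding v3 unfolding var_scale var_lin[OF g(1,2)] var_lin[OF g(1,3)] var_lin[OF g(2,3)]
        by (simp add: algebra_simps power2_eq_square)
      also have "\<dots> = (\<integral>x. cis (r * g0 x + r * g1 x) \<partial>M) *
          ((\<integral>x. cis (r * g0 x + r * g2 x) \<partial>M) * (\<integral>x. cis (r * g1 x + r * g2 x) \<partial>M))"
        using g by (subst char_H, intro H_lin g, subst char_H, intro H_lin g, subst char_H, intro H_lin g)
           (simp add: add_divide_distrib diff_divide_distrib flip: of_real_mult exp_add)
      also have "\<dots> = (\<integral>x. cis (v x) \<partial>?M3)"
        unfolding e V_def prod.case
        by (subst integral_cis_pair[OF prob_space_axioms M2, of "\<lambda>x. r * g0 x + r * g1 x"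
              "\<lambda>q. (r * g0 (fst q) + r * g2 (fst q)) + (r * g1 (snd q) + r * g2 (snd q))"], measurable,
            subst integral_cis_pair[OF prob_space_axioms prob_space_axioms, of "\<lambda>x. r * g0 x + r * g2 x"
              "\<lambda>q. r * g1 q + r * g2 q"], measurable)
      finally show ?thesis .
    qed
    fix u' v' assume uv: "(u', v') \<in> P"
    then obtain k0 k1 k2 where k: "k0 \<in> H" "k1 \<in> H" "k2 \<in> H" and e': "u' = U (k0, k1, k2)" "v' = V (k0, k1, k2)"
      unfolding P_def by auto
    show "((\<lambda>x. u x + u' x), (\<lambda>x. v x + v' x)) \<in> P"
      using P_I[OF H_add[OF g(1) k(1)] H_add[OF g(2) k(2)] H_add[OF g(3) k(3)]] unfolding e e' U_def V_def
      by (simp add: algebra_simps)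
  qed
  define Z1 where "Z1 = (\<lambda>(h :: 'a \<Rightarrow> real, s :: nat) (q :: 'a \<times> 'a \<times> 'a \<times> 'a).
    r * h (fst q) + r * h (if s = 0 then fst (snd q) else if s = 1 then fst (snd (snd q)) else snd (snd (snd q))))"
  define Z2 where "Z2 = (\<lambda>(h :: 'a \<Rightarrow> real, s :: nat) (q :: 'a \<times> 'a \<times> 'a).
    if s = 0 then r * h (fst q) + r * h (fst (snd q)) else if s = 1 then r * h (fst q) + r * h (snd (snd q))
    else r * h (fst (snd q)) + r * h (snd (snd q)))"
  have ZP: "(Z1 i, Z2 i) \<in> P" if iI: "i \<in> I" for i
  proof -
    obtain h s where i: "i = (h, s)" "h \<in> H" "s = 0 \<or> s = 1 \<or> s = 2" using iI by (auto simp: I_def)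
    show ?thesis
      using i(3) P_I[OF i(2) H_zero H_zero] P_I[OF H_zero i(2) H_zero] P_I[OF H_zero H_zero i(2)]
      unfolding i(1) Z1_def Z2_def U_def V_def by auto
  qed
  have Zr [measurable]: "(\<lambda>x. \<lambda>i\<in>I. Z1 i x) \<in> measurable ?M4 (PiM I (\<lambda>_. borel))"
     "(\<lambda>x. \<lambda>i\<in>I. Z2 i x) \<in> measurable ?M3 (PiM I (\<lambda>_. borel))"
    using ZP P_meas by (auto intro!: measurable_restrict)
  have eq: "distr ?M4 (PiM I (\<lambda>_. borel)) (\<lambda>x. \<lambda>i\<in>I. Z1 i x) = distr ?M3 (PiM I (\<lambda>_. borel)) (\<lambda>x. \<lambda>i\<in>I. Z2 i x)"
    using ZP H_zero by (intro distr_PiM_eq) (auto simp: P_def)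
  define \<Phi> where "\<Phi> = (\<lambda>\<zeta> :: ('a \<Rightarrow> real) \<times> nat \<Rightarrow> real. ((\<lambda>h\<in>H. \<zeta> (h, 0)), (\<lambda>h\<in>H. \<zeta> (h, 1)), (\<lambda>h\<in>H. \<zeta> (h, 2))))"
  have [measurable]: "\<Phi> \<in> measurable (PiM I (\<lambda>_. borel)) (paths \<Otimes>\<^sub>M (paths \<Otimes>\<^sub>M paths))"
    unfolding \<Phi>_def by (intro measurable_Pair measurable_restrict measurable_component_singleton) (auto simp: I_def)
  have e1: "\<Phi> (\<lambda>i\<in>I. Z1 i q) = (case q of (w, x, y, z) \<Rightarrow>
      (mix r2 r2 (path w) (path x), mix r2 r2 (path w) (path y), mix r2 r2 (path w) (path z)))" for q
    unfolding r_def[symmetric]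
    by (auto simp: \<Phi>_def Z1_def mix_def path_def I_def fun_eq_iff split: prod.splits)
  have e2: "\<Phi> (\<lambda>i\<in>I. Z2 i q) = (case q of (x, y, z) \<Rightarrow>
      (mix r2 r2 (path x) (path y), mix r2 r2 (path x) (path z), mix r2 r2 (path y) (path z)))" for q
    unfolding r_def[symmetric]
    by (auto simp: \<Phi>_def Z2_def mix_def path_def I_def fun_eq_iff split: prod.splits)
  show ?thesis
    using arg_cong[OF eq, of "\<lambda>D. distr D (paths \<Otimes>\<^sub>M (paths \<Otimes>\<^sub>M paths)) \<Phi>"]
    by (simp add: distr_distr comp_def e1 e2)
qed

end

section \<open>The Wick product as an integral operator\<close>

text \<open>The integral of a non-integrable function is 0 by convention, so the bound survives in
  that case.\<close>

lemma ennreal_norm_integral_le: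
  fixes f :: "'a \<Rightarrow> complex"
  shows "ennreal (cmod (\<integral>x. f x \<partial>M)) \<le> (\<integral>\<^sup>+x. ennreal (cmod (f x)) \<partial>M)"
  using integral_norm_bound_ennreal[of M f]
  by (cases "integrable M f") (auto simp: not_integrable_integral_eq)

text \<open>Cauchy-Schwarz in \<open>z\<close> for fixed \<open>x\<close> and \<open>y\<close>
  bounds the square of \<open>K\<close> by a function of \<open>x\<close> times a function of
  \<open>y\<close>; Cauchy-Schwarz in the pair then separates \<open>\<Phi>\<close> from
  \<open>K\<close>, and the remaining double integral factorises.\<close>

lemma (in prob_space) Cauchy_Schwarz_triangle:
  fixes \<Phi> \<Psi> X :: "'a \<times> 'a \<Rightarrow> ennreal"
  assumes [measurable]: "\<Phi> \<in> borel_measurable (M \<Otimes>\<^sub>M M)" "\<Psi> \<in> borel_measurable (M \<Otimes>\<^sub>M M)" "X \<in> borel_measurable (M \<Otimes>\<^sub>M M)"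
  shows "(\<integral>\<^sup>+x. \<integral>\<^sup>+y. \<integral>\<^sup>+z. \<Phi> (x, y) * \<Psi> (x, z) * X (y, z) \<partial>M \<partial>M \<partial>M)\<^sup>2
     \<le> (\<integral>\<^sup>+x. \<integral>\<^sup>+y. (\<Phi> (x, y))\<^sup>2 \<partial>M \<partial>M) * (\<integral>\<^sup>+x. \<integral>\<^sup>+y. (\<Psi> (x, y))\<^sup>2 \<partial>M \<partial>M) * (\<integral>\<^sup>+x. \<integral>\<^sup>+y. (X (x, y))\<^sup>2 \<partial>M \<partial>M)"
proof -
  define K where "K = (\<lambda>(x, y). \<integral>\<^sup>+z. \<Psi> (x, z) * X (y, z) \<partial>M)"
  have [measurable]: "K \<in> borel_measurable (M \<Otimes>\<^sub>M M)" unfolding K_def by measurable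
  have K2: "(K (x, y))\<^sup>2 \<le> (\<integral>\<^sup>+z. (\<Psi> (x, z))\<^sup>2 \<partial>M) * (\<integral>\<^sup>+z. (X (y, z))\<^sup>2 \<partial>M)"
    if [measurable]: "x \<in> space M" "y \<in> space M" for x y
    unfolding K_def prod.case by (rule Cauchy_Schwarz_nn_integral; measurable)
  have "(\<integral>\<^sup>+x. \<integral>\<^sup>+y. \<integral>\<^sup>+z. \<Phi> (x, y) * \<Psi> (x, z) * X (y, z) \<partial>M \<partial>M \<partial>M)
      = (\<integral>\<^sup>+x. \<integral>\<^sup>+y. \<Phi> (x, y) * K (x, y) \<partial>M \<partial>M)"
    unfolding K_def prod.case
    by (intro nn_integral_cong) (subst nn_integral_cmult[symmetric], measurable, simp add: mult.assoc)
  also have "\<dots> = (\<integral>\<^sup>+z. \<Phi> z * K z \<partial>(M \<Otimes>\<^sub>M M))"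
    by (rule nn_integral_fst) measurable
  finally have "(\<integral>\<^sup>+x. \<integral>\<^sup>+y. \<integral>\<^sup>+z. \<Phi> (x, y) * \<Psi> (x, z) * X (y, z) \<partial>M \<partial>M \<partial>M)\<^sup>2
      \<le> (\<integral>\<^sup>+z. (\<Phi> z)\<^sup>2 \<partial>(M \<Otimes>\<^sub>M M)) * (\<integral>\<^sup>+z. (K z)\<^sup>2 \<partial>(M \<Otimes>\<^sub>M M))"
    using Cauchy_Schwarz_nn_integral[of \<Phi> "M \<Otimes>\<^sub>M M" K] by simp
  also have "(\<integral>\<^sup>+z. (\<Phi> z)\<^sup>2 \<partial>(M \<Otimes>\<^sub>M M)) = (\<integral>\<^sup>+x. \<integral>\<^sup>+y. (\<Phi> (x, y))\<^sup>2 \<partial>M \<partial>M)"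
    by (rule nn_integral_fst[symmetric]) measurable
  also have "(\<integral>\<^sup>+z. (K z)\<^sup>2 \<partial>(M \<Otimes>\<^sub>M M)) = (\<integral>\<^sup>+x. \<integral>\<^sup>+y. (K (x, y))\<^sup>2 \<partial>M \<partial>M)"
    by (rule nn_integral_fst[symmetric]) measurable
  also have "\<dots> \<le> (\<integral>\<^sup>+x. \<integral>\<^sup>+y. (\<integral>\<^sup>+z. (\<Psi> (x, z))\<^sup>2 \<partial>M) * (\<integral>\<^sup>+z. (X (y, z))\<^sup>2 \<partial>M) \<partial>M \<partial>M)"
    using K2 by (intro nn_integral_mono) auto
  also have "\<dots> = (\<integral>\<^sup>+x. \<integral>\<^sup>+y. (\<Psi> (x, y))\<^sup>2 \<partial>M \<partial>M) * (\<integral>\<^sup>+x. \<integral>\<^sup>+y. (X (x, y))\<^sup>2 \<partial>M \<partial>M)"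
    by (subst nn_integral_cmult, measurable, subst nn_integral_multc, measurable)
  finally show ?thesis by (simp add: mult.assoc mult_left_mono)
qed

context gaussian_space
begin

lemma measurable_path_comp [measurable (raw)]:
  "F \<in> borel_measurable paths \<Longrightarrow> f \<in> measurable N M \<Longrightarrow> (\<lambda>x. F (path (f x))) \<in> borel_measurable N"
  by (rule measurable_compose[OF measurable_compose[OF _ path_measurable]])

lemma nn_integral_rotate:
  assumes ab: "a\<^sup>2 + b\<^sup>2 = 1" and [measurable]: "\<Theta> \<in> borel_measurable (paths \<Otimes>\<^sub>M paths)"
  shows "(\<integral>\<^sup>+x. \<integral>\<^sup>+y. \<Theta> (mix a b (path x) (path y), mix b (-a) (path x) (path y)) \<partial>M \<partial>M)
       = (\<integral>\<^sup>+x. \<integral>\<^sup>+y. \<Theta> (path x, path y) \<partial>M \<partial>M)"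
proof -
  have "(\<integral>\<^sup>+x. \<integral>\<^sup>+y. \<Theta> (mix a b (path x) (path y), mix b (-a) (path x) (path y)) \<partial>M \<partial>M)
    = (\<integral>\<^sup>+z. \<Theta> (case z of (x, y) \<Rightarrow> (mix a b (path x) (path y), mix b (-a) (path x) (path y))) \<partial>(M \<Otimes>\<^sub>M M))"
    by (subst nn_integral_fst[symmetric]) auto
  also have "\<dots> = (\<integral>\<^sup>+z. \<Theta> z \<partial>distr (M \<Otimes>\<^sub>M M) (paths \<Otimes>\<^sub>M paths) (\<lambda>(x, y). (mix a b (path x) (path y), mix b (-a) (path x) (path y))))"
    by (subst nn_integral_distr) auto
  also have "\<dots> = (\<integral>\<^sup>+z. \<Theta> z \<partial>distr (M \<Otimes>\<^sub>M M) (paths \<Otimes>\<^sub>M paths) (\<lambda>(x, y). (path x, path y)))"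
    unfolding rotation_law[OF ab] ..
  also have "\<dots> = (\<integral>\<^sup>+z. \<Theta> (case z of (x, y) \<Rightarrow> (path x, path y)) \<partial>(M \<Otimes>\<^sub>M M))"
    by (subst nn_integral_distr) auto
  also have "\<dots> = (\<integral>\<^sup>+x. \<integral>\<^sup>+y. \<Theta> (path x, path y) \<partial>M \<partial>M)"
    by (subst nn_integral_fst[symmetric]) auto
  finally show ?thesis .
qed

lemma nn_integral_mix:
  assumes ab: "a\<^sup>2 + b\<^sup>2 = 1" and [measurable]: "g \<in> borel_measurable paths"
  shows "(\<integral>\<^sup>+x. \<integral>\<^sup>+y. g (mix a b (path x) (path y)) \<partial>M \<partial>M) = (\<integral>\<^sup>+x. g (path x) \<partial>M)"
  using nn_integral_rotate[OF ab, of "\<lambda>z. g (fst z)"] by (simp add: emeasure_space_1)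

lemma
  fixes \<Theta> :: "_ \<Rightarrow> complex"
  assumes ab: "a\<^sup>2 + b\<^sup>2 = 1" and [measurable]: "\<Theta> \<in> borel_measurable (paths \<Otimes>\<^sub>M paths)"
  shows integrable_rotate: "integrable (M \<Otimes>\<^sub>M M) (\<lambda>(x, y). \<Theta> (mix a b (path x) (path y), mix b (-a) (path x) (path y)))
       \<longleftrightarrow> integrable (M \<Otimes>\<^sub>M M) (\<lambda>(x, y). \<Theta> (path x, path y))"
    and integral_rotate: "(\<integral>(x, y). \<Theta> (mix a b (path x) (path y), mix b (-a) (path x) (path y)) \<partial>(M \<Otimes>\<^sub>M M))
       = (\<integral>(x, y). \<Theta> (path x, path y) \<partial>(M \<Otimes>\<^sub>M M))"
proof -
  let ?r = "\<lambda>(x, y). (mix a b (path x) (path y), mix b (-a) (path x) (path y))" and ?s = "\<lambda>(x, y). (path x, path y)"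
  have "integrable (M \<Otimes>\<^sub>M M) (\<lambda>z. \<Theta> (?r z)) \<longleftrightarrow> integrable (distr (M \<Otimes>\<^sub>M M) (paths \<Otimes>\<^sub>M paths) ?r) \<Theta>"
    by (subst integrable_distr_eq) auto
  also have "\<dots> \<longleftrightarrow> integrable (M \<Otimes>\<^sub>M M) (\<lambda>z. \<Theta> (?s z))"
    unfolding rotation_law[OF ab] by (subst integrable_distr_eq) auto
  finally show "integrable (M \<Otimes>\<^sub>M M) (\<lambda>(x, y). \<Theta> (mix a b (path x) (path y), mix b (-a) (path x) (path y)))
       \<longleftrightarrow> integrable (M \<Otimes>\<^sub>M M) (\<lambda>(x, y). \<Theta> (path x, path y))"
    by (simp add: case_prod_unfold)
  have "(\<integral>z. \<Theta> (?r z) \<partial>(M \<Otimes>\<^sub>M M)) = (\<integral>z. \<Theta> z \<partial>distr (M \<Otimes>\<^sub>M M) (paths \<Otimes>\<^sub>M paths) ?r)"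
    by (subst integral_distr) auto
  also have "\<dots> = (\<integral>z. \<Theta> (?s z) \<partial>(M \<Otimes>\<^sub>M M))"
    unfolding rotation_law[OF ab] by (subst integral_distr) auto
  finally show "(\<integral>(x, y). \<Theta> (mix a b (path x) (path y), mix b (-a) (path x) (path y)) \<partial>(M \<Otimes>\<^sub>M M))
       = (\<integral>(x, y). \<Theta> (path x, path y) \<partial>(M \<Otimes>\<^sub>M M))"
    by (simp add: case_prod_unfold)
qed

text \<open>Defined at every path; where the integrand is not integrable the value is 0. For
  integrable \<open>F\<close> and \<open>G\<close> this concerns only a null set, by
  \<open>wk_L1\<close>.\<close>

definition wk :: "real \<Rightarrow> real \<Rightarrow> ((('a \<Rightarrow> real) \<Rightarrow> real) \<Rightarrow> complex) \<Rightarrow> ((('a \<Rightarrow> real) \<Rightarrow> real) \<Rightarrow> complex)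
    \<Rightarrow> (('a \<Rightarrow> real) \<Rightarrow> real) \<Rightarrow> complex" where
  "wk a b F G \<xi> = (\<integral>y. F (mix a b \<xi> (path y)) * G (mix b (-a) \<xi> (path y)) \<partial>M)"

lemma wk_measurable [measurable]:
  assumes [measurable]: "F \<in> borel_measurable paths" "G \<in> borel_measurable paths"
  shows "wk a b F G \<in> borel_measurable paths"
  unfolding wk_def[abs_def] by measurable

text \<open>Kept in nonnegative integrals because it is also the source of integrability: the L1, L2
  and L^p statements about \<open>wk\<close> obtain theirs from the finiteness of the right
  side.\<close>

lemma wk_powr_le:
  assumes ab: "a\<^sup>2 + b\<^sup>2 = 1" and p: "p \<ge> 1"
    and [measurable]: "F \<in> borel_measurable paths" "G \<in> borel_measurable paths"
  shows "(\<integral>\<^sup>+x. ennreal (cmod (wk a b F G (path x)) powr p) \<partial>M)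
     \<le> (\<integral>\<^sup>+x. ennreal (cmod (F (path x)) powr p) \<partial>M) * (\<integral>\<^sup>+x. ennreal (cmod (G (path x)) powr p) \<partial>M)"
proof -
  have "(\<integral>\<^sup>+x. ennreal (cmod (wk a b F G (path x)) powr p) \<partial>M)
    \<le> (\<integral>\<^sup>+x. \<integral>\<^sup>+y. ennreal (cmod (F (mix a b (path x) (path y)) * G (mix b (-a) (path x) (path y))) powr p) \<partial>M \<partial>M)"
    unfolding wk_def using p by (intro nn_integral_mono norm_integral_powr_le) auto
  also have "\<dots> = (\<integral>\<^sup>+x. \<integral>\<^sup>+y. ennreal (cmod (F (path x) * G (path y)) powr p) \<partial>M \<partial>M)"
    using nn_integral_rotate[OF ab, of "\<lambda>(\<xi>, \<eta>). ennreal (cmod (F \<xi> * G \<eta>) powr p)"] by simp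
  also have "\<dots> = (\<integral>\<^sup>+x. \<integral>\<^sup>+y. ennreal (cmod (F (path x)) powr p) * ennreal (cmod (G (path y)) powr p) \<partial>M \<partial>M)"
    by (simp add: norm_mult powr_mult ennreal_mult)
  also have "\<dots> = (\<integral>\<^sup>+x. ennreal (cmod (F (path x)) powr p) \<partial>M) * (\<integral>\<^sup>+x. ennreal (cmod (G (path x)) powr p) \<partial>M)"
    by (subst nn_integral_cmult, measurable, subst nn_integral_multc, measurable)
  finally show ?thesis .
qed

lemma wk_nn_norm_le:
  assumes ab: "a\<^sup>2 + b\<^sup>2 = 1"
    and [measurable]: "F \<in> borel_measurable paths" "G \<in> borel_measurable paths"
  shows "(\<integral>\<^sup>+x. ennreal (cmod (wk a b F G (path x))) \<partial>M)
     \<le> (\<integral>\<^sup>+x. ennreal (cmod (F (path x))) \<partial>M) * (\<integral>\<^sup>+x. ennreal (cmod (G (path x))) \<partial>M)"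
  using wk_powr_le[OF ab, of 1 F G] by simp

lemma wk_L2c:
  assumes ab: "a\<^sup>2 + b\<^sup>2 = 1" and m [measurable]: "F \<in> borel_measurable paths" "G \<in> borel_measurable paths"
    and L: "(\<lambda>x. F (path x)) \<in> L2c M" "(\<lambda>x. G (path x)) \<in> L2c M"
  shows "(\<lambda>x. wk a b F G (path x)) \<in> L2c M"
    "norm2 M (\<lambda>x. wk a b F G (path x)) \<le> norm2 M (\<lambda>x. F (path x)) * norm2 M (\<lambda>x. G (path x))"
proof -
  have le: "(\<integral>\<^sup>+x. ennreal ((cmod (wk a b F G (path x)))\<^sup>2) \<partial>M) \<le> ennreal ((norm2 M (\<lambda>x. F (path x)) * norm2 M (\<lambda>x. G (path x)))\<^sup>2)"
    using wk_powr_le[OF ab _ m, of 2] L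
    by (simp add: powr_numeral nn_integral_eq_integral L2cD norm2_sq power_mult_distrib ennreal_mult)
  have i: "integrable M (\<lambda>x. (cmod (wk a b F G (path x)))\<^sup>2)"
    by (intro integrableI_nonneg) (auto intro: le_less_trans[OF le])
  then show "(\<lambda>x. wk a b F G (path x)) \<in> L2c M" by (simp add: L2c_def)
  have "(norm2 M (\<lambda>x. wk a b F G (path x)))\<^sup>2 \<le> (norm2 M (\<lambda>x. F (path x)) * norm2 M (\<lambda>x. G (path x)))\<^sup>2"
    using le i by (simp add: nn_integral_eq_integral norm2_sq)
  then show "norm2 M (\<lambda>x. wk a b F G (path x)) \<le> norm2 M (\<lambda>x. F (path x)) * norm2 M (\<lambda>x. G (path x))"
    by (rule power2_le_imp_le) simp
qed

text \<open>The adjoint form of \<open>wk\<close>: since the reflection is its own inverse, the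
  change of variables moves it from \<open>F\<close> and \<open>G\<close> onto the test function
  \<open>K\<close>. Orthogonality and the Fourier identity are both read off from here.\<close>

lemma integral_wk_mult:
  assumes ab: "a\<^sup>2 + b\<^sup>2 = 1"
    and [measurable]: "F \<in> borel_measurable paths" "G \<in> borel_measurable paths" "K \<in> borel_measurable paths"
    and i: "integrable (M \<Otimes>\<^sub>M M) (\<lambda>(x, y). F (path x) * G (path y) * K (mix a b (path x) (path y)))"
  shows "(\<integral>x. wk a b F G (path x) * K (path x) \<partial>M)
     = (\<integral>(x, y). F (path x) * G (path y) * K (mix a b (path x) (path y)) \<partial>(M \<Otimes>\<^sub>M M))"
proof -
  interpret MM: pair_prob_space M M ..
  define \<Theta> where "\<Theta> = (\<lambda>(\<xi>, \<eta>). F \<xi> * G \<eta> * K (mix a b \<xi> \<eta>))"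
  have [measurable]: "\<Theta> \<in> borel_measurable (paths \<Otimes>\<^sub>M paths)" unfolding \<Theta>_def by measurable
  have \<Theta>: "\<Theta> (mix a b (path x) (path y), mix b (-a) (path x) (path y))
     = F (mix a b (path x) (path y)) * G (mix b (-a) (path x) (path y)) * K (path x)" for x y
    by (simp add: \<Theta>_def mix_rotate[OF ab])
  have "integrable (M \<Otimes>\<^sub>M M) (\<lambda>(x, y). F (mix a b (path x) (path y)) * G (mix b (-a) (path x) (path y)) * K (path x))"
    using integrable_rotate[OF ab, of \<Theta>] i unfolding \<Theta> by (simp add: \<Theta>_def)
  from MM.integral_fst[OF this]
  have "(\<integral>x. wk a b F G (path x) * K (path x) \<partial>M)
     = (\<integral>(x, y). F (mix a b (path x) (path y)) * G (mix b (-a) (path x) (path y)) * K (path x) \<partial>(M \<Otimes>\<^sub>M M))"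
    by (simp add: wk_def)
  also have "\<dots> = (\<integral>(x, y). \<Theta> (path x, path y) \<partial>(M \<Otimes>\<^sub>M M))"
    using integral_rotate[OF ab, of \<Theta>] unfolding \<Theta> by simp
  finally show ?thesis by (simp add: \<Theta>_def)
qed

lemma integral_pair_mult:
  fixes f g :: "'a \<Rightarrow> complex"
  assumes "integrable M f" "integrable M g"
  shows "integrable (M \<Otimes>\<^sub>M M) (\<lambda>(x, y). f x * g y)"
    "(\<integral>(x, y). f x * g y \<partial>(M \<Otimes>\<^sub>M M)) = (\<integral>x. f x \<partial>M) * (\<integral>x. g x \<partial>M)"
proof -
  interpret MM: pair_prob_space M M ..
  have [measurable]: "f \<in> borel_measurable M" "g \<in> borel_measurable M" using assms by auto
  have "(\<integral>\<^sup>+z. ennreal (norm (case z of (x, y) \<Rightarrow> f x * g y)) \<partial>(M \<Otimes>\<^sub>M M))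
      = (\<integral>\<^sup>+x. \<integral>\<^sup>+y. ennreal (cmod (f x)) * ennreal (cmod (g y)) \<partial>M \<partial>M)"
    by (subst nn_integral_fst[symmetric]) (auto simp: norm_mult ennreal_mult)
  also have "\<dots> = (\<integral>\<^sup>+x. ennreal (cmod (f x)) \<partial>M) * (\<integral>\<^sup>+x. ennreal (cmod (g x)) \<partial>M)"
    by (subst nn_integral_cmult, measurable, subst nn_integral_multc, measurable)
  also have "\<dots> < \<infinity>"
    using assms by (auto simp: integrable_iff_bounded ennreal_mult_less_top)
  finally show i: "integrable (M \<Otimes>\<^sub>M M) (\<lambda>(x, y). f x * g y)"
    by (intro integrableI_bounded) auto
  show "(\<integral>(x, y). f x * g y \<partial>(M \<Otimes>\<^sub>M M)) = (\<integral>x. f x \<partial>M) * (\<integral>x. g x \<partial>M)"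
    using MM.integral_fst[OF i] by simp
qed

text \<open>An exponential of a linear functional splits over \<open>mix\<close> into a factor for
  each path, which turns the adjoint formula into a product of two integrals.\<close>

lemma integral_wk_cis:
  assumes ab: "a\<^sup>2 + b\<^sup>2 = 1" and h: "h \<in> H"
    and [measurable]: "F \<in> borel_measurable paths" "G \<in> borel_measurable paths"
    and i: "integrable M (\<lambda>x. F (path x))" "integrable M (\<lambda>x. G (path x))"
  shows "(\<integral>x. wk a b F G (path x) * cis (h x) \<partial>M)
     = (\<integral>x. F (path x) * cis (a * h x) \<partial>M) * (\<integral>x. G (path x) * cis (b * h x) \<partial>M)"
proof -
  have hm: "(\<lambda>\<xi>. \<xi> h) \<in> borel_measurable paths" using h by measurable
  have [measurable]: "h \<in> borel_measurable M" using h H_meas by auto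
  have i1: "integrable M (\<lambda>x. F (path x) * cis (a * h x))"
    by (rule integrable_mult_cis[OF i(1)]) measurable
  have i2: "integrable M (\<lambda>x. G (path x) * cis (b * h x))"
    by (rule integrable_mult_cis[OF i(2)]) measurable
  have e: "F (path x) * G (path y) * cis (mix a b (path x) (path y) h) = (F (path x) * cis (a * h x)) * (G (path y) * cis (b * h y))" for x y
    using h by (simp add: cis_mult[symmetric] ac_simps)
  have "(\<integral>x. wk a b F G (path x) * cis (path x h) \<partial>M)
     = (\<integral>(x, y). F (path x) * G (path y) * cis (mix a b (path x) (path y) h) \<partial>(M \<Otimes>\<^sub>M M))"
  proof (rule integral_wk_mult[OF ab, where K="\<lambda>\<xi>. cis (\<xi> h)"])
    show "(\<lambda>\<xi>. cis (\<xi> h)) \<in> borel_measurable paths" using hm by measurable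
    show "integrable (M \<Otimes>\<^sub>M M) (\<lambda>(x, y). F (path x) * G (path y) * cis (mix a b (path x) (path y) h))"
      unfolding e using integral_pair_mult(1)[OF i1 i2] .
  qed measurable
  then show ?thesis unfolding e integral_pair_mult(2)[OF i1 i2] using h by simp
qed

text \<open>\<open>ou\<close> is the Ornstein--Uhlenbeck operator \<open>\<Gamma>(1 / sqrt 2)\<close>.\<close>

abbreviation "ou F \<equiv> wk r2 r2 F (\<lambda>_. 1)"

lemma r2_sq: "r2\<^sup>2 + r2\<^sup>2 = 1" by (simp add: power_divide)

text \<open>
  By \<open>trilinear_law\<close> the three arguments may be taken as \<open>x + y\<close>, \<open>x + z\<close>, \<open>y + z\<close> over \<open>sqrt 2\<close>; every
  variable then occurs in only two factors and Cauchy--Schwarz applies twice.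
\<close>

lemma ou_triple_le:
  assumes [measurable]: "F \<in> borel_measurable paths" "G \<in> borel_measurable paths" "K \<in> borel_measurable paths"
  shows "(\<integral>\<^sup>+w. ennreal (cmod (ou F (path w) * ou G (path w) * ou K (path w))) \<partial>M)\<^sup>2
     \<le> (\<integral>\<^sup>+x. ennreal ((cmod (F (path x)))\<^sup>2) \<partial>M) * (\<integral>\<^sup>+x. ennreal ((cmod (G (path x)))\<^sup>2) \<partial>M)
        * (\<integral>\<^sup>+x. ennreal ((cmod (K (path x)))\<^sup>2) \<partial>M)"
proof -
  interpret M2: pair_prob_space M M ..
  interpret M3: pair_prob_space M "M \<Otimes>\<^sub>M M" ..
  note fst3 = sigma_finite_measure.nn_integral_fst[OF prob_space_imp_sigma_finite[OF M2.prob_space_axioms], symmetric]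
  note fst4 = sigma_finite_measure.nn_integral_fst[OF prob_space_imp_sigma_finite[OF M3.prob_space_axioms], symmetric]
  have it3: "(\<integral>\<^sup>+q. f q \<partial>(M \<Otimes>\<^sub>M (M \<Otimes>\<^sub>M M))) = (\<integral>\<^sup>+x. \<integral>\<^sup>+y. \<integral>\<^sup>+z. f (x, y, z) \<partial>M \<partial>M \<partial>M)"
    if [measurable]: "f \<in> borel_measurable (M \<Otimes>\<^sub>M (M \<Otimes>\<^sub>M M))" for f
    by (subst fst3, measurable, intro nn_integral_cong nn_integral_fst[symmetric]) measurable
  have it4: "(\<integral>\<^sup>+q. f q \<partial>(M \<Otimes>\<^sub>M (M \<Otimes>\<^sub>M (M \<Otimes>\<^sub>M M)))) = (\<integral>\<^sup>+w. \<integral>\<^sup>+x. \<integral>\<^sup>+y. \<integral>\<^sup>+z. f (w, x, y, z) \<partial>M \<partial>M \<partial>M \<partial>M)"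
    if [measurable]: "f \<in> borel_measurable (M \<Otimes>\<^sub>M (M \<Otimes>\<^sub>M (M \<Otimes>\<^sub>M M)))" for f
    by (subst fst4, measurable, intro nn_integral_cong it3) measurable
  define \<Phi> where "\<Phi> F = (\<lambda>(x, y). ennreal (cmod (F (mix r2 r2 (path x) (path y)))))" for F :: "(('a \<Rightarrow> real) \<Rightarrow> real) \<Rightarrow> complex"
  have \<Phi>m [measurable]: "\<Phi> F \<in> borel_measurable (M \<Otimes>\<^sub>M M)" if [measurable]: "F \<in> borel_measurable paths" for F
    unfolding \<Phi>_def by measurable
  have ou_le: "ennreal (cmod (ou F (path w))) \<le> (\<integral>\<^sup>+x. \<Phi> F (w, x) \<partial>M)" for F w
    unfolding wk_def \<Phi>_def prod.case using ennreal_norm_integral_le by auto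
  define \<Theta> where "\<Theta> = (\<lambda>(\<xi>, \<eta>, \<zeta>). ennreal (cmod (F \<xi>)) * ennreal (cmod (G \<eta>)) * ennreal (cmod (K \<zeta>)))"
  have [measurable]: "\<Theta> \<in> borel_measurable (paths \<Otimes>\<^sub>M (paths \<Otimes>\<^sub>M paths))" unfolding \<Theta>_def by measurable
  have "(\<integral>\<^sup>+w. ennreal (cmod (ou F (path w) * ou G (path w) * ou K (path w))) \<partial>M)
     \<le> (\<integral>\<^sup>+w. (\<integral>\<^sup>+x. \<Phi> F (w, x) \<partial>M) * (\<integral>\<^sup>+y. \<Phi> G (w, y) \<partial>M) * (\<integral>\<^sup>+z. \<Phi> K (w, z) \<partial>M) \<partial>M)"
    unfolding norm_mult ennreal_mult[OF mult_nonneg_nonneg[OF norm_ge_zero norm_ge_zero] norm_ge_zero]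
      ennreal_mult[OF norm_ge_zero norm_ge_zero]
    by (intro nn_integral_mono mult_mono ou_le) auto
  also have "\<dots> = (\<integral>\<^sup>+w. \<integral>\<^sup>+x. \<integral>\<^sup>+y. \<integral>\<^sup>+z. \<Phi> F (w, x) * \<Phi> G (w, y) * \<Phi> K (w, z) \<partial>M \<partial>M \<partial>M \<partial>M)"
    by (intro nn_integral_cong) (simp add: nn_integral_cmult nn_integral_multc)
  also have "\<dots> = (\<integral>\<^sup>+q. \<Theta> (case q of (w, x, y, z) \<Rightarrow> (mix r2 r2 (path w) (path x), mix r2 r2 (path w) (path y), mix r2 r2 (path w) (path z)))
       \<partial>(M \<Otimes>\<^sub>M (M \<Otimes>\<^sub>M (M \<Otimes>\<^sub>M M))))"
    by (subst it4) (auto simp: \<Phi>_def \<Theta>_def)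
  also have "\<dots> = (\<integral>\<^sup>+q. \<Theta> (case q of (x, y, z) \<Rightarrow> (mix r2 r2 (path x) (path y), mix r2 r2 (path x) (path z), mix r2 r2 (path y) (path z)))
       \<partial>(M \<Otimes>\<^sub>M (M \<Otimes>\<^sub>M M)))"
    using arg_cong[OF trilinear_law, of "\<lambda>D. \<integral>\<^sup>+q. \<Theta> q \<partial>D"]
    by (subst (asm) (1 2) nn_integral_distr) auto
  also have "\<dots> = (\<integral>\<^sup>+x. \<integral>\<^sup>+y. \<integral>\<^sup>+z. \<Phi> F (x, y) * \<Phi> G (x, z) * \<Phi> K (y, z) \<partial>M \<partial>M \<partial>M)"
    by (subst it3) (auto simp: \<Phi>_def \<Theta>_def)
  finally have "(\<integral>\<^sup>+w. ennreal (cmod (ou F (path w) * ou G (path w) * ou K (path w))) \<partial>M)\<^sup>2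
     \<le> (\<integral>\<^sup>+x. \<integral>\<^sup>+y. \<integral>\<^sup>+z. \<Phi> F (x, y) * \<Phi> G (x, z) * \<Phi> K (y, z) \<partial>M \<partial>M \<partial>M)\<^sup>2"
    by (rule power_mono) simp
  also have "\<dots> \<le> (\<integral>\<^sup>+x. \<integral>\<^sup>+y. (\<Phi> F (x, y))\<^sup>2 \<partial>M \<partial>M) * (\<integral>\<^sup>+x. \<integral>\<^sup>+y. (\<Phi> G (x, y))\<^sup>2 \<partial>M \<partial>M) * (\<integral>\<^sup>+x. \<integral>\<^sup>+y. (\<Phi> K (x, y))\<^sup>2 \<partial>M \<partial>M)"
    by (rule Cauchy_Schwarz_triangle) measurable
  finally have le: "(\<integral>\<^sup>+w. ennreal (cmod (ou F (path w) * ou G (path w) * ou K (path w))) \<partial>M)\<^sup>2 \<le> \<dots>" .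
  have "(\<integral>\<^sup>+x. \<integral>\<^sup>+y. (\<Phi> F (x, y))\<^sup>2 \<partial>M \<partial>M) = (\<integral>\<^sup>+x. ennreal ((cmod (F (path x)))\<^sup>2) \<partial>M)"
    if [measurable]: "F \<in> borel_measurable paths" for F
    using nn_integral_mix[OF r2_sq, of "\<lambda>\<xi>. ennreal ((cmod (F \<xi>))\<^sup>2)"] by (simp add: \<Phi>_def ennreal_power)
  with le show ?thesis by simp
qed

end

section \<open>Polynomials on path space\<close>

context gaussian_space
begin

definition pmon :: "('a \<Rightarrow> real) list \<Rightarrow> (('a \<Rightarrow> real) \<Rightarrow> real) \<Rightarrow> complex" where
  "pmon hs \<xi> = (\<Prod>h\<leftarrow>hs. complex_of_real (\<xi> h))"

lemma pmon_Nil [simp]: "pmon [] \<xi> = 1"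
  and pmon_Cons [simp]: "pmon (h # hs) \<xi> = of_real (\<xi> h) * pmon hs \<xi>"
  and pmon_append: "pmon (hs @ ks) \<xi> = pmon hs \<xi> * pmon ks \<xi>"
  by (simp_all add: pmon_def)

text \<open>
  \<open>Q n\<close> contains the polynomials of degree strictly below \<open>n\<close>, so that the case \<open>n = 0\<close> of the chaos
  decomposition needs no special treatment; in \<open>D S\<close> the pair of degrees in the two paths lies in \<open>S\<close>.
\<close>

inductive_set Q :: "nat \<Rightarrow> ((('a \<Rightarrow> real) \<Rightarrow> real) \<Rightarrow> complex) set" for n where
  Q_zero: "(\<lambda>\<xi>. 0) \<in> Q n"
| Q_step: "p \<in> Q n \<Longrightarrow> set hs \<subseteq> H \<Longrightarrow> length hs < n \<Longrightarrow> (\<lambda>\<xi>. c * pmon hs \<xi> + p \<xi>) \<in> Q n"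

lemma Q_mon: "set hs \<subseteq> H \<Longrightarrow> length hs < n \<Longrightarrow> (\<lambda>\<xi>. c * pmon hs \<xi>) \<in> Q n"
  using Q_step[OF Q_zero, of hs n c] by simp

lemma Q_const: "0 < n \<Longrightarrow> (\<lambda>\<xi>. c) \<in> Q n"
  using Q_mon[of "[]" n c] by simp

lemma Q_add: assumes "p \<in> Q n" "q \<in> Q n" shows "(\<lambda>\<xi>. p \<xi> + q \<xi>) \<in> Q n"
  using assms(1)
proof induction
  case (Q_step p hs c)
  from Q.Q_step[OF this(4,2,3), of c] show ?case by (simp add: add.assoc)
qed (use assms in simp)

lemma Q_cmult: assumes "p \<in> Q n" shows "(\<lambda>\<xi>. c * p \<xi>) \<in> Q n"
  using assms
proof induction
  case (Q_step p hs d)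
  from Q.Q_step[OF this(4,2,3), of "c * d"] show ?case by (simp add: algebra_simps)
qed (simp add: Q_zero)

lemma Q_diff: assumes "p \<in> Q n" "q \<in> Q n" shows "(\<lambda>\<xi>. p \<xi> - q \<xi>) \<in> Q n"
  using Q_add[OF assms(1) Q_cmult[OF assms(2), of "-1"]] by simp

lemma Q_mono: assumes "p \<in> Q n" "n \<le> m" shows "p \<in> Q m"
  using assms by (induction) (auto intro: Q_zero Q_step)

lemma Q_0: assumes "p \<in> Q 0" shows "p = (\<lambda>\<xi>. 0)"
  using assms by (induction) auto

lemma Q_mult_mon:
  assumes "p \<in> Q n" "set hs \<subseteq> H" shows "(\<lambda>\<xi>. pmon hs \<xi> * p \<xi>) \<in> Q (length hs + n)"
  using assms(1)
proof induction
  case (Q_step p ks c)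
  then have "(\<lambda>\<xi>. c * pmon (hs @ ks) \<xi> + pmon hs \<xi> * p \<xi>) \<in> Q (length hs + n)"
    using assms(2) by (intro Q.Q_step) auto
  then show ?case by (simp add: pmon_append algebra_simps)
qed (simp add: Q_zero)

lemma Q_mult: assumes "p \<in> Q (Suc i)" "q \<in> Q (Suc j)" shows "(\<lambda>\<xi>. p \<xi> * q \<xi>) \<in> Q (Suc (i + j))"
  using assms(1)
proof induction
  case (Q_step p hs c)
  have "(\<lambda>\<xi>. pmon hs \<xi> * q \<xi>) \<in> Q (Suc (i + j))"
    using Q_mult_mon[OF assms(2) Q_step(2)] by (rule Q_mono) (use Q_step in simp)
  from Q_add[OF Q_cmult[OF this, of c] Q_step.IH] show ?case by (simp add: algebra_simps)
qed (simp add: Q_zero)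

lemma Q_cnj: assumes "p \<in> Q n" shows "(\<lambda>\<xi>. cnj (p \<xi>)) \<in> Q n"
  using assms
proof induction
  case (Q_step p hs c)
  have "cnj (pmon hs \<xi>) = pmon hs \<xi>" for \<xi> by (induction hs) auto
  with Q.Q_step[OF Q_step.IH Q_step(2,3), of "cnj c"] show ?case by simp
qed (simp add: Q_zero)

lemma pmon_measurable [measurable]:
  assumes "set hs \<subseteq> H" shows "pmon hs \<in> borel_measurable paths"
  using assms
proof (induction hs)
  case (Cons h hs)
  then have [measurable]: "pmon hs \<in> borel_measurable paths" "(\<lambda>\<xi>. \<xi> h) \<in> borel_measurable paths" by auto
  show ?case unfolding pmon_Cons[abs_def] by measurable
qed (simp add: pmon_Nil[abs_def])

lemma Q_measurable [measurable_dest]: assumes "p \<in> Q n" shows "p \<in> borel_measurable paths"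
  using assms
proof induction
  case (Q_step p hs c)
  then have [measurable]: "pmon hs \<in> borel_measurable paths" "p \<in> borel_measurable paths" using pmon_measurable by auto
  show ?case by measurable
qed simp

lemma pmon_moments:
  assumes "set hs \<subseteq> H" shows "integrable M (\<lambda>x. cmod (pmon hs (path x)) ^ k)"
  using assms
proof (induction hs arbitrary: k)
  case (Cons h hs)
  then have h: "h \<in> H" and hs: "set hs \<subseteq> H" by auto
  have [measurable]: "h \<in> borel_measurable M" "pmon hs \<in> borel_measurable paths" using h hs H_meas by auto
  have i: "integrable M (\<lambda>x. \<bar>h x\<bar> ^ (2 * k) + cmod (pmon hs (path x)) ^ (2 * k))"
    using moment_abs_integrable[OF h, of "2 * k"] Cons.IH[OF hs, of "2 * k"] by simp
  have le: "norm (cmod (pmon (h # hs) (path x)) ^ k) \<le> norm (\<bar>h x\<bar> ^ (2 * k) + cmod (pmon hs (path x)) ^ (2 * k))" for x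
  proof -
    have ab: "u * v \<le> u\<^sup>2 + v\<^sup>2" if "u \<ge> 0" "v \<ge> 0" for u v :: real
      using sum_squares_bound[of u v] mult_nonneg_nonneg[OF that] by linarith
    have "cmod (pmon (h # hs) (path x)) ^ k = \<bar>h x\<bar> ^ k * cmod (pmon hs (path x)) ^ k"
      using h by (simp add: norm_mult power_mult_distrib)
    also have "\<dots> \<le> (\<bar>h x\<bar> ^ k)\<^sup>2 + (cmod (pmon hs (path x)) ^ k)\<^sup>2" by (rule ab) auto
    finally show ?thesis by (simp add: power_mult[symmetric] mult.commute)
  qed
  have [measurable]: "pmon (h # hs) \<in> borel_measurable paths" using Cons.prems by (rule pmon_measurable)
  show ?case
    by (rule Bochner_Integration.integrable_bound[OF i]) (measurable, intro AE_I2 le)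
qed simp

lemma pmon_L2c: assumes "set hs \<subseteq> H" shows "(\<lambda>x. pmon hs (path x)) \<in> L2c M"
  unfolding L2c_def using pmon_moments[OF assms, of 2] pmon_measurable[OF assms] by auto

lemma Q_L2c: assumes "p \<in> Q n" shows "(\<lambda>x. p (path x)) \<in> L2c M"
  using assms by induction (auto intro!: L2c_zero L2c_add L2c_cmult pmon_L2c)

section \<open>Polynomials in two paths and their leading terms\<close>

inductive_set D :: "(nat \<times> nat) set \<Rightarrow> ((('a \<Rightarrow> real) \<Rightarrow> real) \<Rightarrow> (('a \<Rightarrow> real) \<Rightarrow> real) \<Rightarrow> complex) set" for S where
  D_zero: "(\<lambda>\<xi> \<eta>. 0) \<in> D S"
| D_step: "R \<in> D S \<Longrightarrow> set hs \<subseteq> H \<Longrightarrow> set ks \<subseteq> H \<Longrightarrow> (length hs, length ks) \<in> S \<Longrightarrow>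
     (\<lambda>\<xi> \<eta>. c * (pmon hs \<xi> * pmon ks \<eta>) + R \<xi> \<eta>) \<in> D S"

lemma D_mon: "set hs \<subseteq> H \<Longrightarrow> set ks \<subseteq> H \<Longrightarrow> (length hs, length ks) \<in> S \<Longrightarrow> (\<lambda>\<xi> \<eta>. c * (pmon hs \<xi> * pmon ks \<eta>)) \<in> D S"
  using D_step[OF D_zero, of hs ks S c] by simp

lemma D_add: assumes "R \<in> D S" "R' \<in> D S" shows "(\<lambda>\<xi> \<eta>. R \<xi> \<eta> + R' \<xi> \<eta>) \<in> D S"
  using assms(1)
proof induction
  case (D_step R hs ks c)
  from D.D_step[OF this(5,2,3,4), of c] show ?case by (simp add: add.assoc)
qed (use assms in simp)

lemma D_cmult: assumes "R \<in> D S" shows "(\<lambda>\<xi> \<eta>. c * R \<xi> \<eta>) \<in> D S"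
  using assms
proof induction
  case (D_step R hs ks d)
  from D.D_step[OF this(5,2,3,4), of "c * d"] show ?case by (simp add: algebra_simps)
qed (simp add: D_zero)

lemma D_mono: assumes "R \<in> D S" "S \<subseteq> S'" shows "R \<in> D S'"
  using assms by (induction) (auto intro: D_zero D_step)

lemma D_mult_left:
  assumes "R \<in> D S" "h \<in> H" "\<And>i j. (i, j) \<in> S \<Longrightarrow> (Suc i, j) \<in> S'"
  shows "(\<lambda>\<xi> \<eta>. of_real (\<xi> h) * R \<xi> \<eta>) \<in> D S'"
  using assms(1)
proof induction
  case (D_step R hs ks c)
  then have "(\<lambda>\<xi> \<eta>. c * (pmon (h # hs) \<xi> * pmon ks \<eta>) + of_real (\<xi> h) * R \<xi> \<eta>) \<in> D S'"
    using assms by (intro D.D_step) auto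
  then show ?case by (simp add: algebra_simps)
qed (simp add: D_zero)

lemma D_mult_right:
  assumes "R \<in> D S" "h \<in> H" "\<And>i j. (i, j) \<in> S \<Longrightarrow> (i, Suc j) \<in> S'"
  shows "(\<lambda>\<xi> \<eta>. of_real (\<eta> h) * R \<xi> \<eta>) \<in> D S'"
  using assms(1)
proof induction
  case (D_step R hs ks c)
  then have "(\<lambda>\<xi> \<eta>. c * (pmon hs \<xi> * pmon (h # ks) \<eta>) + of_real (\<eta> h) * R \<xi> \<eta>) \<in> D S'"
    using assms by (intro D.D_step) auto
  then show ?case by (simp add: algebra_simps)
qed (simp add: D_zero)

text \<open>On multiplying out, taking the first path from every factor gives the leading monomial,
  and every other term spends at least one factor on the second path. Each factor has its own
  coefficients because the two arguments of \<open>wk\<close> are mixed differently.\<close>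

lemma prod_mix_leading:
  assumes "fst ` set ts \<subseteq> H"
  shows "\<exists>R \<in> D {(i, j). i < length ts}. \<forall>\<xi> \<eta>.
    (\<Prod>(h, \<alpha>, \<beta>)\<leftarrow>ts. complex_of_real (\<alpha> * \<xi> h + \<beta> * \<eta> h))
      = (\<Prod>(h, \<alpha>, \<beta>)\<leftarrow>ts. complex_of_real \<alpha>) * pmon (map fst ts) \<xi> + R \<xi> \<eta>"
  using assms
proof (induction ts)
  case Nil
  show ?case by (intro bexI[OF _ D_zero]) simp
next
  case (Cons t ts)
  obtain h \<alpha> \<beta> where t: "t = (h, \<alpha>, \<beta>)" by (metis prod.exhaust)
  have h: "h \<in> H" and ts: "set (map fst ts) \<subseteq> H" using Cons.prems by (auto simp: t)
  obtain R where R: "R \<in> D {(i, j). i < length ts}" and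
    eq: "\<And>\<xi> \<eta>. (\<Prod>(h, \<alpha>, \<beta>)\<leftarrow>ts. complex_of_real (\<alpha> * \<xi> h + \<beta> * \<eta> h))
      = (\<Prod>(h, \<alpha>, \<beta>)\<leftarrow>ts. complex_of_real \<alpha>) * pmon (map fst ts) \<xi> + R \<xi> \<eta>"
    using Cons by (auto simp: t)
  define C where "C = (\<Prod>(h, \<alpha>, \<beta>)\<leftarrow>ts. complex_of_real \<alpha>)"
  let ?S = "{(i, j). i < length (t # ts)} :: (nat \<times> nat) set"
  have "(\<lambda>\<xi> \<eta>. (\<beta> * C) * (pmon (map fst ts) \<xi> * pmon [h] \<eta>)
     + (\<alpha> * (of_real (\<xi> h) * R \<xi> \<eta>) + \<beta> * (of_real (\<eta> h) * R \<xi> \<eta>))) \<in> D ?S"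
    using h ts by (intro D_step D_add D_cmult D_mult_left[OF R] D_mult_right[OF R]) auto
  moreover have "(\<Prod>(h, \<alpha>, \<beta>)\<leftarrow>t # ts. complex_of_real (\<alpha> * \<xi> h + \<beta> * \<eta> h))
      = (\<Prod>(h, \<alpha>, \<beta>)\<leftarrow>t # ts. complex_of_real \<alpha>) * pmon (map fst (t # ts)) \<xi> +
       ((\<beta> * C) * (pmon (map fst ts) \<xi> * pmon [h] \<eta>)
         + (\<alpha> * (of_real (\<xi> h) * R \<xi> \<eta>) + \<beta> * (of_real (\<eta> h) * R \<xi> \<eta>)))" for \<xi> \<eta>
    unfolding t list.map prod_list.Cons split_conv eq fst_conv pmon_Cons pmon_Nil C_def[symmetric]
    by (simp add: algebra_simps)
  ultimately show ?case by (intro bexI[of _ "\<lambda>\<xi> \<eta>. (\<beta> * C) * (pmon (map fst ts) \<xi> * pmon [h] \<eta>)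
     + (\<alpha> * (of_real (\<xi> h) * R \<xi> \<eta>) + \<beta> * (of_real (\<eta> h) * R \<xi> \<eta>))"]) auto
qed

text \<open>The remainder is controlled in the first path only, since the second one is integrated
  out afterwards.\<close>

definition lead_rel :: "real \<Rightarrow> real \<Rightarrow> nat \<Rightarrow> nat \<Rightarrow> ((('a \<Rightarrow> real) \<Rightarrow> real) \<Rightarrow> complex) \<Rightarrow> ((('a \<Rightarrow> real) \<Rightarrow> real) \<Rightarrow> complex) \<Rightarrow> bool" where
  "lead_rel a b i j p q \<longleftrightarrow> (\<exists>R \<in> D {(i', j'). i' < i + j}. \<forall>\<xi> \<eta>.
     p (mix a b \<xi> \<eta>) * q (mix b (-a) \<xi> \<eta>) = a ^ i * b ^ j * (p \<xi> * q \<xi>) + R \<xi> \<eta>)"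

lemma lead_rel_mon:
  assumes xs: "set xs \<subseteq> H" "length xs \<le> i" and zs: "set zs \<subseteq> H" "length zs \<le> j"
  shows "lead_rel a b i j (pmon xs) (pmon zs)"
proof -
  define ts where "ts = map (\<lambda>h. (h, a, b)) xs @ map (\<lambda>h. (h, b, - a)) zs"
  have "fst ` set ts \<subseteq> H" using xs zs by (auto simp: ts_def)
  from prod_mix_leading[OF this] obtain R where R: "R \<in> D {(i, j). i < length ts}" and
    eq: "\<And>\<xi> \<eta>. (\<Prod>(h, \<alpha>, \<beta>)\<leftarrow>ts. complex_of_real (\<alpha> * \<xi> h + \<beta> * \<eta> h))
      = (\<Prod>(h, \<alpha>, \<beta>)\<leftarrow>ts. complex_of_real \<alpha>) * pmon (map fst ts) \<xi> + R \<xi> \<eta>" by auto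
  have lead: "(\<Prod>(h, \<alpha>, \<beta>)\<leftarrow>map (\<lambda>h. (h, c, d)) ys. complex_of_real \<alpha>) = of_real c ^ length ys" for ys c d
    by (induction ys) auto
  have full: "(\<Prod>(h, \<alpha>, \<beta>)\<leftarrow>map (\<lambda>h. (h, c, d)) ys. complex_of_real (\<alpha> * \<xi> h + \<beta> * \<eta> h)) = pmon ys (mix c d \<xi> \<eta>)"
    if "set ys \<subseteq> H" for ys c d \<xi> \<eta>
    using that by (induction ys) auto
  have fsts: "map fst ts = xs @ zs"
    by (simp add: ts_def comp_def)
  have eq': "pmon xs (mix a b \<xi> \<eta>) * pmon zs (mix b (-a) \<xi> \<eta>)
     = of_real a ^ length xs * of_real b ^ length zs * pmon (xs @ zs) \<xi> + R \<xi> \<eta>" for \<xi> \<eta>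
    using eq[of \<xi> \<eta>] unfolding fsts
    unfolding ts_def map_append prod_list.append full[OF xs(1)] full[OF zs(1)] lead .
  have len: "length ts = length xs + length zs" by (simp add: ts_def)
  have R': "R \<in> D {(i', j'). i' < i + j}"
    using R by (rule D_mono) (use xs zs len in auto)
  show ?thesis
  proof (cases "length xs = i \<and> length zs = j")
    case True
    then show ?thesis unfolding lead_rel_def using R' eq' by (intro bexI[of _ R]) (auto simp: pmon_append)
  next
    \<comment> \<open>If a monomial is shorter than its nominal degree, its coefficient is not
      \<open>a ^ i * b ^ j\<close>; the discrepancy multiplies a monomial of length below
      \<open>i + j\<close> and joins the remainder.\<close>
    case False
    have 1: "(\<lambda>\<xi> \<eta>. (of_real a ^ length xs * of_real b ^ length zs - of_real a ^ i * of_real b ^ j) * (pmon (xs @ zs) \<xi> * pmon [] \<eta>) + R \<xi> \<eta>)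
       \<in> D {(i', j'). i' < i + j}"
      using xs zs False R' by (intro D_step) auto
    have 2: "pmon xs (mix a b \<xi> \<eta>) * pmon zs (mix b (-a) \<xi> \<eta>) = complex_of_real a ^ i * complex_of_real b ^ j * (pmon xs \<xi> * pmon zs \<xi>)
      + ((of_real a ^ length xs * of_real b ^ length zs - of_real a ^ i * of_real b ^ j) * (pmon (xs @ zs) \<xi> * pmon [] \<eta>) + R \<xi> \<eta>)" for \<xi> \<eta>
      unfolding eq' by (simp add: pmon_append algebra_simps)
    show ?thesis unfolding lead_rel_def by (rule bexI[OF _ 1]) (intro allI 2)
  qed
qed

lemma lead_rel_left:
  assumes "lead_rel a b i j p q" "lead_rel a b i j p' q"
  shows "lead_rel a b i j (\<lambda>\<xi>. c * p \<xi> + p' \<xi>) q"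
proof -
  obtain R R' where R: "R \<in> D {(i', j'). i' < i + j}" "R' \<in> D {(i', j'). i' < i + j}" and
   eq: "\<And>\<xi> \<eta>. p (mix a b \<xi> \<eta>) * q (mix b (-a) \<xi> \<eta>) = complex_of_real a ^ i * complex_of_real b ^ j * (p \<xi> * q \<xi>) + R \<xi> \<eta>"
    "\<And>\<xi> \<eta>. p' (mix a b \<xi> \<eta>) * q (mix b (-a) \<xi> \<eta>) = complex_of_real a ^ i * complex_of_real b ^ j * (p' \<xi> * q \<xi>) + R' \<xi> \<eta>"
    using assms unfolding lead_rel_def by auto
  show ?thesis unfolding lead_rel_def distrib_right mult.assoc[of c] eq
    by (rule bexI[OF _ D_add[OF D_cmult[OF R(1), of c] R(2)]]) (simp add: algebra_simps)
qed

lemma lead_rel_right: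
  assumes "lead_rel a b i j p q" "lead_rel a b i j p q'"
  shows "lead_rel a b i j p (\<lambda>\<xi>. c * q \<xi> + q' \<xi>)"
proof -
  obtain R R' where R: "R \<in> D {(i', j'). i' < i + j}" "R' \<in> D {(i', j'). i' < i + j}" and
   eq: "\<And>\<xi> \<eta>. p (mix a b \<xi> \<eta>) * q (mix b (-a) \<xi> \<eta>) = complex_of_real a ^ i * complex_of_real b ^ j * (p \<xi> * q \<xi>) + R \<xi> \<eta>"
    "\<And>\<xi> \<eta>. p (mix a b \<xi> \<eta>) * q' (mix b (-a) \<xi> \<eta>) = complex_of_real a ^ i * complex_of_real b ^ j * (p \<xi> * q' \<xi>) + R' \<xi> \<eta>"
    using assms unfolding lead_rel_def by auto
  show ?thesis unfolding lead_rel_def distrib_left mult.left_commute[of _ c] eq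
    by (rule bexI[OF _ D_add[OF D_cmult[OF R(1), of c] R(2)]]) (simp add: algebra_simps)
qed

lemma lead_rel_poly:
  assumes p: "p \<in> Q (Suc i)" and q: "q \<in> Q (Suc j)"
  shows "lead_rel a b i j p q"
proof -
  have 1: "lead_rel a b i j p (pmon ks)" if ks: "set ks \<subseteq> H" "length ks \<le> j" for ks
    using p
  proof induction
    case Q_zero
    then show ?case unfolding lead_rel_def by (intro bexI[OF _ D_zero]) simp
  next
    case (Q_step p hs c)
    then show ?case using ks by (intro lead_rel_left lead_rel_mon) auto
  qed
  show ?thesis
    using q
  proof induction
    case Q_zero
    then show ?case unfolding lead_rel_def by (intro bexI[OF _ D_zero]) simp
  next
    case (Q_step p hs c)
    then show ?case by (intro lead_rel_right 1) auto
  qed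
qed

lemma D_integral:
  assumes "R \<in> D S" "\<And>i j. (i, j) \<in> S \<Longrightarrow> i < n"
  shows "integrable M (\<lambda>y. R \<xi> (path y))" "(\<lambda>\<xi>. \<integral>y. R \<xi> (path y) \<partial>M) \<in> Q n"
proof -
  have "(\<forall>\<xi>. integrable M (\<lambda>y. R \<xi> (path y))) \<and> (\<lambda>\<xi>. \<integral>y. R \<xi> (path y) \<partial>M) \<in> Q n"
    using assms(1)
  proof induction
    case (D_step R hs ks c)
    have i: "integrable M (\<lambda>y. pmon ks (path y))" using D_step pmon_L2c L2c_integrable by auto
    have "(\<lambda>\<xi>. (c * (\<integral>y. pmon ks (path y) \<partial>M)) * pmon hs \<xi> + (\<integral>y. R \<xi> (path y) \<partial>M)) \<in> Q n"
      using D_step assms(2) by (intro Q_step) auto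
    then show ?case using D_step i by (simp add: algebra_simps)
  qed (simp add: Q_zero)
  then show "integrable M (\<lambda>y. R \<xi> (path y))" "(\<lambda>\<xi>. \<integral>y. R \<xi> (path y) \<partial>M) \<in> Q n" by auto
qed

text \<open>Integrating out the second path leaves a polynomial remainder of degree below
  \<open>i + j\<close>. The integrability claim holds at every path, not just almost everywhere, so
  that \<open>wk\<close> is additive on polynomials without exceptional sets.\<close>

lemma wk_poly:
  fixes p q :: "(('a \<Rightarrow> real) \<Rightarrow> real) \<Rightarrow> complex"
  assumes p: "p \<in> Q (Suc i)" and q: "q \<in> Q (Suc j)"
  shows "(\<lambda>\<xi>. wk a b p q \<xi> - complex_of_real a ^ i * complex_of_real b ^ j * (p \<xi> * q \<xi>)) \<in> Q (i + j)"
    "wk a b p q \<in> Q (Suc (i + j))"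
    "integrable M (\<lambda>y. p (mix a b \<xi> (path y)) * q (mix b (-a) \<xi> (path y)))"
proof -
  obtain R where R: "R \<in> D {(i', j'). i' < i + j}" and
   eq: "\<And>\<xi> \<eta>. p (mix a b \<xi> \<eta>) * q (mix b (-a) \<xi> \<eta>) = complex_of_real a ^ i * complex_of_real b ^ j * (p \<xi> * q \<xi>) + R \<xi> \<eta>"
    using lead_rel_poly[OF p q, of a b] unfolding lead_rel_def by auto
  have RD: "integrable M (\<lambda>y. R \<xi> (path y))" "(\<lambda>\<xi>. \<integral>y. R \<xi> (path y) \<partial>M) \<in> Q (i + j)" for \<xi>
    by (rule D_integral[OF R]; simp)+
  have "wk a b p q \<xi> - complex_of_real a ^ i * complex_of_real b ^ j * (p \<xi> * q \<xi>) = (\<integral>y. R \<xi> (path y) \<partial>M)" for \<xi>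
    unfolding wk_def eq using RD(1) by (simp add: prob_space)
  then show 1: "(\<lambda>\<xi>. wk a b p q \<xi> - complex_of_real a ^ i * complex_of_real b ^ j * (p \<xi> * q \<xi>)) \<in> Q (i + j)"
    using RD(2) by simp
  show "wk a b p q \<in> Q (Suc (i + j))"
    using Q_add[OF Q_mono[OF 1, of "Suc (i + j)"] Q_cmult[OF Q_mult[OF p q], of "complex_of_real a ^ i * complex_of_real b ^ j"]] by simp
  show "integrable M (\<lambda>y. p (mix a b \<xi> (path y)) * q (mix b (-a) \<xi> (path y)))"
    unfolding eq using RD(1) by simp
qed

text \<open>Each factor sends its degree to exactly one of the two paths, so the total degree is
  preserved. For a test function the degrees in both paths matter, in contrast to
  \<open>prod_mix_leading\<close>.\<close>

lemma D_mix_mon: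
  assumes "set hs \<subseteq> H" shows "(\<lambda>\<xi> \<eta>. pmon hs (mix a b \<xi> \<eta>)) \<in> D {(i, j). i + j = length hs}"
  using assms
proof (induction hs)
  case Nil
  show ?case using D_mon[of "[]" "[]" _ 1] by simp
next
  case (Cons h hs)
  then have R: "(\<lambda>\<xi> \<eta>. pmon hs (mix a b \<xi> \<eta>)) \<in> D {(i, j). i + j = length hs}" and h: "h \<in> H" by auto
  have "(\<lambda>\<xi> \<eta>. a * (of_real (\<xi> h) * pmon hs (mix a b \<xi> \<eta>)) + b * (of_real (\<eta> h) * pmon hs (mix a b \<xi> \<eta>)))
      \<in> D {(i, j). i + j = length (h # hs)}"
    using h by (intro D_add D_cmult D_mult_left[OF R] D_mult_right[OF R]) auto
  then show ?case using h by (simp add: algebra_simps)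
qed

lemma D_mix_poly:
  assumes "p \<in> Q n" shows "(\<lambda>\<xi> \<eta>. p (mix a b \<xi> \<eta>)) \<in> D {(i, j). i + j < n}"
  using assms
proof induction
  case (Q_step p hs c)
  then show ?case
    by (intro D_add D_cmult D_mono[OF D_mix_mon]) auto
qed (simp add: D_zero)

lemma D_pair_integrable:
  assumes "R \<in> D S" "F \<in> L2c M" "G \<in> L2c M"
  shows "integrable (M \<Otimes>\<^sub>M M) (\<lambda>(x, y). F x * G y * R (path x) (path y))"
  using assms(1)
proof induction
  case (D_step R hs ks c)
  have "integrable (M \<Otimes>\<^sub>M M) (\<lambda>(x, y). (F x * pmon hs (path x)) * (G y * pmon ks (path y)))"
    using D_step assms by (intro integral_pair_mult integrable_mult_L2c pmon_L2c)
  from Bochner_Integration.integrable_add[OF integrable_mult_right[OF this, of c] D_step.IH] show ?case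
    by (simp add: case_prod_unfold algebra_simps)
qed simp

lemma integral_mult_tendsto:
  assumes "\<And>n. F n \<in> L2c M" "f \<in> L2c M" "(\<lambda>n. norm2 M (\<lambda>x. F n x - f x)) \<longlonglongrightarrow> 0" "g \<in> L2c M"
  shows "(\<lambda>n. \<integral>x. F n x * g x \<partial>M) \<longlonglongrightarrow> (\<integral>x. f x * g x \<partial>M)"
  using inner2_tendsto[OF assms(1,2) L2c_cnj[OF assms(4)] assms(3)] by (simp add: inner2_def)

text \<open>Each monomial of \<open>R\<close> makes the double integral factor into two single ones,
  whose limits are controlled by \<open>null\<close>. The sequences are there because an element of
  a chaos is reached only as an L2 limit of polynomials, where \<open>wk\<close> is
  understood.\<close>

lemma D_pair_tendsto_0:
  assumes R: "R \<in> D S"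
    and F: "\<And>n. F n \<in> L2c M" "f \<in> L2c M" "(\<lambda>n. norm2 M (\<lambda>x. F n x - f x)) \<longlonglongrightarrow> 0"
    and G: "\<And>n. G n \<in> L2c M" "g \<in> L2c M" "(\<lambda>n. norm2 M (\<lambda>x. G n x - g x)) \<longlonglongrightarrow> 0"
    and null: "\<And>hs ks. set hs \<subseteq> H \<Longrightarrow> set ks \<subseteq> H \<Longrightarrow> (length hs, length ks) \<in> S \<Longrightarrow>
       (\<integral>x. f x * pmon hs (path x) \<partial>M) * (\<integral>x. g x * pmon ks (path x) \<partial>M) = 0"
  shows "(\<lambda>n. \<integral>(x, y). F n x * G n y * R (path x) (path y) \<partial>(M \<Otimes>\<^sub>M M)) \<longlonglongrightarrow> 0"
  using R
proof induction
  case (D_step R hs ks c)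
  have L: "(\<lambda>x. pmon hs (path x)) \<in> L2c M" "(\<lambda>x. pmon ks (path x)) \<in> L2c M" using D_step pmon_L2c by auto
  have eq: "(\<integral>(x, y). F n x * G n y * (c * (pmon hs (path x) * pmon ks (path y)) + R (path x) (path y)) \<partial>(M \<Otimes>\<^sub>M M))
     = c * ((\<integral>x. F n x * pmon hs (path x) \<partial>M) * (\<integral>x. G n x * pmon ks (path x) \<partial>M))
       + (\<integral>(x, y). F n x * G n y * R (path x) (path y) \<partial>(M \<Otimes>\<^sub>M M))" for n
  proof -
    note i = integrable_mult_L2c[OF F(1)[of n] L(1)] integrable_mult_L2c[OF G(1)[of n] L(2)]
    have "(\<integral>(x, y). F n x * G n y * (c * (pmon hs (path x) * pmon ks (path y)) + R (path x) (path y)) \<partial>(M \<Otimes>\<^sub>M M))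
       = (\<integral>z. c * (case z of (x, y) \<Rightarrow> (F n x * pmon hs (path x)) * (G n y * pmon ks (path y)))
           + (case z of (x, y) \<Rightarrow> F n x * G n y * R (path x) (path y)) \<partial>(M \<Otimes>\<^sub>M M))"
      by (intro Bochner_Integration.integral_cong) (auto simp: algebra_simps)
    then show ?thesis
      using integral_pair_mult[OF i] D_pair_integrable[OF D_step(1) F(1)[of n] G(1)[of n]] by simp
  qed
  have "(\<lambda>n. c * ((\<integral>x. F n x * pmon hs (path x) \<partial>M) * (\<integral>x. G n x * pmon ks (path x) \<partial>M))
       + (\<integral>(x, y). F n x * G n y * R (path x) (path y) \<partial>(M \<Otimes>\<^sub>M M)))
     \<longlonglongrightarrow> c * ((\<integral>x. f x * pmon hs (path x) \<partial>M) * (\<integral>x. g x * pmon ks (path x) \<partial>M)) + 0"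
    by (intro tendsto_intros integral_mult_tendsto F G L D_step.IH)
  then show ?case unfolding eq using null[OF D_step(2-4)] by simp
qed simp

section \<open>The Ornstein-Uhlenbeck operator on polynomials and norms of products\<close>

lemma ou_poly:
  fixes p :: "(('a \<Rightarrow> real) \<Rightarrow> real) \<Rightarrow> complex"
  assumes "p \<in> Q (Suc i)"
  shows "(\<lambda>\<xi>. ou p \<xi> - complex_of_real (r2 ^ i) * p \<xi>) \<in> Q i" "ou p \<in> Q (Suc i)"
    "integrable M (\<lambda>y. p (mix r2 r2 \<xi> (path y)))"
  using wk_poly[OF assms Q_const[of "Suc 0" 1], of r2 r2] by simp_all

lemma ou_lin:
  assumes "p \<in> Q (Suc i)" "q \<in> Q (Suc j)"
  shows "ou (\<lambda>\<xi>. c * p \<xi> + q \<xi>) \<xi> = c * ou p \<xi> + ou q \<xi>"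
  unfolding wk_def using ou_poly(3)[OF assms(1)] ou_poly(3)[OF assms(2)] by simp

abbreviation nrm :: "((('a \<Rightarrow> real) \<Rightarrow> real) \<Rightarrow> complex) \<Rightarrow> real" where
  "nrm p \<equiv> norm2 M (\<lambda>x. p (path x))"

lemma ou_contract: "p \<in> Q n \<Longrightarrow> nrm (ou p) \<le> nrm p"
  using wk_L2c(2)[OF r2_sq Q_measurable, of p n "\<lambda>_. 1"] Q_L2c[of p n] L2c_const[of 1] by (simp add: norm2_const)

text \<open>By induction on the degree, since \<open>p - 2\<^sup>i\<^sup>/\<^sup>2 ou p\<close> has smaller degree than \<open>p\<close>.\<close>

lemma ou_inverse:
  "\<exists>C\<ge>0. \<forall>p\<in>Q n. \<exists>p'\<in>Q n. (\<forall>\<xi>. ou p' \<xi> = p \<xi>) \<and> nrm p' \<le> C * nrm p"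
proof (induction n)
  case 0
  show ?case by (intro exI[of _ 0]) (auto dest!: Q_0 simp: wk_def intro!: bexI[OF _ Q_zero])
next
  case (Suc i)
  then obtain C where C: "C \<ge> 0" "\<And>p. p \<in> Q i \<Longrightarrow> \<exists>p'\<in>Q i. (\<forall>\<xi>. ou p' \<xi> = p \<xi>) \<and> nrm p' \<le> C * nrm p" by blast
  define t where "t = 1 / r2 ^ i"
  have t: "t > 0" by (simp add: t_def)
  have "\<exists>p'\<in>Q (Suc i). (\<forall>\<xi>. ou p' \<xi> = p \<xi>) \<and> nrm p' \<le> (t + C * (1 + t)) * nrm p" if p: "p \<in> Q (Suc i)" for p
  proof -
    define s where "s = (\<lambda>\<xi>. p \<xi> - complex_of_real t * ou p \<xi>)"
    have "(\<lambda>\<xi>. - complex_of_real t * (ou p \<xi> - complex_of_real (r2 ^ i) * p \<xi>)) = s"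
      by (auto simp: s_def t_def field_simps)
    then have s: "s \<in> Q i" using Q_cmult[OF ou_poly(1)[OF p], of "- complex_of_real t"] by simp
    \<comment> \<open>The defect \<open>s\<close> has lower degree, so the induction hypothesis
      supplies a preimage \<open>s'\<close>; then \<open>t p + s'\<close> is a preimage of
      \<open>p\<close>.\<close>
    obtain s' where s': "s' \<in> Q i" "\<And>\<xi>. ou s' \<xi> = s \<xi>" "nrm s' \<le> C * nrm s" using C(2)[OF s] by auto
    have s'': "s' \<in> Q (Suc i)" using s'(1) by (rule Q_mono) simp
    note pL = Q_L2c[OF p] and oL = Q_L2c[OF ou_poly(2)[OF p]] and sL = Q_L2c[OF s'(1)]
    have "nrm s \<le> nrm p + t * nrm (ou p)"
      unfolding s_def using norm2_triangle_minus[OF pL L2c_cmult[OF oL, of "of_real t"]] t by (simp add: norm2_cmult)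
    also have "\<dots> \<le> nrm p + t * nrm p"
      using ou_contract[OF p] t by simp
    finally have ns: "nrm s \<le> (1 + t) * nrm p" by (simp add: algebra_simps)
    show ?thesis
    proof (intro bexI conjI allI)
      show "(\<lambda>\<xi>. complex_of_real t * p \<xi> + s' \<xi>) \<in> Q (Suc i)" by (intro Q_add Q_cmult p s'')
      show "ou (\<lambda>\<xi>. complex_of_real t * p \<xi> + s' \<xi>) \<xi> = p \<xi>" for \<xi>
        unfolding ou_lin[OF p s''] s'(2) by (simp add: s_def)
      have "nrm (\<lambda>\<xi>. complex_of_real t * p \<xi> + s' \<xi>) \<le> t * nrm p + nrm s'"
        using norm2_triangle[OF L2c_cmult[OF pL, of "of_real t"] sL] t by (simp add: norm2_cmult)
      also have "\<dots> \<le> t * nrm p + C * ((1 + t) * nrm p)"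
        using s'(3) mult_left_mono[OF ns C(1)] by simp
      finally show "nrm (\<lambda>\<xi>. complex_of_real t * p \<xi> + s' \<xi>) \<le> (t + C * (1 + t)) * nrm p"
        by (simp add: algebra_simps)
    qed
  qed
  then show ?case using t C(1) by (intro exI[of _ "t + C * (1 + t)"]) auto
qed

text \<open>
  This replaces hypercontractivity: \<open>ou\<close> is boundedly invertible on polynomials of bounded degree, and
  \<open>ou_triple_le\<close> is applied to \<open>p\<close>, \<open>q\<close> and the conjugate of \<open>p q\<close>.
\<close>

lemma poly_product_bound:
  "\<exists>C\<ge>0. \<forall>p\<in>Q (Suc i). \<forall>q\<in>Q (Suc j). nrm (\<lambda>\<xi>. p \<xi> * q \<xi>) \<le> C * nrm p * nrm q"
proof -
  obtain A where A: "A \<ge> 0" "\<And>p. p \<in> Q (Suc i) \<Longrightarrow> \<exists>p'\<in>Q (Suc i). (\<forall>\<xi>. ou p' \<xi> = p \<xi>) \<and> nrm p' \<le> A * nrm p"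
    using ou_inverse[of "Suc i"] by blast
  obtain B where B: "B \<ge> 0" "\<And>p. p \<in> Q (Suc j) \<Longrightarrow> \<exists>p'\<in>Q (Suc j). (\<forall>\<xi>. ou p' \<xi> = p \<xi>) \<and> nrm p' \<le> B * nrm p"
    using ou_inverse[of "Suc j"] by blast
  obtain C where C: "C \<ge> 0" "\<And>p. p \<in> Q (Suc (i + j)) \<Longrightarrow> \<exists>p'\<in>Q (Suc (i + j)). (\<forall>\<xi>. ou p' \<xi> = p \<xi>) \<and> nrm p' \<le> C * nrm p"
    using ou_inverse[of "Suc (i + j)"] by blast
  have "nrm (\<lambda>\<xi>. p \<xi> * q \<xi>) \<le> (A * B * C) * nrm p * nrm q" if p: "p \<in> Q (Suc i)" and q: "q \<in> Q (Suc j)" for p q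
  proof -
    define k where "k = (\<lambda>\<xi>. cnj (p \<xi> * q \<xi>))"
    have k: "k \<in> Q (Suc (i + j))" unfolding k_def by (intro Q_cnj Q_mult p q)
    obtain p' where p': "p' \<in> Q (Suc i)" "\<And>\<xi>. ou p' \<xi> = p \<xi>" "nrm p' \<le> A * nrm p" using A(2)[OF p] by auto
    obtain q' where q': "q' \<in> Q (Suc j)" "\<And>\<xi>. ou q' \<xi> = q \<xi>" "nrm q' \<le> B * nrm q" using B(2)[OF q] by auto
    obtain k' where k': "k' \<in> Q (Suc (i + j))" "\<And>\<xi>. ou k' \<xi> = k \<xi>" "nrm k' \<le> C * nrm k" using C(2)[OF k] by auto
    define N where "N = nrm (\<lambda>\<xi>. p \<xi> * q \<xi>)"
    have N0: "N \<ge> 0" by (simp add: N_def)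
    have nk: "nrm k = N" by (simp add: N_def k_def norm2_def norm_mult)
    have "ennreal ((N\<^sup>2)\<^sup>2) = (\<integral>\<^sup>+x. ennreal ((cmod (p (path x) * q (path x)))\<^sup>2) \<partial>M)\<^sup>2"
      using L2cD(2)[OF Q_L2c[OF Q_mult[OF p q]]]
      by (simp add: N_def norm2_sq nn_integral_eq_integral ennreal_power)
    also have "(\<integral>\<^sup>+x. ennreal ((cmod (p (path x) * q (path x)))\<^sup>2) \<partial>M)
       = (\<integral>\<^sup>+w. ennreal (cmod (ou p' (path w) * ou q' (path w) * ou k' (path w))) \<partial>M)"
      by (simp add: p' q' k' k_def norm_mult power2_eq_square)
    also have "\<dots>\<^sup>2 \<le> (\<integral>\<^sup>+x. ennreal ((cmod (p' (path x)))\<^sup>2) \<partial>M) * (\<integral>\<^sup>+x. ennreal ((cmod (q' (path x)))\<^sup>2) \<partial>M)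
        * (\<integral>\<^sup>+x. ennreal ((cmod (k' (path x)))\<^sup>2) \<partial>M)"
      by (intro ou_triple_le Q_measurable[OF p'(1)] Q_measurable[OF q'(1)] Q_measurable[OF k'(1)])
    also have "\<dots> = ennreal ((nrm p' * nrm q' * nrm k')\<^sup>2)"
      using L2cD(2)[OF Q_L2c[OF p'(1)]] L2cD(2)[OF Q_L2c[OF q'(1)]] L2cD(2)[OF Q_L2c[OF k'(1)]]
      by (simp add: norm2_sq nn_integral_eq_integral power_mult_distrib ennreal_mult)
    finally have "(N\<^sup>2)\<^sup>2 \<le> (nrm p' * nrm q' * nrm k')\<^sup>2" by (subst (asm) ennreal_le_iff) auto
    then have "N\<^sup>2 \<le> nrm p' * nrm q' * nrm k'" by (rule power2_le_imp_le) simp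
    also have "\<dots> \<le> (A * nrm p) * (B * nrm q) * (C * N)"
      using p'(3) q'(3) k'(3) A(1) B(1) C(1) N0 unfolding nk by (intro mult_mono mult_nonneg_nonneg) auto
    \<comment> \<open>\<open>N\<close> occurs on both sides because \<open>k\<close> has the same
      norm as \<open>p q\<close>; unless it is zero, it cancels.\<close>
    finally have "N * N \<le> ((A * B * C) * nrm p * nrm q) * N" by (simp add: power2_eq_square algebra_simps)
    then show ?thesis
      using N0 A(1) B(1) C(1) unfolding N_def[symmetric] by (cases "N = 0") auto
  qed
  then show ?thesis using A(1) B(1) C(1) by (intro exI[of _ "A * B * C"]) auto
qed

end

section \<open>Chaos spaces\<close>

context gaussian_space
begin

text \<open>Degree at most \<open>n\<close> becomes length below \<open>Suc n\<close>. Written on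
  path space, polynomials can be evaluated at mixed paths.\<close>

lemma Fpoly_eq: "Fpoly H n = (\<lambda>p x. p (path x)) ` Q (Suc n)"
proof (intro equalityI subsetI)
  fix f assume "f \<in> Fpoly H n"
  then obtain m c mon where f: "f = (\<lambda>x. \<Sum>i<(m::nat). c i * mon i x)" and mon: "\<forall>i<m. mon i \<in> monomials H n"
    unfolding Fpoly_def by blast
  have "\<exists>p\<in>Q (Suc n). mon i = (\<lambda>x. p (path x))" if i: "i < m" for i
  proof -
    from mon i obtain j Xs where j: "mon i = (\<lambda>x. \<Prod>i<j. complex_of_real (Xs i x))" "j \<le> n" "\<forall>i<j. Xs i \<in> H"
      unfolding monomials_def by blast
    have sub: "set (map Xs [0..<j]) \<subseteq> H" using j(3) by auto
    have "pmon (map Xs [0..<k]) (path x) = (\<Prod>i<k. complex_of_real (Xs i x))" if "k \<le> j" for x k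
      using that j(3) by (induction k) (auto simp: pmon_append mult.commute)
    from this[of j] have "mon i = (\<lambda>x. pmon (map Xs [0..<j]) (path x))" unfolding j(1) by auto
    moreover have "pmon (map Xs [0..<j]) \<in> Q (Suc n)"
      using Q_mon[OF sub, of "Suc n" 1] j(2) by simp
    ultimately show ?thesis by auto
  qed
  then obtain p where p: "\<And>i. i < m \<Longrightarrow> p i \<in> Q (Suc n)" "\<And>i. i < m \<Longrightarrow> mon i = (\<lambda>x. p i (path x))" by metis
  have "(\<lambda>\<xi>. \<Sum>i<k. c i * p i \<xi>) \<in> Q (Suc n)" if "k \<le> m" for k
    using that by (induction k) (auto intro!: Q_zero Q_add Q_cmult p(1))
  from this[of m] have "(\<lambda>\<xi>. \<Sum>i<m. c i * p i \<xi>) \<in> Q (Suc n)" by simp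
  moreover have "f = (\<lambda>x. \<Sum>i<m. c i * p i (path x))" unfolding f using p(2) by auto
  ultimately show "f \<in> (\<lambda>p x. p (path x)) ` Q (Suc n)" by (intro image_eqI) auto
next
  fix f assume "f \<in> (\<lambda>p x. p (path x)) ` Q (Suc n)"
  then obtain p where p: "p \<in> Q (Suc n)" and f: "f = (\<lambda>x. p (path x))" by auto
  from p have "(\<lambda>x. p (path x)) \<in> Fpoly H n"
  proof induction
    case Q_zero
    show ?case unfolding Fpoly_def by (auto intro!: exI[of _ 0])
  next
    case (Q_step p hs c)
    then obtain m d mon where f: "(\<lambda>x. p (path x)) = (\<lambda>x. \<Sum>i<(m::nat). d i * mon i x)" and mon: "\<forall>i<m. mon i \<in> monomials H n"
      unfolding Fpoly_def by blast
    have "pmon hs (path x) = (\<Prod>i<length hs. complex_of_real ((hs ! i) x))" for x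
      using Q_step(2)
    proof (induction hs)
      case (Cons h hs)
      then show ?case by (simp add: prod.lessThan_Suc_shift del: prod.lessThan_Suc)
    qed simp
    then have hm: "(\<lambda>x. pmon hs (path x)) \<in> monomials H n"
      unfolding monomials_def using Q_step(2,3)
      by (auto intro!: exI[of _ "length hs"] exI[of _ "\<lambda>i. hs ! i"])
    have "(\<lambda>x. c * pmon hs (path x) + p (path x))
      = (\<lambda>x. \<Sum>i<Suc m. (if i < m then d i else c) * (if i < m then mon i else (\<lambda>x. pmon hs (path x))) x)"
      using f by (auto simp: fun_eq_iff)
    then show ?case unfolding Fpoly_def using mon hm
      by (auto intro!: exI[of _ "Suc m"] exI[of _ "\<lambda>i. if i < m then d i else c"]
          exI[of _ "\<lambda>i. if i < m then mon i else (\<lambda>x. pmon hs (path x))"])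
  qed
  then show "f \<in> Fpoly H n" unfolding f .
qed

definition Qbar :: "nat \<Rightarrow> ('a \<Rightarrow> complex) set" where
  "Qbar n = {f \<in> L2c M. \<forall>e>0. \<exists>p\<in>Q n. norm2 M (\<lambda>x. f x - p (path x)) < e}"

lemma Fbar_eq: "Fbar M H n = Qbar (Suc n)"
proof -
  have "(\<forall>e>0. \<exists>g\<in>Fpoly H n. dist2 M f g < e) \<longleftrightarrow> (\<forall>e>0. \<exists>p\<in>Q (Suc n). norm2 M (\<lambda>x. f x - p (path x)) < e)" for f
  proof -
    have 1: "(\<exists>g\<in>Fpoly H n. dist2 M f g < e) \<longleftrightarrow> (\<exists>p\<in>Q (Suc n). (norm2 M (\<lambda>x. f x - p (path x)))\<^sup>2 < e)" for e
      unfolding Fpoly_eq dist2_norm2 by auto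
    show ?thesis unfolding 1
    proof (intro iffI allI impI)
      fix e :: real assume *: "\<forall>e>0. \<exists>p\<in>Q (Suc n). (norm2 M (\<lambda>x. f x - p (path x)))\<^sup>2 < e" "e > 0"
      then have "e\<^sup>2 > 0" by simp
      with * obtain p where "p \<in> Q (Suc n)" "(norm2 M (\<lambda>x. f x - p (path x)))\<^sup>2 < e\<^sup>2" by blast
      then show "\<exists>p\<in>Q (Suc n). norm2 M (\<lambda>x. f x - p (path x)) < e"
        using \<open>e > 0\<close> by (intro bexI[of _ p]) (auto intro: power2_less_imp_less)
    next
      fix e :: real assume *: "\<forall>e>0. \<exists>p\<in>Q (Suc n). norm2 M (\<lambda>x. f x - p (path x)) < e" "e > 0"
      then have "sqrt e > 0" by simp
      with * obtain p where p: "p \<in> Q (Suc n)" "norm2 M (\<lambda>x. f x - p (path x)) < sqrt e" by blast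
      have "(norm2 M (\<lambda>x. f x - p (path x)))\<^sup>2 < (sqrt e)\<^sup>2" using p(2) by (intro power_strict_mono) auto
      then show "\<exists>p\<in>Q (Suc n). (norm2 M (\<lambda>x. f x - p (path x)))\<^sup>2 < e"
        using \<open>e > 0\<close> p(1) by (intro bexI[of _ p]) auto
    qed
  qed
  then show ?thesis unfolding Fbar_def Qbar_def by auto
qed

lemma Qbar_L2c: "f \<in> Qbar n \<Longrightarrow> f \<in> L2c M"
  by (simp add: Qbar_def)

lemma Q_Qbar: assumes "p \<in> Q n" shows "(\<lambda>x. p (path x)) \<in> Qbar n"
  unfolding Qbar_def using Q_L2c[OF assms] by (auto intro!: bexI[OF _ assms])

lemma Qbar_seq:
  assumes "f \<in> Qbar n"
  obtains p where "\<And>m. p m \<in> Q n" "(\<lambda>m. norm2 M (\<lambda>x. p m (path x) - f x)) \<longlonglongrightarrow> 0"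
proof -
  have "\<exists>p\<in>Q n. norm2 M (\<lambda>x. f x - p (path x)) < 1 / Suc m" for m
    using assms unfolding Qbar_def by auto
  then obtain p where p: "\<And>m. p m \<in> Q n" "\<And>m. norm2 M (\<lambda>x. f x - p m (path x)) < 1 / Suc m" by metis
  have "(\<lambda>m. norm2 M (\<lambda>x. p m (path x) - f x)) \<longlonglongrightarrow> 0"
  proof (rule Lim_null_comparison)
    show "\<forall>\<^sub>F m in sequentially. norm (norm2 M (\<lambda>x. p m (path x) - f x)) \<le> inverse (real (Suc m))"
      using p(2) by (auto simp: norm2_minus_commute[of M _ f] inverse_eq_divide intro!: always_eventually less_imp_le)
  qed (rule LIMSEQ_inverse_real_of_nat)
  with p(1) show ?thesis by (rule that)
qed

lemma Qbar_limit:
  assumes "\<And>m. f m \<in> Qbar n" "g \<in> L2c M" "(\<lambda>m. norm2 M (\<lambda>x. f m x - g x)) \<longlonglongrightarrow> 0"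
  shows "g \<in> Qbar n"
  unfolding Qbar_def mem_Collect_eq
proof (intro conjI allI impI)
  fix e :: real assume e: "e > 0"
  obtain m where m: "norm2 M (\<lambda>x. f m x - g x) < e / 2"
    using order_tendstoD(2)[OF assms(3), of "e / 2"] e by (auto simp: eventually_sequentially)
  obtain p where p: "p \<in> Q n" "norm2 M (\<lambda>x. f m x - p (path x)) < e / 2"
    using assms(1)[of m] e unfolding Qbar_def by (auto dest: spec[of _ "e / 2"])
  have "norm2 M (\<lambda>x. g x - p (path x)) < e"
    using norm2_triangle_diff[OF assms(2) Qbar_L2c[OF assms(1)] Q_L2c[OF p(1)], of m] m p(2) norm2_minus_commute[of M g "f m"]
    by simp
  with p(1) show "\<exists>p\<in>Q n. norm2 M (\<lambda>x. g x - p (path x)) < e" by auto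
qed (use assms in auto)

lemma Qbar_mono: "n \<le> m \<Longrightarrow> f \<in> Qbar n \<Longrightarrow> f \<in> Qbar m"
  unfolding Qbar_def using Q_mono by blast

lemma closed_subspace_Qbar: "closed_subspace (Qbar n)"
  unfolding closed_subspace_def
proof (intro conjI allI impI ballI)
  show "Qbar n \<subseteq> L2c M" using Qbar_L2c by auto
  show "(\<lambda>x. 0) \<in> Qbar n" using Q_Qbar[OF Q_zero] by simp
  fix f assume f: "f \<in> Qbar n"
  obtain p where p: "\<And>m. p m \<in> Q n" "(\<lambda>m. norm2 M (\<lambda>x. p m (path x) - f x)) \<longlonglongrightarrow> 0" by (rule Qbar_seq[OF f]) (rule that)
  show "(\<lambda>x. c * f x) \<in> Qbar n" for c
  proof (rule Qbar_limit[OF Q_Qbar[OF Q_cmult[OF p(1)]] L2c_cmult[OF Qbar_L2c[OF f]]])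
    have "(\<lambda>m. norm2 M (\<lambda>x. c * (p m (path x) - f x))) \<longlonglongrightarrow> 0"
      unfolding norm2_cmult using tendsto_mult_right_zero[OF p(2)] .
    then show "(\<lambda>m. norm2 M (\<lambda>x. c * p m (path x) - c * f x)) \<longlonglongrightarrow> 0" by (simp add: right_diff_distrib)
  qed
  fix g assume g: "g \<in> Qbar n"
  obtain q where q: "\<And>m. q m \<in> Q n" "(\<lambda>m. norm2 M (\<lambda>x. q m (path x) - g x)) \<longlonglongrightarrow> 0" by (rule Qbar_seq[OF g]) (rule that)
  show "(\<lambda>x. f x + g x) \<in> Qbar n"
  proof (rule Qbar_limit[OF Q_Qbar[OF Q_add[OF p(1) q(1)]] L2c_add[OF Qbar_L2c[OF f] Qbar_L2c[OF g]]])
    show "(\<lambda>m. norm2 M (\<lambda>x. p m (path x) + q m (path x) - (f x + g x))) \<longlonglongrightarrow> 0"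
      using norm2_diff_tendsto[OF Q_L2c[OF p(1)] Q_L2c[OF q(1)] Qbar_L2c[OF f] Qbar_L2c[OF g] p(2) q(2), of "-1"] by simp
  qed
next
  fix f g assume "\<forall>m. f m \<in> Qbar n" "g \<in> L2c M" "(\<lambda>m. norm2 M (\<lambda>x. f m x - g x)) \<longlonglongrightarrow> 0"
  then show "g \<in> Qbar n" using Qbar_limit[of f n g] by auto
qed

lemma orth_Q_Qbar:
  assumes "f \<in> L2c M" "\<And>p. p \<in> Q n \<Longrightarrow> inner2 M f (\<lambda>x. p (path x)) = 0" "g \<in> Qbar n"
  shows "inner2 M f g = 0"
proof -
  obtain q where q: "\<And>m. q m \<in> Q n" "(\<lambda>m. norm2 M (\<lambda>x. q m (path x) - g x)) \<longlonglongrightarrow> 0" by (rule Qbar_seq[OF assms(3)]) (rule that)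
  have "(\<lambda>m. inner2 M (\<lambda>x. q m (path x)) f) \<longlonglongrightarrow> inner2 M g f"
    by (rule inner2_tendsto[OF Q_L2c[OF q(1)] Qbar_L2c[OF assms(3)] assms(1) q(2)])
  moreover have "inner2 M (\<lambda>x. q m (path x)) f = 0" for m
    using assms(2)[OF q(1)] inner2_commute[of M _ f] by simp
  ultimately have "inner2 M g f = 0" by (simp add: LIMSEQ_const_iff)
  then show ?thesis using inner2_commute[of M f g] by simp
qed

text \<open>\<open>Q 0\<close> contains only the zero function, so \<open>Qbar 0\<close> consists of
  null functions and orthogonality to it is no condition; this absorbs the separate clause for
  \<open>n = 0\<close>.\<close>

lemma chaos_eq: "chaos M H n = {f \<in> Qbar (Suc n). \<forall>g\<in>Qbar n. inner2 M f g = 0}"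
proof (cases n)
  case 0
  have "inner2 M f g = 0" if "f \<in> L2c M" "g \<in> Qbar 0" for f g
    using that(1) _ that(2) by (rule orth_Q_Qbar) (auto dest: Q_0 simp: inner2_def)
  then show ?thesis unfolding chaos_def Fbar_eq 0 using Qbar_L2c by auto
next
  case (Suc m)
  then show ?thesis by (simp add: chaos_def Fbar_eq)
qed

lemma chaosD: assumes "f \<in> chaos M H n"
  shows "f \<in> Qbar (Suc n)" "f \<in> L2c M" "g \<in> Qbar n \<Longrightarrow> inner2 M f g = 0"
  using assms Qbar_L2c unfolding chaos_eq by auto

lemma closed_subspace_chaos: "closed_subspace (chaos M H n)"
proof -
  note V = closed_subspace_Qbar[of "Suc n"]
  have L: "g \<in> Qbar n \<Longrightarrow> g \<in> L2c M" for g using Qbar_L2c .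
  show ?thesis
    unfolding closed_subspace_def
  proof (intro conjI allI impI ballI)
    show "chaos M H n \<subseteq> L2c M" using chaosD by auto
    show "(\<lambda>x. 0) \<in> chaos M H n" using closed_subspaceD(2)[OF V] by (simp add: chaos_eq inner2_def)
    show "(\<lambda>x. f x + g x) \<in> chaos M H n" if "f \<in> chaos M H n" "g \<in> chaos M H n" for f g
      using that closed_subspaceD(3)[OF V] L chaosD(2)[OF that(1)] chaosD(2)[OF that(2)] by (auto simp: chaos_eq inner2_add_left)
    show "(\<lambda>x. c * f x) \<in> chaos M H n" if "f \<in> chaos M H n" for c f
      using that closed_subspaceD(4)[OF V] by (auto simp: chaos_eq inner2_cmult_left)
    fix f g assume f: "\<forall>m. f m \<in> chaos M H n" and g: "g \<in> L2c M" and lim: "(\<lambda>m. norm2 M (\<lambda>x. f m x - g x)) \<longlonglongrightarrow> 0"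
    have "inner2 M g k = 0" if "k \<in> Qbar n" for k
    proof -
      have "(\<lambda>m. inner2 M (f m) k) \<longlonglongrightarrow> inner2 M g k"
        using f chaosD(2) L[OF that] g lim by (intro inner2_tendsto) auto
      moreover have "inner2 M (f m) k = 0" for m using f chaosD(3) that by auto
      ultimately show ?thesis by (simp add: LIMSEQ_const_iff)
    qed
    moreover have "g \<in> Qbar (Suc n)" by (rule Qbar_limit[OF chaosD(1)[OF spec[OF f]] g lim])
    ultimately show "g \<in> chaos M H n" by (simp add: chaos_eq)
  qed
qed

lemma chaos_proj:
  assumes "f \<in> L2c M"
  shows "chaos_proj M H n f \<in> chaos M H n"
    "h \<in> chaos M H n \<Longrightarrow> inner2 M (\<lambda>x. f x - chaos_proj M H n f x) h = 0"
proof -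
  obtain g where "g \<in> chaos M H n" "\<And>h. h \<in> chaos M H n \<Longrightarrow> inner2 M (\<lambda>x. f x - g x) h = 0"
    by (rule projection_exists[OF closed_subspace_chaos[of n] assms]) (rule that)
  then have "\<exists>g. g \<in> chaos M H n \<and> (\<forall>h\<in>chaos M H n. inner2 M (\<lambda>x. f x - g x) h = 0)" by blast
  note someI_ex[OF this, folded chaos_proj_def]
  then show "chaos_proj M H n f \<in> chaos M H n"
    "h \<in> chaos M H n \<Longrightarrow> inner2 M (\<lambda>x. f x - chaos_proj M H n f x) h = 0" by auto
qed

lemma chaos_proj_L2c: "f \<in> L2c M \<Longrightarrow> chaos_proj M H n f \<in> L2c M"
  using chaos_proj(1) chaosD(2) by blast

lemma chaos_proj_unique:
  assumes f: "f \<in> L2c M" and g: "g \<in> chaos M H n" "\<And>h. h \<in> chaos M H n \<Longrightarrow> inner2 M (\<lambda>x. f x - g x) h = 0"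
  shows "AE x in M. chaos_proj M H n f x = g x"
proof -
  define d where "d = (\<lambda>x. chaos_proj M H n f x - g x)"
  have d: "d \<in> chaos M H n" unfolding d_def by (intro closed_subspace_diff[OF closed_subspace_chaos] chaos_proj f g)
  have dL: "d \<in> L2c M" using d chaosD by auto
  have "inner2 M d d = inner2 M (\<lambda>x. (f x - g x) - (f x - chaos_proj M H n f x)) d"
    by (simp add: d_def)
  also have "\<dots> = inner2 M (\<lambda>x. f x - g x) d - inner2 M (\<lambda>x. f x - chaos_proj M H n f x) d"
    using f g chaosD(2) chaos_proj_L2c dL by (intro inner2_diff_left L2c_diff) auto
  also have "\<dots> = 0" using g(2)[OF d] chaos_proj(2)[OF f d] by simp
  finally have "norm2 M d = 0" by (simp add: inner2_self)
  then show ?thesis using norm2_eq_0_AE[OF dL] by (auto simp: d_def)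
qed

text \<open>Continuous extension of a bounded bilinear map, phrased for the sequence
  \<open>r\<close> of its values only. It serves pointwise products of polynomials and again
  \<open>wk\<close>, in the latter case with \<open>C = 1\<close>.\<close>

lemma bilinear_limit:
  assumes r: "\<And>m. r m \<in> L2c M"
    and F: "\<And>m. F m \<in> L2c M" "f \<in> L2c M" "(\<lambda>m. norm2 M (\<lambda>x. F m x - f x)) \<longlonglongrightarrow> 0"
    and G: "\<And>m. G m \<in> L2c M" "g \<in> L2c M" "(\<lambda>m. norm2 M (\<lambda>x. G m x - g x)) \<longlonglongrightarrow> 0"
    and C: "C \<ge> 0"
      "\<And>m n. norm2 M (\<lambda>x. r m x - r n x) \<le> C * norm2 M (\<lambda>x. F m x - F n x) * norm2 M (G m) + C * norm2 M (F n) * norm2 M (\<lambda>x. G m x - G n x)"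
  obtains k where "k \<in> L2c M" "(\<lambda>m. norm2 M (\<lambda>x. r m x - k x)) \<longlonglongrightarrow> 0"
proof (rule L2c_complete[OF r])
  fix e :: real assume e: "e > 0"
  obtain A where "\<And>m. norm (norm2 M (F m)) \<le> A"
    using convergent_imp_Bseq[OF convergentI[OF norm2_tendsto[OF F]]] unfolding Bseq_def by blast
  then have A: "norm2 M (F m) \<le> A" for m by simp
  obtain B where "\<And>m. norm (norm2 M (G m)) \<le> B"
    using convergent_imp_Bseq[OF convergentI[OF norm2_tendsto[OF G]]] unfolding Bseq_def by blast
  then have B: "norm2 M (G m) \<le> B" for m by simp
  have AB0: "A \<ge> 0" "B \<ge> 0" using A[of 0] B[of 0] norm2_nonneg order_trans by blast+
  define K where "K = C * B + C * A"
  have K0: "K \<ge> 0" using AB0 C(1) by (simp add: K_def)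
  define \<delta> where "\<delta> = e / (2 * (K + 1))"
  have \<delta>: "\<delta> > 0" using e K0 by (simp add: \<delta>_def)
  obtain N1 where N1: "\<And>m. m \<ge> N1 \<Longrightarrow> norm2 M (\<lambda>x. F m x - f x) < \<delta>"
    using order_tendstoD(2)[OF F(3) \<delta>] by (auto simp: eventually_sequentially)
  obtain N2 where N2: "\<And>m. m \<ge> N2 \<Longrightarrow> norm2 M (\<lambda>x. G m x - g x) < \<delta>"
    using order_tendstoD(2)[OF G(3) \<delta>] by (auto simp: eventually_sequentially)
  have "norm2 M (\<lambda>x. r m x - r n x) < e" if mn: "m \<ge> max N1 N2" "n \<ge> max N1 N2" for m n
  proof -
    have dF: "norm2 M (\<lambda>x. F m x - F n x) \<le> 2 * \<delta>"
      using norm2_triangle_diff[OF F(1) F(2) F(1), of m n] N1[of m] N1[of n] mn norm2_minus_commute[of M f "F n"] by auto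
    have dG: "norm2 M (\<lambda>x. G m x - G n x) \<le> 2 * \<delta>"
      using norm2_triangle_diff[OF G(1) G(2) G(1), of m n] N2[of m] N2[of n] mn norm2_minus_commute[of M g "G n"] by auto
    have "norm2 M (\<lambda>x. r m x - r n x) \<le> C * norm2 M (\<lambda>x. F m x - F n x) * norm2 M (G m) + C * norm2 M (F n) * norm2 M (\<lambda>x. G m x - G n x)"
      by (rule C(2))
    also have "\<dots> \<le> C * (2 * \<delta>) * B + C * A * (2 * \<delta>)"
      using C(1) A[of n] B[of m] dF dG AB0 \<delta> by (intro add_mono mult_mono mult_nonneg_nonneg) auto
    also have "\<dots> = 2 * \<delta> * K" by (simp add: K_def algebra_simps)
    also have "\<dots> < 2 * \<delta> * (K + 1)" using \<delta> by simp
    also have "\<dots> = e" using K0 by (simp add: \<delta>_def field_simps)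
    finally show ?thesis .
  qed
  then show "\<exists>N. \<forall>m\<ge>N. \<forall>n\<ge>N. norm2 M (\<lambda>x. r m x - r n x) < e" by blast
qed

text \<open>By \<open>poly_product_bound\<close> the products have an L2 limit \<open>k\<close>,
  while Cauchy-Schwarz makes them converge to \<open>f * g\<close> in L1; comparing the two puts
  \<open>f * g\<close> into L2. This is what gives the projection of a product of chaos elements its
  meaning.\<close>

lemma product_limit:
  assumes p: "\<And>m. p m \<in> Q (Suc i)" "f \<in> L2c M" "(\<lambda>m. norm2 M (\<lambda>x. p m (path x) - f x)) \<longlonglongrightarrow> 0"
    and q: "\<And>m. q m \<in> Q (Suc j)" "g \<in> L2c M" "(\<lambda>m. norm2 M (\<lambda>x. q m (path x) - g x)) \<longlonglongrightarrow> 0"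
  shows "(\<lambda>x. f x * g x) \<in> L2c M" "(\<lambda>m. norm2 M (\<lambda>x. p m (path x) * q m (path x) - f x * g x)) \<longlonglongrightarrow> 0"
proof -
  note pL = Q_L2c[OF p(1)] and qL = Q_L2c[OF q(1)]
  have pqL: "(\<lambda>x. p m (path x) * q n (path x)) \<in> L2c M" for m n using Q_L2c[OF Q_mult[OF p(1) q(1)]] .
  obtain C where C: "C \<ge> 0" "\<And>p q. p \<in> Q (Suc i) \<Longrightarrow> q \<in> Q (Suc j) \<Longrightarrow> nrm (\<lambda>\<xi>. p \<xi> * q \<xi>) \<le> C * nrm p * nrm q"
    using poly_product_bound[of i j] by blast
  obtain k where k: "k \<in> L2c M" "(\<lambda>m. norm2 M (\<lambda>x. p m (path x) * q m (path x) - k x)) \<longlonglongrightarrow> 0"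
  proof (rule bilinear_limit[where r="\<lambda>m x. p m (path x) * q m (path x)" and F="\<lambda>m x. p m (path x)"
        and G="\<lambda>m x. q m (path x)", OF pqL pL p(2,3) qL q(2,3) C(1)])
    fix m n
    have 1: "norm2 M (\<lambda>x. (p m (path x) - p n (path x)) * q m (path x)) \<le> C * nrm (\<lambda>\<xi>. p m \<xi> - p n \<xi>) * nrm (q m)"
      by (rule C(2)[OF Q_diff[OF p(1) p(1)] q(1)])
    have 2: "norm2 M (\<lambda>x. p n (path x) * (q m (path x) - q n (path x))) \<le> C * nrm (p n) * nrm (\<lambda>\<xi>. q m \<xi> - q n \<xi>)"
      by (rule C(2)[OF p(1) Q_diff[OF q(1) q(1)]])
    have "norm2 M (\<lambda>x. p m (path x) * q m (path x) - p n (path x) * q n (path x))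
       = norm2 M (\<lambda>x. (p m (path x) - p n (path x)) * q m (path x) + p n (path x) * (q m (path x) - q n (path x)))"
      by (simp add: algebra_simps)
    also have "\<dots> \<le> norm2 M (\<lambda>x. (p m (path x) - p n (path x)) * q m (path x)) + norm2 M (\<lambda>x. p n (path x) * (q m (path x) - q n (path x)))"
      by (intro norm2_triangle Q_L2c[OF Q_mult[OF Q_diff[OF p(1) p(1)] q(1)]] Q_L2c[OF Q_mult[OF p(1) Q_diff[OF q(1) q(1)]]])
    finally show "norm2 M (\<lambda>x. p m (path x) * q m (path x) - p n (path x) * q n (path x))
       \<le> C * nrm (\<lambda>\<xi>. p m \<xi> - p n \<xi>) * nrm (q m) + C * nrm (p n) * nrm (\<lambda>\<xi>. q m \<xi> - q n \<xi>)"
      using 1 2 by simp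
  qed blast
  have [measurable]: "f \<in> borel_measurable M" "g \<in> borel_measurable M" "k \<in> borel_measurable M"
    using p q k by (auto dest: L2cD)
  have fg: "integrable M (\<lambda>x. f x * g x)" using p q by (intro integrable_mult_L2c)
  \<comment> \<open>The left side does not depend on \<open>m\<close>; letting \<open>m\<close> grow
    shows that \<open>f * g\<close> and \<open>k\<close> agree almost everywhere.\<close>
  have le: "(\<integral>x. cmod (f x * g x - k x) \<partial>M) \<le> norm2 M (\<lambda>x. p m (path x) - f x) * nrm (q m)
      + norm2 M f * norm2 M (\<lambda>x. q m (path x) - g x) + norm2 M (\<lambda>x. p m (path x) * q m (path x) - k x)" for m
  proof -
    note d1 = L2c_diff[OF pL[of m] p(2)] and d2 = L2c_diff[OF qL[of m] q(2)] and d3 = L2c_diff[OF pqL[of m m] k(1)]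
    have i1: "integrable M (\<lambda>x. cmod (p m (path x) - f x) * cmod (q m (path x)))"
      using integrable_norm[OF integrable_mult_L2c[OF d1 qL[of m]]] by (simp add: norm_mult)
    have i2: "integrable M (\<lambda>x. cmod (f x) * cmod (q m (path x) - g x))"
      using integrable_norm[OF integrable_mult_L2c[OF p(2) d2]] by (simp add: norm_mult)
    have i3: "integrable M (\<lambda>x. cmod (p m (path x) * q m (path x) - k x))"
      using L2c_integrable[OF d3] by auto
    have "(\<integral>x. cmod (f x * g x - k x) \<partial>M) \<le> (\<integral>x. cmod (p m (path x) - f x) * cmod (q m (path x))
       + cmod (f x) * cmod (q m (path x) - g x) + cmod (p m (path x) * q m (path x) - k x) \<partial>M)"
    proof (intro integral_mono integrable_norm Bochner_Integration.integrable_diff Bochner_Integration.integrable_add fg L2c_integrable[OF k(1)] L2c_integrable[OF pqL[of m m]] i1 i2 i3)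
      fix x
      have E: "f x * g x - k x = - ((p m (path x) - f x) * q m (path x)) + - (f x * (q m (path x) - g x)) + (p m (path x) * q m (path x) - k x)"
        by (simp add: algebra_simps)
      show "cmod (f x * g x - k x) \<le> cmod (p m (path x) - f x) * cmod (q m (path x))
       + cmod (f x) * cmod (q m (path x) - g x) + cmod (p m (path x) * q m (path x) - k x)"
        unfolding E using norm_triangle_ineq[of "- ((p m (path x) - f x) * q m (path x)) + - (f x * (q m (path x) - g x))" "p m (path x) * q m (path x) - k x"]
          norm_triangle_ineq[of "- ((p m (path x) - f x) * q m (path x))" "- (f x * (q m (path x) - g x))"]
        unfolding norm_minus_cancel norm_mult[of "p m (path x) - f x"] norm_mult[of "f x" "q m (path x) - g x"] by argo
    qed
    also have "\<dots> = (\<integral>x. cmod (p m (path x) - f x) * cmod (q m (path x)) \<partial>M)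
       + (\<integral>x. cmod (f x) * cmod (q m (path x) - g x) \<partial>M) + (\<integral>x. cmod (p m (path x) * q m (path x) - k x) \<partial>M)"
      using i1 i2 i3 by simp
    also have "\<dots> \<le> norm2 M (\<lambda>x. p m (path x) - f x) * nrm (q m)
      + norm2 M f * norm2 M (\<lambda>x. q m (path x) - g x) + norm2 M (\<lambda>x. p m (path x) * q m (path x) - k x)"
      by (intro add_mono integral_mult_le_norm2 norm1_le_norm2 d1 d2 d3 qL p(2))
    finally show ?thesis .
  qed
  have "(\<lambda>m. norm2 M (\<lambda>x. p m (path x) - f x) * nrm (q m)
      + norm2 M f * norm2 M (\<lambda>x. q m (path x) - g x) + norm2 M (\<lambda>x. p m (path x) * q m (path x) - k x)) \<longlonglongrightarrow> 0 * norm2 M g + norm2 M f * 0 + 0"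
    by (intro tendsto_intros p(3) q(3) k(2) norm2_tendsto[OF qL q(2,3)])
  from LIMSEQ_le_const[OF this, of "\<integral>x. cmod (f x * g x - k x) \<partial>M"]
  have "(\<integral>x. cmod (f x * g x - k x) \<partial>M) \<le> 0" using le by simp
  then have "(\<integral>x. cmod (f x * g x - k x) \<partial>M) = 0" by (intro antisym integral_nonneg_AE) auto
  then have AE: "AE x in M. f x * g x = k x"
    using integral_nonneg_eq_0_iff_AE[of M "\<lambda>x. cmod (f x * g x - k x)"] fg L2c_integrable[OF k(1)] by auto
  have "integrable M (\<lambda>x. (cmod (f x * g x))\<^sup>2) \<longleftrightarrow> integrable M (\<lambda>x. (cmod (k x))\<^sup>2)"
    using AE by (intro integrable_cong_AE) auto
  then show "(\<lambda>x. f x * g x) \<in> L2c M" using k(1) by (simp add: L2c_def)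
  have "norm2 M (\<lambda>x. p m (path x) * q m (path x) - k x) = norm2 M (\<lambda>x. p m (path x) * q m (path x) - f x * g x)" for m
  proof (rule norm2_cong_AE)
    show "AE x in M. p m (path x) * q m (path x) - k x = p m (path x) * q m (path x) - f x * g x" using AE by auto
  qed (use L2cD(1)[OF pqL[of m m]] in measurable)
  with k(2) show "(\<lambda>m. norm2 M (\<lambda>x. p m (path x) * q m (path x) - f x * g x)) \<longlonglongrightarrow> 0" by simp
qed

lemma chaos_orth_pmon:
  assumes "f \<in> chaos M H i" "p \<in> Q i"
  shows "(\<integral>x. f x * p (path x) \<partial>M) = 0"
  using chaosD(3)[OF assms(1) Q_Qbar[OF Q_cnj[OF assms(2)]]] by (simp add: inner2_def)

lemma cis_L2c: "h \<in> H \<Longrightarrow> (\<lambda>x. cis (c * h x)) \<in> L2c M"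
  by (intro L2c_bounded[of _ 1]) (auto dest!: H_meas)

text \<open>\<open>chaos_proj\<close> chooses among representatives, so the product is recorded
  through its Fourier integrals, which do not see the choice and which later form a Cauchy
  product.\<close>

lemma chaos_product_proj:
  assumes ab: "a\<^sup>2 + b\<^sup>2 = 1" and f: "f \<in> chaos M H i" and g: "g \<in> chaos M H j" and h: "h \<in> H"
  shows "(\<lambda>y. (complex_of_real a ^ i * f y) * (complex_of_real b ^ j * g y)) \<in> L2c M"
    "(\<integral>x. chaos_proj M H (i + j) (\<lambda>y. (complex_of_real a ^ i * f y) * (complex_of_real b ^ j * g y)) x * cis (h x) \<partial>M)
     = (\<integral>x. f x * cis (a * h x) \<partial>M) * (\<integral>x. g x * cis (b * h x) \<partial>M)"
proof -
  note fL = chaosD(2)[OF f] and gL = chaosD(2)[OF g]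
  obtain p where p: "\<And>m. p m \<in> Q (Suc i)" "(\<lambda>m. norm2 M (\<lambda>x. p m (path x) - f x)) \<longlonglongrightarrow> 0"
    by (rule Qbar_seq[OF chaosD(1)[OF f]]) (rule that)
  obtain q where q: "\<And>m. q m \<in> Q (Suc j)" "(\<lambda>m. norm2 M (\<lambda>x. q m (path x) - g x)) \<longlonglongrightarrow> 0"
    by (rule Qbar_seq[OF chaosD(1)[OF g]]) (rule that)
  note pL = Q_L2c[OF p(1)] and qL = Q_L2c[OF q(1)]
  note pl = product_limit[OF p(1) fL p(2) q(1) gL q(2)]
  define c where "c = complex_of_real a ^ i * complex_of_real b ^ j"
  have fun_eq: "(\<lambda>y. (complex_of_real a ^ i * f y) * (complex_of_real b ^ j * g y)) = (\<lambda>y. c * (f y * g y))"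
    by (simp add: c_def algebra_simps)
  show L: "(\<lambda>y. (complex_of_real a ^ i * f y) * (complex_of_real b ^ j * g y)) \<in> L2c M"
    unfolding fun_eq by (intro L2c_cmult pl)
  define W where "W m = wk a b (p m) (q m)" for m
  have WQ: "W m \<in> Q (Suc (i + j))" for m unfolding W_def by (rule wk_poly(2)[OF p(1) q(1)])
  have WL: "(\<lambda>x. W m (path x)) \<in> L2c M" for m by (rule Q_L2c[OF WQ])
  \<comment> \<open>\<open>f\<close> and \<open>g\<close> are functions on \<open>\<Omega>\<close>,
    whereas \<open>wk\<close> acts on functions of paths; \<open>w\<close> plays the role of their
    \<open>wk\<close>, obtained as a limit along polynomials.\<close>
  obtain w where w: "w \<in> L2c M" "(\<lambda>m. norm2 M (\<lambda>x. W m (path x) - w x)) \<longlonglongrightarrow> 0"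
  proof (rule bilinear_limit[where r="\<lambda>m x. W m (path x)" and F="\<lambda>m x. p m (path x)"
        and G="\<lambda>m x. q m (path x)" and C=1, OF WL pL fL p(2) qL gL q(2)])
    fix m n
    have e: "W m \<xi> - W n \<xi> = wk a b (\<lambda>\<xi>. p m \<xi> - p n \<xi>) (q m) \<xi> + wk a b (p n) (\<lambda>\<xi>. q m \<xi> - q n \<xi>) \<xi>" for \<xi>
      unfolding W_def wk_def left_diff_distrib right_diff_distrib
      by (simp add: wk_poly(3)[OF p(1) q(1)])
    have "norm2 M (\<lambda>x. W m (path x) - W n (path x)) \<le> nrm (wk a b (\<lambda>\<xi>. p m \<xi> - p n \<xi>) (q m)) + nrm (wk a b (p n) (\<lambda>\<xi>. q m \<xi> - q n \<xi>))"
      unfolding e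
      by (intro norm2_triangle Q_L2c[OF wk_poly(2)[OF Q_diff[OF p(1) p(1)] q(1)]] Q_L2c[OF wk_poly(2)[OF p(1) Q_diff[OF q(1) q(1)]]])
    also have "\<dots> \<le> nrm (\<lambda>\<xi>. p m \<xi> - p n \<xi>) * nrm (q m) + nrm (p n) * nrm (\<lambda>\<xi>. q m \<xi> - q n \<xi>)"
      by (intro add_mono wk_L2c(2)[OF ab] Q_measurable[OF Q_diff[OF p(1) p(1)]] Q_measurable[OF Q_diff[OF q(1) q(1)]]
          Q_measurable[OF p(1)] Q_measurable[OF q(1)] pL qL L2c_diff)
    finally show "norm2 M (\<lambda>x. W m (path x) - W n (path x))
       \<le> 1 * nrm (\<lambda>\<xi>. p m \<xi> - p n \<xi>) * nrm (q m) + 1 * nrm (p n) * nrm (\<lambda>\<xi>. q m \<xi> - q n \<xi>)" by simp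
  qed auto
  have wbar: "w \<in> Qbar (Suc (i + j))" by (rule Qbar_limit[OF Q_Qbar[OF WQ] w])
  have diff: "(\<lambda>x. w x - c * (f x * g x)) \<in> Qbar (i + j)"
  proof (rule Qbar_limit)
    show "(\<lambda>x. W m (path x) - c * (p m (path x) * q m (path x))) \<in> Qbar (i + j)" for m
      unfolding W_def c_def using Q_Qbar[OF wk_poly(1)[OF p(1) q(1)]] .
    show "(\<lambda>x. w x - c * (f x * g x)) \<in> L2c M" by (intro L2c_diff L2c_cmult w pl)
    show "(\<lambda>m. norm2 M (\<lambda>x. (W m (path x) - c * (p m (path x) * q m (path x))) - (w x - c * (f x * g x)))) \<longlonglongrightarrow> 0"
      by (rule norm2_diff_tendsto[OF WL Q_L2c[OF Q_mult[OF p(1) q(1)]] w(1) pl(1) w(2) pl(2)])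
  qed
  have "inner2 M w (\<lambda>x. \<kappa> (path x)) = 0" if \<kappa>: "\<kappa> \<in> Q (i + j)" for \<kappa>
  proof -
    define \<kappa>' where "\<kappa>' = (\<lambda>\<xi>. cnj (\<kappa> \<xi>))"
    have \<kappa>': "\<kappa>' \<in> Q (i + j)" unfolding \<kappa>'_def by (rule Q_cnj[OF \<kappa>])
    note R = D_mix_poly[OF \<kappa>', of a b]
    have "(\<integral>x. W m (path x) * \<kappa>' (path x) \<partial>M) = (\<integral>(x, y). p m (path x) * q m (path y) * \<kappa>' (mix a b (path x) (path y)) \<partial>(M \<Otimes>\<^sub>M M))" for m
      unfolding W_def
      by (rule integral_wk_mult[OF ab Q_measurable[OF p(1)] Q_measurable[OF q(1)] Q_measurable[OF \<kappa>'] D_pair_integrable[OF R pL qL]])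
    moreover have "(\<lambda>m. \<integral>(x, y). p m (path x) * q m (path y) * \<kappa>' (mix a b (path x) (path y)) \<partial>(M \<Otimes>\<^sub>M M)) \<longlonglongrightarrow> 0"
    proof (rule D_pair_tendsto_0[OF R pL fL p(2) qL gL q(2)])
      fix hs ks assume hk: "set hs \<subseteq> H" "set ks \<subseteq> H" "(length hs, length ks) \<in> {(i', j'). i' + j' < i + j}"
      \<comment> \<open>One of the two degrees falls short of its chaos index, and that factor
        vanishes by orthogonality.\<close>
      then consider "length hs < i" | "length ks < j" by fastforce
      then show "(\<integral>x. f x * pmon hs (path x) \<partial>M) * (\<integral>x. g x * pmon ks (path x) \<partial>M) = 0"
      proof cases
        case 1
        then show ?thesis using chaos_orth_pmon[OF f Q_mon[OF hk(1), of i 1]] by simp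
      next
        case 2
        then show ?thesis using chaos_orth_pmon[OF g Q_mon[OF hk(2), of j 1]] by simp
      qed
    qed
    ultimately have "(\<lambda>m. \<integral>x. W m (path x) * \<kappa>' (path x) \<partial>M) \<longlonglongrightarrow> 0" by simp
    with integral_mult_tendsto[OF WL w Q_L2c[OF \<kappa>']] have "(\<integral>x. w x * \<kappa>' (path x) \<partial>M) = 0"
      using LIMSEQ_unique by blast
    then show ?thesis by (simp add: inner2_def \<kappa>'_def)
  qed
  then have wch: "w \<in> chaos M H (i + j)"
    unfolding chaos_eq using wbar orth_Q_Qbar[OF w(1)] by auto
  have "AE x in M. chaos_proj M H (i + j) (\<lambda>y. c * (f y * g y)) x = w x"
  proof (rule chaos_proj_unique[OF _ wch])
    show "(\<lambda>y. c * (f y * g y)) \<in> L2c M" by (intro L2c_cmult pl)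
    fix k assume k: "k \<in> chaos M H (i + j)"
    have "(\<lambda>x. c * (f x * g x) - w x) \<in> Qbar (i + j)"
      using closed_subspaceD(4)[OF closed_subspace_Qbar diff, of "-1"] by simp
    from chaosD(3)[OF k this] show "inner2 M (\<lambda>x. c * (f x * g x) - w x) k = 0"
      using inner2_commute[of M _ k] by simp
  qed
  moreover have [measurable]: "h \<in> borel_measurable M" "w \<in> borel_measurable M"
      "chaos_proj M H (i + j) (\<lambda>y. c * (f y * g y)) \<in> borel_measurable M"
    using chaos_proj_L2c[OF L, of "i + j"] w(1) H_meas[OF h] unfolding fun_eq by (auto dest: L2cD)
  ultimately have "(\<integral>x. chaos_proj M H (i + j) (\<lambda>y. c * (f y * g y)) x * cis (h x) \<partial>M) = (\<integral>x. w x * cis (h x) \<partial>M)"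
    by (intro integral_cong_AE) auto
  also have "\<dots> = (\<integral>x. f x * cis (a * h x) \<partial>M) * (\<integral>x. g x * cis (b * h x) \<partial>M)"
  proof (rule LIMSEQ_unique)
    show "(\<lambda>m. \<integral>x. W m (path x) * cis (h x) \<partial>M) \<longlonglongrightarrow> (\<integral>x. w x * cis (h x) \<partial>M)"
      using integral_mult_tendsto[OF WL w cis_L2c[OF h, of 1]] by simp
    have "(\<integral>x. W m (path x) * cis (h x) \<partial>M) = (\<integral>x. p m (path x) * cis (a * h x) \<partial>M) * (\<integral>x. q m (path x) * cis (b * h x) \<partial>M)" for m
      unfolding W_def by (rule integral_wk_cis[OF ab h Q_measurable[OF p(1)] Q_measurable[OF q(1)] L2c_integrable[OF pL] L2c_integrable[OF qL]])
    then show "(\<lambda>m. \<integral>x. W m (path x) * cis (h x) \<partial>M) \<longlonglongrightarrow> (\<integral>x. f x * cis (a * h x) \<partial>M) * (\<integral>x. g x * cis (b * h x) \<partial>M)"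
      using tendsto_mult[OF integral_mult_tendsto[OF pL fL p(2) cis_L2c[OF h, of a]] integral_mult_tendsto[OF qL gL q(2) cis_L2c[OF h, of b]]]
      by simp
  qed
  finally show "(\<integral>x. chaos_proj M H (i + j) (\<lambda>y. (complex_of_real a ^ i * f y) * (complex_of_real b ^ j * g y)) x * cis (h x) \<partial>M)
     = (\<integral>x. f x * cis (a * h x) \<partial>M) * (\<integral>x. g x * cis (b * h x) \<partial>M)"
    unfolding fun_eq .
qed

end

section \<open>Wiener--Ito expansion and Fourier transforms\<close>

context gaussian_space
begin

definition chaos_sum :: "('a \<Rightarrow> complex) \<Rightarrow> nat \<Rightarrow> 'a \<Rightarrow> complex" where
  "chaos_sum \<phi> N x = (\<Sum>i<N. chaos_proj M H i \<phi> x)"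

text \<open>\<open>Qbar (Suc N)\<close> is the orthogonal sum of \<open>Qbar N\<close> and the chaos
  of order \<open>N\<close>, so adding one chaos projection to the projection onto
  \<open>Qbar N\<close> yields the next one.\<close>

lemma chaos_sum_proj:
  assumes \<phi>: "\<phi> \<in> L2c M"
  shows "chaos_sum \<phi> N \<in> Qbar N" "g \<in> Qbar N \<Longrightarrow> inner2 M (\<lambda>x. \<phi> x - chaos_sum \<phi> N x) g = 0"
proof -
  have "chaos_sum \<phi> N \<in> Qbar N \<and> (\<forall>g\<in>Qbar N. inner2 M (\<lambda>x. \<phi> x - chaos_sum \<phi> N x) g = 0)"
  proof (induction N)
    case 0
    have "inner2 M \<phi> g = 0" if "g \<in> Qbar 0" for g
      using \<phi> _ that by (rule orth_Q_Qbar) (auto dest: Q_0 simp: inner2_def)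
    then show ?case
      using closed_subspaceD(2)[OF closed_subspace_Qbar] by (simp add: chaos_sum_def[abs_def])
  next
    case (Suc N)
    let ?P = "chaos_proj M H N \<phi>"
    have S: "chaos_sum \<phi> (Suc N) x = chaos_sum \<phi> N x + ?P x" for x by (simp add: chaos_sum_def)
    have T: "chaos_sum \<phi> N \<in> Qbar N" using Suc by auto
    note TL = Qbar_L2c[OF T] and PL = chaos_proj_L2c[OF \<phi>, of N] and Pch = chaos_proj(1)[OF \<phi>, of N]
    have "(\<lambda>x. chaos_sum \<phi> N x + ?P x) \<in> Qbar (Suc N)"
      by (rule closed_subspaceD(3)[OF closed_subspace_Qbar Qbar_mono[OF _ T] chaosD(1)[OF Pch]]) simp
    then have 1: "chaos_sum \<phi> (Suc N) \<in> Qbar (Suc N)" unfolding S[abs_def] by simp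
    have "inner2 M (\<lambda>x. \<phi> x - chaos_sum \<phi> (Suc N) x) g = 0" if g: "g \<in> Qbar (Suc N)" for g
    proof -
      \<comment> \<open>The test function is split in the same way: \<open>g2\<close> is its
        projection onto \<open>Qbar N\<close>, and \<open>g - g2\<close> lies in the chaos of order
        \<open>N\<close>.\<close>
      obtain g2 where g2: "g2 \<in> Qbar N" "\<And>h. h \<in> Qbar N \<Longrightarrow> inner2 M (\<lambda>x. g x - g2 x) h = 0"
        by (rule projection_exists[OF closed_subspace_Qbar[of N] Qbar_L2c[OF g]]) (rule that)
      define g1 where "g1 = (\<lambda>x. g x - g2 x)"
      have g1: "g1 \<in> chaos M H N"
        unfolding chaos_eq g1_def using g2(2)
        by (auto intro: closed_subspace_diff[OF closed_subspace_Qbar g Qbar_mono[OF _ g2(1)]])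
      note L1 = chaosD(2)[OF g1] and L2 = Qbar_L2c[OF g2(1)]
      have a: "inner2 M g1 (\<lambda>x. \<phi> x - chaos_sum \<phi> (Suc N) x) = 0"
      proof -
        have "inner2 M (\<lambda>x. (\<phi> x - ?P x) - chaos_sum \<phi> N x) g1 = inner2 M (\<lambda>x. \<phi> x - ?P x) g1 - inner2 M (chaos_sum \<phi> N) g1"
          by (intro inner2_diff_left L2c_diff \<phi> PL TL L1)
        also have "\<dots> = 0"
          using chaos_proj(2)[OF \<phi> g1] chaosD(3)[OF g1 T] inner2_commute[of M _ g1] by simp
        finally show ?thesis using inner2_commute[of M g1] by (simp add: S algebra_simps)
      qed
      have b: "inner2 M g2 (\<lambda>x. \<phi> x - chaos_sum \<phi> (Suc N) x) = 0"
      proof -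
        have "inner2 M (\<lambda>x. (\<phi> x - chaos_sum \<phi> N x) - ?P x) g2 = inner2 M (\<lambda>x. \<phi> x - chaos_sum \<phi> N x) g2 - inner2 M ?P g2"
          by (intro inner2_diff_left L2c_diff \<phi> PL TL L2)
        also have "\<dots> = 0"
          using Suc g2(1) chaosD(3)[OF Pch g2(1)] by simp
        finally show ?thesis using inner2_commute[of M g2] by (simp add: S algebra_simps)
      qed
      have "g = (\<lambda>x. g1 x + g2 x)" by (simp add: g1_def)
      then have "inner2 M g (\<lambda>x. \<phi> x - chaos_sum \<phi> (Suc N) x) = 0"
        using a b inner2_add_left[OF L1 L2 L2c_diff[OF \<phi> Qbar_L2c[OF 1]]] by simp
      then show ?thesis using inner2_commute[of M _ g] by simp
    qed
    with 1 show ?case by blast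
  qed
  then show "chaos_sum \<phi> N \<in> Qbar N" "g \<in> Qbar N \<Longrightarrow> inner2 M (\<lambda>x. \<phi> x - chaos_sum \<phi> N x) g = 0" by auto
qed

lemma chaos_sum_pythagoras:
  assumes "\<phi> \<in> L2c M"
  shows "(norm2 M \<phi>)\<^sup>2 = (norm2 M (\<lambda>x. \<phi> x - chaos_sum \<phi> N x))\<^sup>2 + (norm2 M (chaos_sum \<phi> N))\<^sup>2"
  using norm2_add_sq[OF L2c_diff[OF assms Qbar_L2c[OF chaos_sum_proj(1)[OF assms]]] Qbar_L2c[OF chaos_sum_proj(1)[OF assms]], of N N]
    chaos_sum_proj(2)[OF assms chaos_sum_proj(1)[OF assms], of N] by simp

lemma chaos_bessel:
  assumes \<phi>: "\<phi> \<in> L2c M"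
  shows "(\<Sum>i<N. (norm2 M (chaos_proj M H i \<phi>))\<^sup>2) \<le> (norm2 M \<phi>)\<^sup>2"
proof -
  have "(\<Sum>i<N. (norm2 M (chaos_proj M H i \<phi>))\<^sup>2) = (norm2 M (chaos_sum \<phi> N))\<^sup>2"
  proof (induction N)
    case 0
    then show ?case by (simp add: chaos_sum_def[abs_def])
  next
    case (Suc N)
    have "inner2 M (chaos_sum \<phi> N) (chaos_proj M H N \<phi>) = 0"
      using chaosD(3)[OF chaos_proj(1)[OF \<phi>] chaos_sum_proj(1)[OF \<phi>], of N] inner2_commute[of M "chaos_sum \<phi> N"] by simp
    then show ?case
      using norm2_add_sq[OF Qbar_L2c[OF chaos_sum_proj(1)[OF \<phi>]] chaos_proj_L2c[OF \<phi>], of N N] Suc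
      by (simp add: chaos_sum_def[abs_def])
  qed
  then show ?thesis using chaos_sum_pythagoras[OF \<phi>, of N] by simp
qed

lemma taylor_Q: assumes "h \<in> H"
  shows "\<exists>p\<in>Q (Suc n). \<forall>x. p (path x) = (\<Sum>k\<le>n. (\<i> * h x) ^ k / fact k)"
proof -
  have "(\<lambda>\<xi>. \<Sum>k\<le>m. (\<i> ^ k / fact k) * pmon (replicate k h) \<xi>) \<in> Q (Suc n)" if "m \<le> n" for m
    using that
  proof (induction m)
    case 0
    show ?case using Q_const[of "Suc n" 1] by simp
  next
    case (Suc m)
    have "(\<lambda>\<xi>. (\<i> ^ Suc m / fact (Suc m)) * pmon (replicate (Suc m) h) \<xi>) \<in> Q (Suc n)"
      using assms Suc.prems by (intro Q_mon) auto
    from Q_add[OF Suc.IH this] Suc.prems show ?case by simp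
  qed
  from this[of n] have p: "(\<lambda>\<xi>. \<Sum>k\<le>n. (\<i> ^ k / fact k) * pmon (replicate k h) \<xi>) \<in> Q (Suc n)" by simp
  have "pmon (replicate k h) (path x) = of_real (h x) ^ k" for k x
    using assms by (induction k) auto
  then show ?thesis
    by (intro bexI[OF _ p]) (simp add: power_mult_distrib)
qed

text \<open>Taylor polynomials of the exponential converge in L2. This links orthogonality to
  polynomials with Fourier uniqueness and is the source of the density of polynomials among adapted
  functions.\<close>

lemma cis_orth_0:
  assumes f: "f \<in> L2c M" and h: "h \<in> H" and orth: "\<And>n p. p \<in> Q n \<Longrightarrow> inner2 M f (\<lambda>x. p (path x)) = 0"
  shows "(\<integral>x. f x * cis (h x) \<partial>M) = 0"
proof -
  obtain p where p: "\<And>n. p n \<in> Q (Suc n)" "\<And>n x. p n (path x) = (\<Sum>k\<le>n. (\<i> * h x) ^ k / fact k)"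
    using taylor_Q[OF h] by metis
  have lim: "(\<lambda>n. norm2 M (\<lambda>x. p n (path x) - cis (h x))) \<longlonglongrightarrow> 0"
    using cis_taylor_norm2[OF h] unfolding p(2) by (subst norm2_minus_commute)
  have "(\<lambda>n. \<integral>x. p n (path x) * f x \<partial>M) \<longlonglongrightarrow> (\<integral>x. cis (h x) * f x \<partial>M)"
    by (rule integral_mult_tendsto[OF Q_L2c[OF p(1)] _ lim f]) (use cis_L2c[OF h, of 1] in simp)
  then have "(\<lambda>n. \<integral>x. p n (path x) * f x \<partial>M) \<longlonglongrightarrow> (\<integral>x. f x * cis (h x) \<partial>M)"
    by (simp add: mult.commute)
  moreover have "(\<integral>x. p n (path x) * f x \<partial>M) = 0" for n
    using orth[OF Q_cnj[OF p(1)]] by (simp add: inner2_def mult.commute)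
  ultimately show ?thesis by (simp add: LIMSEQ_const_iff)
qed

text \<open>\<open>\<phi>\<close> need not be the sum of its projections here. The series is only
  tested against the exponential \<open>e\<close>, which polynomials approximate, so a part of
  \<open>\<phi>\<close> orthogonal to all polynomials is invisible.\<close>

lemma chaos_series_sums:
  assumes \<phi>: "\<phi> \<in> L2c M" and h: "h \<in> H"
  shows "(\<lambda>i. \<integral>x. chaos_proj M H i \<phi> x * cis (h x) \<partial>M) sums (\<integral>x. \<phi> x * cis (h x) \<partial>M)"
    "summable (\<lambda>i. norm (\<integral>x. chaos_proj M H i \<phi> x * cis (h x) \<partial>M))"
proof -
  define e where "e = (\<lambda>x. cis (- 1 * h x))"
  have eL: "e \<in> L2c M" unfolding e_def by (rule cis_L2c[OF h])
  have cis_e: "cis (h x) = cnj (e x)" for x by (simp add: e_def cis_cnj)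
  have inner: "(\<integral>x. f x * cis (h x) \<partial>M) = inner2 M f e" for f by (simp add: inner2_def cis_e)
  have PL: "chaos_proj M H i \<phi> \<in> L2c M" for i by (rule chaos_proj_L2c[OF \<phi>])
  have PLe: "chaos_proj M H i e \<in> L2c M" for i by (rule chaos_proj_L2c[OF eL])
  \<comment> \<open>The exponential may be replaced by its own projection onto the same chaos, after
    which Bessel's inequality for \<open>\<phi>\<close> and for \<open>e\<close> gives absolute
    summability.\<close>
  have bound: "norm (inner2 M (chaos_proj M H i \<phi>) e) \<le> (norm2 M (chaos_proj M H i \<phi>))\<^sup>2 + (norm2 M (chaos_proj M H i e))\<^sup>2" for i
  proof -
    have "inner2 M (\<lambda>x. e x - chaos_proj M H i e x) (chaos_proj M H i \<phi>) = 0"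
      by (rule chaos_proj(2)[OF eL chaos_proj(1)[OF \<phi>]])
    then have "inner2 M e (chaos_proj M H i \<phi>) = inner2 M (chaos_proj M H i e) (chaos_proj M H i \<phi>)"
      by (simp add: inner2_diff_left[OF eL PLe PL])
    then have "norm (inner2 M (chaos_proj M H i \<phi>) e) = norm (inner2 M (chaos_proj M H i e) (chaos_proj M H i \<phi>))"
      by (metis inner2_commute complex_mod_cnj)
    also have "\<dots> \<le> norm2 M (chaos_proj M H i e) * norm2 M (chaos_proj M H i \<phi>)" by (rule norm_inner2_le[OF PLe PL])
    also have "\<dots> \<le> (norm2 M (chaos_proj M H i \<phi>))\<^sup>2 + (norm2 M (chaos_proj M H i e))\<^sup>2"
      using sum_squares_bound[of "norm2 M (chaos_proj M H i e)" "norm2 M (chaos_proj M H i \<phi>)"]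
        mult_nonneg_nonneg[OF norm2_nonneg[of M "chaos_proj M H i e"] norm2_nonneg[of M "chaos_proj M H i \<phi>"]] by argo
    finally show ?thesis .
  qed
  have "summable (\<lambda>i. (norm2 M (chaos_proj M H i f))\<^sup>2)" if "f \<in> L2c M" for f
    using chaos_bessel[OF that] by (intro summableI_nonneg_bounded) auto
  from summable_add[OF this[OF \<phi>] this[OF eL]]
  show "summable (\<lambda>i. norm (\<integral>x. chaos_proj M H i \<phi> x * cis (h x) \<partial>M))"
    unfolding inner by (rule summable_comparison_test[rotated]) (use bound in auto)
  have part: "(\<Sum>i<N. inner2 M (chaos_proj M H i \<phi>) e) = inner2 M (chaos_sum \<phi> N) e" for N
  proof (induction N)
    case (Suc N)
    have "(\<Sum>i<Suc N. inner2 M (chaos_proj M H i \<phi>) e) = inner2 M (\<lambda>x. chaos_sum \<phi> N x + chaos_proj M H N \<phi> x) e"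
      using inner2_add_left[OF Qbar_L2c[OF chaos_sum_proj(1)[OF \<phi>]] PL eL, of N N] Suc by simp
    then show ?case by (simp add: chaos_sum_def[abs_def])
  qed (simp add: chaos_sum_def[abs_def] inner2_def)
  have "(\<lambda>N. inner2 M (chaos_sum \<phi> N) e) \<longlonglongrightarrow> inner2 M \<phi> e"
  proof (rule LIMSEQ_I)
    fix r :: real assume r: "r > 0"
    obtain p where p: "\<And>n. p n \<in> Q (Suc n)" "\<And>n x. p n (path x) = (\<Sum>k\<le>n. (\<i> * (- 1 * h x)) ^ k / fact k)"
      using taylor_Q[OF H_scale[OF h, of "-1"]] by metis
    define \<delta> where "\<delta> = r / (norm2 M \<phi> + 1)"
    have \<delta>: "\<delta> > 0" using r by (simp add: \<delta>_def add_nonneg_pos)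
    obtain n where n: "norm2 M (\<lambda>x. e x - p n (path x)) < \<delta>"
      using order_tendstoD(2)[OF cis_taylor_norm2[OF H_scale[OF h, of "-1"]] \<delta>] unfolding p(2) e_def eventually_sequentially
      by auto
    have "norm (inner2 M (chaos_sum \<phi> N) e - inner2 M \<phi> e) < r" if N: "N \<ge> Suc n" for N
    proof -
      have TL: "chaos_sum \<phi> N \<in> L2c M" by (rule Qbar_L2c[OF chaos_sum_proj(1)[OF \<phi>]])
      have dL: "(\<lambda>x. \<phi> x - chaos_sum \<phi> N x) \<in> L2c M" by (rule L2c_diff[OF \<phi> TL])
      \<comment> \<open>For large \<open>N\<close> the error of the partial sum is orthogonal to
        \<open>p n\<close>, so \<open>e\<close> may be replaced by \<open>e - p n\<close>, whose
        norm is below \<open>\<delta>\<close>.\<close>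
      have z: "inner2 M (\<lambda>x. \<phi> x - chaos_sum \<phi> N x) (\<lambda>x. p n (path x)) = 0"
        by (rule chaos_sum_proj(2)[OF \<phi> Q_Qbar[OF Q_mono[OF p(1) N]]])
      have "(norm2 M (\<lambda>x. \<phi> x - chaos_sum \<phi> N x))\<^sup>2 \<le> (norm2 M \<phi>)\<^sup>2"
        using chaos_sum_pythagoras[OF \<phi>, of N] zero_le_power2[of "norm2 M (chaos_sum \<phi> N)"] by argo
      then have le: "norm2 M (\<lambda>x. \<phi> x - chaos_sum \<phi> N x) \<le> norm2 M \<phi>"
        by (rule power2_le_imp_le) simp
      have pLn: "(\<lambda>x. p n (path x)) \<in> L2c M" by (rule Q_L2c[OF p(1)])
      have "inner2 M \<phi> e - inner2 M (chaos_sum \<phi> N) e = inner2 M (\<lambda>x. \<phi> x - chaos_sum \<phi> N x) e"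
        by (rule inner2_diff_left[OF \<phi> TL eL, symmetric])
      also have "\<dots> = cnj (inner2 M e (\<lambda>x. \<phi> x - chaos_sum \<phi> N x))" by (rule inner2_commute)
      also have "inner2 M e (\<lambda>x. \<phi> x - chaos_sum \<phi> N x) = inner2 M (\<lambda>x. e x - p n (path x)) (\<lambda>x. \<phi> x - chaos_sum \<phi> N x)"
        unfolding inner2_diff_left[OF eL pLn dL] using z inner2_commute[of M "\<lambda>x. p n (path x)" "\<lambda>x. \<phi> x - chaos_sum \<phi> N x"] by simp
      finally have E: "inner2 M \<phi> e - inner2 M (chaos_sum \<phi> N) e = cnj (inner2 M (\<lambda>x. e x - p n (path x)) (\<lambda>x. \<phi> x - chaos_sum \<phi> N x))" .
      have "norm (inner2 M (chaos_sum \<phi> N) e - inner2 M \<phi> e) = norm (inner2 M (\<lambda>x. e x - p n (path x)) (\<lambda>x. \<phi> x - chaos_sum \<phi> N x))"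
        unfolding norm_minus_commute[of "inner2 M (chaos_sum \<phi> N) e"] E by (rule complex_mod_cnj)
      also have "\<dots> \<le> norm2 M (\<lambda>x. e x - p n (path x)) * norm2 M (\<lambda>x. \<phi> x - chaos_sum \<phi> N x)"
        by (rule norm_inner2_le[OF L2c_diff[OF eL pLn] dL])
      also have "\<dots> \<le> \<delta> * norm2 M \<phi>" using n le \<delta> by (intro mult_mono) auto
      also have "\<dots> < \<delta> * (norm2 M \<phi> + 1)" using \<delta> by simp
      also have "\<dots> = r" by (simp add: \<delta>_def add_nonneg_pos less_imp_neq[symmetric])
      finally show ?thesis .
    qed
    then show "\<exists>no. \<forall>N\<ge>no. norm (inner2 M (chaos_sum \<phi> N) e - inner2 M \<phi> e) < r" by blast
  qed
  then show "(\<lambda>i. \<integral>x. chaos_proj M H i \<phi> x * cis (h x) \<partial>M) sums (\<integral>x. \<phi> x * cis (h x) \<partial>M)"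
    unfolding sums_def inner part .
qed

lemma
  assumes ab: "a\<^sup>2 + b\<^sup>2 = 1" and \<phi>: "\<phi> \<in> L2c M" and \<psi>: "\<psi> \<in> L2c M"
  shows wick_partial_Qbar: "wick_partial M H a b \<phi> \<psi> N \<in> Qbar (Suc N)"
    and wick_partial_char: "h \<in> H \<Longrightarrow> (\<integral>x. wick_partial M H a b \<phi> \<psi> N x * cis (h x) \<partial>M)
      = (\<Sum>k\<le>N. \<Sum>i\<le>k. (\<integral>x. chaos_proj M H i \<phi> x * cis (a * h x) \<partial>M) * (\<integral>x. chaos_proj M H (k - i) \<psi> x * cis (b * h x) \<partial>M))"
proof -
  define t where "t k i = chaos_proj M H k (\<lambda>y. (complex_of_real a ^ i * chaos_proj M H i \<phi> y) *
                             (complex_of_real b ^ (k - i) * chaos_proj M H (k - i) \<psi> y))" for k i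
  have wp: "wick_partial M H a b \<phi> \<psi> N = (\<lambda>x. \<Sum>k\<le>N. \<Sum>i\<le>k. t k i x)"
    by (simp add: wick_partial_def t_def)
  have ki: "i + (k - i) = k" if "i \<le> k" for i k :: nat using that by simp
  have tch: "t k i \<in> chaos M H k" if "i \<le> k" for k i
    unfolding t_def by (rule chaos_proj(1)[OF chaos_product_proj(1)[OF ab chaos_proj(1)[OF \<phi>] chaos_proj(1)[OF \<psi>] H_zero]])
  show "wick_partial M H a b \<phi> \<psi> N \<in> Qbar (Suc N)"
    unfolding wp
    by (intro closed_subspace_sum[OF closed_subspace_Qbar] Qbar_mono[OF _ chaosD(1)[OF tch]]) auto
  assume h: "h \<in> H"
  have [simp]: "integrable M (\<lambda>x. t k i x * cis (h x))" if "i \<le> k" for k i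
    using integrable_mult_L2c[OF chaosD(2)[OF tch[OF that]] cis_L2c[OF h, of 1]] by simp
  have "(\<integral>x. t k i x * cis (h x) \<partial>M)
      = (\<integral>x. chaos_proj M H i \<phi> x * cis (a * h x) \<partial>M) * (\<integral>x. chaos_proj M H (k - i) \<psi> x * cis (b * h x) \<partial>M)"
    if "i \<le> k" for k i
    using chaos_product_proj(2)[OF ab chaos_proj(1)[OF \<phi>] chaos_proj(1)[OF \<psi>] h, of i "k - i"] ki[OF that]
    by (simp add: t_def)
  then show "(\<integral>x. wick_partial M H a b \<phi> \<psi> N x * cis (h x) \<partial>M)
      = (\<Sum>k\<le>N. \<Sum>i\<le>k. (\<integral>x. chaos_proj M H i \<phi> x * cis (a * h x) \<partial>M) * (\<integral>x. chaos_proj M H (k - i) \<psi> x * cis (b * h x) \<partial>M))"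
    unfolding wp sum_distrib_right
    by (subst Bochner_Integration.integral_sum, (auto intro!: Bochner_Integration.integrable_sum)[1], intro sum.cong refl)
       (subst Bochner_Integration.integral_sum, auto intro!: sum.cong)
qed

text \<open>The Wick series becomes a Cauchy product of two absolutely convergent series.\<close>

lemma wick2_char:
  assumes ab: "a\<^sup>2 + b\<^sup>2 = 1" and \<phi>: "\<phi> \<in> L2c M" and \<psi>: "\<psi> \<in> L2c M"
    and w: "wick2_rel M H a b \<phi> \<psi> w" and h: "h \<in> H"
  shows "(\<integral>x. w x * cis (h x) \<partial>M) = (\<integral>x. \<phi> x * cis (a * h x) \<partial>M) * (\<integral>x. \<psi> x * cis (b * h x) \<partial>M)"
proof (rule LIMSEQ_unique)
  let ?W = "wick_partial M H a b \<phi> \<psi>"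
  have wL: "w \<in> L2c M" and d: "(\<lambda>N. dist2 M (?W N) w) \<longlonglongrightarrow> 0" using w by (auto simp: wick2_rel_def)
  have "(\<lambda>N. norm2 M (\<lambda>x. ?W N x - w x)) \<longlonglongrightarrow> 0"
    using tendsto_real_sqrt[OF d] by (simp add: dist2_norm2)
  then show "(\<lambda>N. \<integral>x. ?W N x * cis (h x) \<partial>M) \<longlonglongrightarrow> (\<integral>x. w x * cis (h x) \<partial>M)"
    using cis_L2c[OF h, of 1] by (intro integral_mult_tendsto Qbar_L2c[OF wick_partial_Qbar[OF ab \<phi> \<psi>]] wL) auto
  note A = chaos_series_sums[OF \<phi> H_scale[OF h, of a]] and B = chaos_series_sums[OF \<psi> H_scale[OF h, of b]]
  from Cauchy_product_sums[OF A(2) B(2)]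
  show "(\<lambda>N. \<integral>x. ?W N x * cis (h x) \<partial>M) \<longlonglongrightarrow> (\<integral>x. \<phi> x * cis (a * h x) \<partial>M) * (\<integral>x. \<psi> x * cis (b * h x) \<partial>M)"
    unfolding sums_def_le wick_partial_char[OF ab \<phi> \<psi> h] sums_unique[OF A(1), symmetric] sums_unique[OF B(1), symmetric] .
qed

section \<open>F(H) as a pullback of the product sigma-algebra\<close>

lemma path_space: "x \<in> space M \<Longrightarrow> path x \<in> space paths"
  using measurable_space[OF path_measurable] .

text \<open>The coordinates generate the product sigma-algebra and their composition with
  \<open>path\<close> gives the elements of \<open>H\<close>; hence both inclusions need checking on
  generators only.\<close>

lemma sets_FH: "sets (FH M H) = {path -` B \<inter> space M | B. B \<in> sets paths}"
proof -
  let ?V = "vimage_algebra (space M) path paths"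
  have pf: "path \<in> space M \<rightarrow> space paths" using path_space by auto
  have sV: "sets ?V = {path -` B \<inter> space M | B. B \<in> sets paths}" by (rule sets_vimage_algebra2[OF pf])
  let ?G = "\<Union>X\<in>H. {X -` B \<inter> space M | B. B \<in> sets borel}"
  have sF: "sets (FH M H) = sigma_sets (space M) ?G" unfolding FH_def by (intro sets_measure_of) auto
  have spF: "space (FH M H) = space M" unfolding FH_def by (intro space_measure_of) auto
  have "?G \<subseteq> sets ?V"
  proof
    fix A assume "A \<in> ?G"
    then obtain h B where h: "h \<in> H" and B: "B \<in> sets borel" and A: "A = h -` B \<inter> space M" by auto
    have "(\<lambda>\<xi>. \<xi> h) \<in> borel_measurable paths" using h by measurable
    then have "(\<lambda>\<xi>. \<xi> h) -` B \<inter> space paths \<in> sets paths" using B by (rule measurable_sets)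
    moreover have "A = path -` ((\<lambda>\<xi>. \<xi> h) -` B \<inter> space paths) \<inter> space M" unfolding A using h path_space by auto
    ultimately show "A \<in> sets ?V" unfolding sV by blast
  qed
  then have "sets (FH M H) \<subseteq> sets ?V"
    unfolding sF using sets.sigma_sets_subset[of ?G ?V] by simp
  moreover have "path \<in> measurable (FH M H) paths"
    unfolding path_def
  proof (rule measurable_restrict)
    fix h assume h: "h \<in> H"
    show "h \<in> borel_measurable (FH M H)"
    proof (rule measurableI)
      fix B :: "real set" assume "B \<in> sets borel"
      then show "h -` B \<inter> space (FH M H) \<in> sets (FH M H)"
        unfolding sF spF using h by (intro sigma_sets.Basic) auto
    qed simp
  qed
  then have "sets ?V \<subseteq> sets (FH M H)"
    unfolding sV using measurable_sets[of path "FH M H" paths] spF by auto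
  ultimately show ?thesis using sV by simp
qed

lemma space_FH: "space (FH M H) = space M"
  unfolding FH_def by (intro space_measure_of) auto

lemma path_measurable_FH: "path \<in> measurable (FH M H) paths"
  using path_space by (intro measurableI) (auto simp: space_FH sets_FH)

text \<open>Doob-Dynkin factorisation, clear for simple functions and then by limits. At paths not
  coming from a point of \<open>M\<close> the sequence may diverge, and \<open>lim\<close> supplies
  some measurable value there.\<close>

lemma FH_factor:
  fixes g :: "'a \<Rightarrow> complex"
  assumes "g \<in> borel_measurable (FH M H)"
  obtains G where "G \<in> borel_measurable paths" "\<And>x. x \<in> space M \<Longrightarrow> g x = G (path x)"
proof -
  have simple: "\<exists>S. S \<in> borel_measurable paths \<and> (\<forall>x\<in>space M. s x = S (path x))"
    if s: "simple_function (FH M H) s" for s :: "'a \<Rightarrow> complex"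
  proof -
    have fin: "finite (s ` space M)" using simple_functionD(1)[OF s] by (simp add: space_FH)
    have "\<exists>B\<in>sets paths. s -` {v} \<inter> space M = path -` B \<inter> space M" for v
      using simple_functionD(2)[OF s, of "{v}"] unfolding space_FH sets_FH by auto
    then obtain B where B: "\<And>v. B v \<in> sets paths" "\<And>v. s -` {v} \<inter> space M = path -` B v \<inter> space M" by metis
    define S where "S = (\<lambda>\<xi>. \<Sum>v\<in>s ` space M. indicator (B v) \<xi> *\<^sub>R v)"
    have "S \<in> borel_measurable paths" unfolding S_def using B(1) by measurable
    moreover have "s x = S (path x)" if x: "x \<in> space M" for x
    proof -
      have "indicator (B v) (path x) = (if v = s x then 1 else 0 :: real)" for v
        using B(2)[of v] x by (auto simp: indicator_def)
      then have "S (path x) = (\<Sum>v\<in>s ` space M. if v = s x then v else 0)"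
        unfolding S_def by (intro sum.cong) auto
      also have "\<dots> = s x" using fin x by (simp add: sum.delta)
      finally show ?thesis by simp
    qed
    ultimately show ?thesis by blast
  qed
  obtain s where s: "\<And>i. simple_function (FH M H) (s i)" "\<And>x. x \<in> space (FH M H) \<Longrightarrow> (\<lambda>i. s i x) \<longlonglongrightarrow> g x"
    using borel_measurable_implies_sequence_metric[OF assms, of 0] by blast
  obtain S where S: "\<And>i. S i \<in> borel_measurable paths" "\<And>i x. x \<in> space M \<Longrightarrow> s i x = S i (path x)"
    using simple[OF s(1)] by metis
  show ?thesis
  proof (rule that)
    show "(\<lambda>\<xi>. lim (\<lambda>i. S i \<xi>)) \<in> borel_measurable paths" using S(1) by measurable
    fix x assume x: "x \<in> space M"
    have "(\<lambda>i. S i (path x)) \<longlonglongrightarrow> g x" using s(2)[of x] x S(2)[OF x] by (simp add: space_FH)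
    then show "g x = lim (\<lambda>i. S i (path x))" by (rule limI[symmetric])
  qed
qed

text \<open>Up to null sets this is measurability for \<open>FH M H\<close>, in a form that hands
  over the function on paths needed by \<open>wk\<close>.\<close>

definition adapted :: "('a \<Rightarrow> complex) \<Rightarrow> bool" where
  "adapted f \<longleftrightarrow> (\<exists>F \<in> borel_measurable paths. AE x in M. f x = F (path x))"

lemma adapted_comp: "F \<in> borel_measurable paths \<Longrightarrow> adapted (\<lambda>x. F (path x))"
  unfolding adapted_def by auto

lemma adapted_diff: assumes "adapted f" "adapted g" shows "adapted (\<lambda>x. f x - g x)"
proof -
  obtain F G where [measurable]: "F \<in> borel_measurable paths" "G \<in> borel_measurable paths"
    and "AE x in M. f x = F (path x)" "AE x in M. g x = G (path x)" using assms unfolding adapted_def by blast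
  then show ?thesis unfolding adapted_def by (intro bexI[of _ "\<lambda>\<xi>. F \<xi> - G \<xi>"]) auto
qed

text \<open>L1 convergence gives almost everywhere convergence along a subsequence, and the
  pointwise limit of the path functions represents \<open>g\<close>.\<close>

lemma adapted_limit:
  assumes f: "\<And>n. integrable M (f n)" "\<And>n. adapted (f n)" "integrable M g"
    and lim: "(\<lambda>n. \<integral>x. cmod (f n x - g x) \<partial>M) \<longlonglongrightarrow> 0"
  shows "adapted g"
proof -
  obtain F where F [measurable]: "\<And>n. F n \<in> borel_measurable paths" and FA: "\<And>n. AE x in M. f n x = F n (path x)"
    using f(2) unfolding adapted_def by metis
  have "\<exists>r. strict_mono r \<and> (AE x in M. (\<lambda>n. f (r n) x - g x) \<longlonglongrightarrow> 0)"
    using f lim by (intro tendsto_L1_AE_subseq) auto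
  then obtain r where r: "AE x in M. (\<lambda>n. f (r n) x - g x) \<longlonglongrightarrow> 0" by auto
  have FA': "AE x in M. \<forall>n. f n x = F n (path x)" using FA by (simp add: AE_all_countable)
  have "AE x in M. g x = lim (\<lambda>n. F (r n) (path x))"
  proof (rule AE_mp[OF r], rule AE_mp[OF FA'], intro AE_I2 impI)
    fix x assume a: "\<forall>n. f n x = F n (path x)" and l: "(\<lambda>n. f (r n) x - g x) \<longlonglongrightarrow> 0"
    have "(\<lambda>n. f (r n) x) \<longlonglongrightarrow> g x" using l by (rule LIM_zero_cancel)
    then have "(\<lambda>n. F (r n) (path x)) \<longlonglongrightarrow> g x" by (simp only: spec[OF a])
    then show "g x = lim (\<lambda>n. F (r n) (path x))" by (rule limI[symmetric])
  qed
  moreover have "(\<lambda>\<xi>. lim (\<lambda>n. F (r n) \<xi>)) \<in> borel_measurable paths" by measurable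
  ultimately show ?thesis unfolding adapted_def by (intro bexI) auto
qed

lemma adapted_L2_limit:
  assumes f: "\<And>n. f n \<in> L2c M" "\<And>n. adapted (f n)" "g \<in> L2c M"
    and lim: "(\<lambda>n. norm2 M (\<lambda>x. f n x - g x)) \<longlonglongrightarrow> 0"
  shows "adapted g"
proof (rule adapted_limit[OF L2c_integrable[OF f(1)] f(2) L2c_integrable[OF f(3)]])
  show "(\<lambda>n. \<integral>x. cmod (f n x - g x) \<partial>M) \<longlonglongrightarrow> 0"
    by (rule Lim_null_comparison[OF _ lim]) (use norm1_le_norm2[OF L2c_diff[OF f(1,3)]] in auto)
qed

lemma adapted_Qbar: assumes "f \<in> Qbar n" shows "adapted f"
proof -
  obtain p where p: "\<And>m. p m \<in> Q n" "(\<lambda>m. norm2 M (\<lambda>x. p m (path x) - f x)) \<longlonglongrightarrow> 0"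
    by (rule Qbar_seq[OF assms]) (rule that)
  show ?thesis
    by (rule adapted_L2_limit[OF Q_L2c[OF p(1)] adapted_comp[OF Q_measurable[OF p(1)]] Qbar_L2c[OF assms] p(2)])
qed

text \<open>The positive and negative parts of \<open>F\<close> are densities of two finite measures
  with the same Fourier data, hence the same path law. Where \<open>F > 0\<close> the second density
  vanishes, so the first must be null there too. The other sign follows by applying this to
  \<open>- F\<close>.\<close>

lemma real_fourier_unique:
  fixes F :: "(('a \<Rightarrow> real) \<Rightarrow> real) \<Rightarrow> real"
  assumes [measurable]: "F \<in> borel_measurable paths" and i: "integrable M (\<lambda>x. F (path x))"
    and z: "\<And>h. h \<in> H \<Longrightarrow> (\<integral>x. of_real (F (path x)) * cis (h x) \<partial>M) = 0"
  shows "AE x in M. F (path x) \<le> 0"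
proof -
  define u where "u x = max 0 (F (path x))" for x
  define v where "v x = max 0 (- F (path x))" for x
  have [measurable]: "u \<in> borel_measurable M" "v \<in> borel_measurable M" unfolding u_def v_def by measurable
  have ui: "integrable M u" "integrable M v"
    by (rule Bochner_Integration.integrable_bound[OF i]; auto simp: u_def v_def)+
  have uv: "u x \<ge> 0" "v x \<ge> 0" "F (path x) = u x - v x" for x by (auto simp: u_def v_def)
  have fin: "finite_measure (density M f)" if "integrable M f" "\<And>x. f x \<ge> 0" for f :: "'a \<Rightarrow> real"
    using that by (intro finite_measureI) (simp add: emeasure_density nn_integral_eq_integral)
  define P where "P = (\<lambda>h. (h, h)) ` H"
  interpret U: finite_measure "density M u" by (rule fin[OF ui(1) uv(1)])
  interpret V: finite_measure "density M v" by (rule fin[OF ui(2) uv(2)])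
  interpret char_matched "density M u" "density M v" P
  proof
    fix f g assume fg: "(f, g) \<in> P"
    then have fH: "f \<in> H" and fg': "g = f" by (auto simp: P_def)
    then have [measurable]: "f \<in> borel_measurable M" using H_meas by auto
    show "f \<in> borel_measurable (density M u) \<and> g \<in> borel_measurable (density M v)" unfolding fg' by simp
    show "((\<lambda>x. c * f x), (\<lambda>x. c * g x)) \<in> P" for c using H_scale[OF fH, of c] unfolding fg' P_def by auto
    have ci: "integrable M (\<lambda>x. w x *\<^sub>R cis (f x))" if "integrable M w" for w :: "'a \<Rightarrow> real"
      by (rule Bochner_Integration.integrable_bound[OF that]) (use that in auto)
    have "(\<integral>x. u x *\<^sub>R cis (f x) \<partial>M) - (\<integral>x. v x *\<^sub>R cis (f x) \<partial>M) = (\<integral>x. of_real (F (path x)) * cis (f x) \<partial>M)"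
      using ci[OF ui(1)] ci[OF ui(2)]
      by (simp add: uv(3) scaleR_conv_of_real left_diff_distrib flip: Bochner_Integration.integral_diff)
    then have "(\<integral>x. u x *\<^sub>R cis (f x) \<partial>M) = (\<integral>x. v x *\<^sub>R cis (f x) \<partial>M)" using z[OF fH] by simp
    then show "(\<integral>x. cis (f x) \<partial>density M u) = (\<integral>x. cis (g x) \<partial>density M v)"
      unfolding fg' using uv by (subst (1 2) integral_density) auto
    fix f' g' assume fg2: "(f', g') \<in> P"
    then have "f' \<in> H" "g' = f'" by (auto simp: P_def)
    then show "((\<lambda>x. f x + f' x), (\<lambda>x. g x + g' x)) \<in> P" using H_add[OF fH, of f'] unfolding fg' P_def by auto
  qed
  have eq: "distr (density M u) paths path = distr (density M v) paths path"
    using distr_PiM_eq[of H "\<lambda>h. h" "\<lambda>h. h"] H_zero unfolding path_def[abs_def, symmetric] by (auto simp: P_def)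
  define B where "B = {\<xi> \<in> space paths. F \<xi> > 0}"
  have [measurable]: "B \<in> sets paths" unfolding B_def by measurable
  have Bu: "indicator B (path x) = (if F (path x) > 0 then 1 else 0 :: ennreal)" if "x \<in> space M" for x
    using path_space[OF that] by (auto simp: B_def indicator_def)
  have eB: "emeasure (distr (density M f) paths path) B = (\<integral>\<^sup>+x. ennreal (f x) * indicator B (path x) \<partial>M)"
    if [measurable]: "f \<in> borel_measurable M" for f :: "'a \<Rightarrow> real"
    by (subst emeasure_distr, simp, simp, subst emeasure_density, simp, simp)
       (auto intro!: nn_integral_cong simp: indicator_def)
  have "(\<integral>\<^sup>+x. ennreal (u x) * indicator B (path x) \<partial>M) = (\<integral>\<^sup>+x. ennreal (v x) * indicator B (path x) \<partial>M)"
    using eB[of u] eB[of v] eq by simp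
  also have "\<dots> = (\<integral>\<^sup>+x. 0 \<partial>M)"
    by (intro nn_integral_cong) (auto simp: Bu v_def ennreal_neg)
  finally have "(\<integral>\<^sup>+x. ennreal (u x) * indicator B (path x) \<partial>M) = 0" by simp
  then have "AE x in M. ennreal (u x) * indicator B (path x) = 0"
    by (subst (asm) nn_integral_0_iff_AE) auto
  then show ?thesis
  proof (rule AE_mp, intro AE_I2 impI)
    fix x assume "x \<in> space M" "ennreal (u x) * indicator B (path x) = 0"
    then show "F (path x) \<le> 0" using Bu[of x] by (auto simp: u_def split: if_splits)
  qed
qed

text \<open>The real case applies to \<open>Re (c * F)\<close> for \<open>c\<close> equal to 1, -1,
  \<i> and -\<i>, since the conjugate of \<open>F\<close> also has vanishing Fourier integrals:
  conjugation only replaces \<open>h\<close> by \<open>- h\<close>.\<close>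

lemma fourier_unique:
  assumes f: "integrable M f" and ad: "adapted f" and z: "\<And>h. h \<in> H \<Longrightarrow> (\<integral>x. f x * cis (h x) \<partial>M) = 0"
  shows "AE x in M. f x = 0"
proof -
  obtain F where F [measurable]: "F \<in> borel_measurable paths" and FA: "AE x in M. f x = F (path x)"
    using ad unfolding adapted_def by auto
  have [measurable]: "f \<in> borel_measurable M" using f by auto
  have Fi: "integrable M (\<lambda>x. F (path x))" using f FA by (subst integrable_cong_AE[where g=f]) auto
  have Fz: "(\<integral>x. F (path x) * cis (h x) \<partial>M) = 0" if h: "h \<in> H" for h
  proof -
    have [measurable]: "h \<in> borel_measurable M" using h H_meas by auto
    have "(\<integral>x. F (path x) * cis (h x) \<partial>M) = (\<integral>x. f x * cis (h x) \<partial>M)"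
      using FA by (intro integral_cong_AE) auto
    then show ?thesis using z[OF h] by simp
  qed
  have Fcz: "(\<integral>x. cnj (F (path x)) * cis (h x) \<partial>M) = 0" if h: "h \<in> H" for h
  proof -
    have "(\<integral>x. cnj (F (path x)) * cis (h x) \<partial>M) = (\<integral>x. cnj (F (path x) * cis (-1 * h x)) \<partial>M)"
      by (simp add: cis_cnj)
    also have "\<dots> = cnj (\<integral>x. F (path x) * cis (-1 * h x) \<partial>M)" by (rule Bochner_Integration.integral_cnj)
    finally show ?thesis using Fz[OF H_scale[OF h, of "-1"]] by simp
  qed
  have Fci: "integrable M (\<lambda>x. cnj (F (path x)))" using Fi by simp
  have main: "AE x in M. Re (c * F (path x)) \<le> 0" for c
  proof (rule real_fourier_unique[where F="\<lambda>\<xi>. Re (c * F \<xi>)"])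
    show "integrable M (\<lambda>x. Re (c * F (path x)))" using Fi by (intro integrable_Re integrable_mult_right)
    fix h assume h: "h \<in> H"
    have re: "complex_of_real (Re (c * w)) = (c * w + cnj c * cnj w) / 2" for w
      using complex_add_cnj[of "c * w"] by simp
    have "(\<integral>x. complex_of_real (Re (c * F (path x))) * cis (h x) \<partial>M)
       = (\<integral>x. (c / 2) * (F (path x) * cis (h x)) + (cnj c / 2) * (cnj (F (path x)) * cis (h x)) \<partial>M)"
      unfolding re by (intro Bochner_Integration.integral_cong) (auto simp: field_simps)
    also have "\<dots> = 0" using integrable_mult_cis[OF Fi H_meas[OF h]] integrable_mult_cis[OF Fci H_meas[OF h]] Fz[OF h] Fcz[OF h] by simp
    finally show "(\<integral>x. complex_of_real (Re (c * F (path x))) * cis (h x) \<partial>M) = 0" .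
  qed measurable
  show ?thesis
    using FA main[of 1] main[of "-1"] main[of \<i>] main[of "-\<i>"]
    by eventually_elim (simp add: complex_eq_iff)
qed

end

section \<open>The extension to integrable functions\<close>

context gaussian_space
begin

text \<open>The partial sums are Cauchy because their squared distances to \<open>f\<close>
  decrease. Their limit \<open>g\<close> differs from \<open>f\<close> by a function orthogonal to
  all polynomials, hence to all exponentials, and adaptedness lets \<open>fourier_unique\<close>
  conclude that it is null.\<close>

lemma chaos_sum_tendsto:
  assumes f: "f \<in> L2c M" and ad: "adapted f"
  shows "(\<lambda>N. norm2 M (\<lambda>x. chaos_sum f N x - f x)) \<longlonglongrightarrow> 0"
proof -
  let ?T = "chaos_sum f"
  note TQ = chaos_sum_proj(1)[OF f] and TL = Qbar_L2c[OF chaos_sum_proj(1)[OF f]]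
  define d where "d N = (norm2 M (\<lambda>x. f x - ?T N x))\<^sup>2" for N
  have key: "(norm2 M (\<lambda>x. ?T m x - ?T n x))\<^sup>2 = d n - d m" if "n \<le> m" for m n
  proof -
    have D: "(\<lambda>x. ?T m x - ?T n x) \<in> Qbar m"
      by (rule closed_subspace_diff[OF closed_subspace_Qbar TQ Qbar_mono[OF that TQ]])
    have "d n = (norm2 M (\<lambda>x. (f x - ?T m x) + (?T m x - ?T n x)))\<^sup>2" by (simp add: d_def)
    also have "\<dots> = d m + (norm2 M (\<lambda>x. ?T m x - ?T n x))\<^sup>2 + 2 * Re (inner2 M (\<lambda>x. f x - ?T m x) (\<lambda>x. ?T m x - ?T n x))"
      unfolding d_def by (rule norm2_add_sq[OF L2c_diff[OF f TL] L2c_diff[OF TL TL]])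
    also have "inner2 M (\<lambda>x. f x - ?T m x) (\<lambda>x. ?T m x - ?T n x) = 0" by (rule chaos_sum_proj(2)[OF f D])
    finally show ?thesis by simp
  qed
  have "decseq d"
    unfolding decseq_def
  proof (intro allI impI)
    fix m n :: nat assume "m \<le> n"
    from key[OF this] zero_le_power2[of "norm2 M (\<lambda>x. ?T n x - ?T m x)"] show "d n \<le> d m" by argo
  qed
  then obtain L where L: "d \<longlonglongrightarrow> L" "\<forall>i. L \<le> d i"
    by (rule decseq_convergent[of d 0]) (auto simp: d_def)
  obtain g where g: "g \<in> L2c M" "(\<lambda>N. norm2 M (\<lambda>x. ?T N x - g x)) \<longlonglongrightarrow> 0"
  proof (rule L2c_complete[OF TL])
    fix e :: real assume e: "e > 0"
    then have "e\<^sup>2 > 0" by simp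
    then obtain N where N: "\<And>n. n \<ge> N \<Longrightarrow> d n < L + e\<^sup>2"
      using order_tendstoD(2)[OF L(1), of "L + e\<^sup>2"] by (auto simp: eventually_sequentially)
    have 1: "norm2 M (\<lambda>x. ?T m x - ?T n x) < e" if "n \<ge> N" "n \<le> m" for m n
    proof (rule power2_less_imp_less)
      show "(norm2 M (\<lambda>x. ?T m x - ?T n x))\<^sup>2 < e\<^sup>2"
        unfolding key[OF that(2)] using N[OF that(1)] L(2)[rule_format, of m] by argo
    qed (use e in simp)
    have "norm2 M (\<lambda>x. ?T m x - ?T n x) < e" if "m \<ge> N" "n \<ge> N" for m n
      using 1[of n m] 1[of m n] that norm2_minus_commute[of M "?T m" "?T n"] by (cases "n \<le> m") auto
    then show "\<exists>N. \<forall>m\<ge>N. \<forall>n\<ge>N. norm2 M (\<lambda>x. ?T m x - ?T n x) < e" by blast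
  qed blast
  have fgL: "(\<lambda>x. f x - g x) \<in> L2c M" by (rule L2c_diff[OF f g(1)])
  have orth: "inner2 M (\<lambda>x. f x - g x) (\<lambda>x. p (path x)) = 0" if p: "p \<in> Q n" for n p
  proof -
    note pL = Q_L2c[OF p]
    have 1: "(\<lambda>N. inner2 M (?T N) (\<lambda>x. p (path x))) \<longlonglongrightarrow> inner2 M g (\<lambda>x. p (path x))"
      by (rule inner2_tendsto[OF TL g(1) pL g(2)])
    have "inner2 M (?T N) (\<lambda>x. p (path x)) = inner2 M f (\<lambda>x. p (path x))" if "N \<ge> n" for N
      using chaos_sum_proj(2)[OF f Q_Qbar[OF Q_mono[OF p that]]] by (simp add: inner2_diff_left[OF f TL pL])
    then have "(\<lambda>N. inner2 M (?T N) (\<lambda>x. p (path x))) \<longlonglongrightarrow> inner2 M f (\<lambda>x. p (path x))"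
      by (intro tendsto_eventually eventually_sequentiallyI) 
    with 1 have "inner2 M g (\<lambda>x. p (path x)) = inner2 M f (\<lambda>x. p (path x))" by (rule LIMSEQ_unique)
    then show ?thesis by (simp add: inner2_diff_left[OF f g(1) pL])
  qed
  have "adapted g" by (rule adapted_L2_limit[OF TL adapted_Qbar[OF TQ] g])
  then have "AE x in M. f x - g x = 0"
    by (intro fourier_unique[OF L2c_integrable[OF fgL] adapted_diff[OF ad]] cis_orth_0[OF fgL _ orth])
  then have AE: "AE x in M. ?T N x - g x = ?T N x - f x" for N by eventually_elim simp
  have "norm2 M (\<lambda>x. ?T N x - g x) = norm2 M (\<lambda>x. ?T N x - f x)" for N
    by (rule norm2_cong_AE[OF AE L2cD(1)[OF L2c_diff[OF TL g(1)]] L2cD(1)[OF L2c_diff[OF TL f]]])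
  with g(2) show ?thesis by simp
qed

lemma poly_dense_L2:
  assumes f: "f \<in> L2c M" and ad: "adapted f" and e: "e > 0"
  shows "\<exists>n. \<exists>p\<in>Q (Suc n). norm2 M (\<lambda>x. p (path x) - f x) < e"
proof -
  obtain N where N: "norm2 M (\<lambda>x. chaos_sum f N x - f x) < e / 2"
    using order_tendstoD(2)[OF chaos_sum_tendsto[OF f ad], of "e / 2"] e by (auto simp: eventually_sequentially)
  note TQ = chaos_sum_proj(1)[OF f, of N]
  obtain p where p: "p \<in> Q N" "norm2 M (\<lambda>x. chaos_sum f N x - p (path x)) < e / 2"
    using TQ e unfolding Qbar_def by (auto dest: spec[of _ "e / 2"])
  have "norm2 M (\<lambda>x. p (path x) - f x) < e"
    using norm2_triangle_diff[OF Q_L2c[OF p(1)] Qbar_L2c[OF TQ] f] N p(2)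
      norm2_minus_commute[of M "\<lambda>x. p (path x)" "chaos_sum f N"] by argo
  then show ?thesis using Q_mono[OF p(1), of "Suc N"] by auto
qed

text \<open>Truncating the path function rather than \<open>f\<close> keeps the result adapted;
  being bounded, it lies in L2, where polynomials are already dense, and the L1 norm is below the L2
  norm.\<close>

lemma poly_dense_L1:
  assumes f: "integrable M f" and ad: "adapted f" and e: "e > 0"
  shows "\<exists>n. \<exists>p\<in>Q (Suc n). (\<integral>x. cmod (p (path x) - f x) \<partial>M) < e"
proof -
  obtain F where F [measurable]: "F \<in> borel_measurable paths" and FA: "AE x in M. f x = F (path x)"
    using ad unfolding adapted_def by auto
  have [measurable]: "f \<in> borel_measurable M" using f by auto
  define Fk where "Fk k \<xi> = (if cmod (F \<xi>) \<le> real k then F \<xi> else 0)" for k :: nat and \<xi>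
  have Fk [measurable]: "Fk k \<in> borel_measurable paths" for k unfolding Fk_def[abs_def] by measurable
  have "(\<lambda>k. \<integral>x. cmod (Fk k (path x) - f x) \<partial>M) \<longlonglongrightarrow> (\<integral>x. 0 \<partial>M)"
  proof (rule integral_dominated_convergence[where w="\<lambda>x. cmod (f x)"])
    show "AE x in M. (\<lambda>k. cmod (Fk k (path x) - f x)) \<longlonglongrightarrow> 0"
    proof (rule AE_mp[OF FA], intro AE_I2 impI)
      fix x assume "f x = F (path x)"
      then have "cmod (Fk k (path x) - f x) = 0" if "k \<ge> nat \<lceil>cmod (F (path x))\<rceil>" for k
        using that by (auto simp: Fk_def nat_le_iff ceiling_le_iff)
      then show "(\<lambda>k. cmod (Fk k (path x) - f x)) \<longlonglongrightarrow> 0"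
        by (intro tendsto_eventually eventually_sequentiallyI)
    qed
    show "AE x in M. norm (cmod (Fk k (path x) - f x)) \<le> cmod (f x)" for k
      by (rule AE_mp[OF FA], intro AE_I2 impI) (auto simp: Fk_def)
  qed (use f in auto)
  then have "(\<lambda>k. \<integral>x. cmod (Fk k (path x) - f x) \<partial>M) \<longlonglongrightarrow> 0" by simp
  from order_tendstoD(2)[OF this, of "e / 2"] e obtain k where k: "(\<integral>x. cmod (Fk k (path x) - f x) \<partial>M) < e / 2"
    by (auto simp: eventually_sequentially)
  have FL: "(\<lambda>x. Fk k (path x)) \<in> L2c M"
    by (rule L2c_bounded[of _ "real k"]) (auto simp: Fk_def[of k])
  obtain n p where p: "p \<in> Q (Suc n)" "norm2 M (\<lambda>x. p (path x) - Fk k (path x)) < e / 2"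
    using poly_dense_L2[OF FL adapted_comp[OF Fk], of "e / 2"] e by auto
  have 1: "(\<integral>x. cmod (p (path x) - Fk k (path x)) \<partial>M) < e / 2"
    using norm1_le_norm2[OF L2c_diff[OF Q_L2c[OF p(1)] FL]] p(2) by simp
  have i: "integrable M (\<lambda>x. p (path x))" "integrable M (\<lambda>x. Fk k (path x))"
    using L2c_integrable[OF Q_L2c[OF p(1)]] L2c_integrable[OF FL] by auto
  have "(\<integral>x. cmod (p (path x) - f x) \<partial>M) \<le> (\<integral>x. cmod (p (path x) - Fk k (path x)) + cmod (Fk k (path x) - f x) \<partial>M)"
    using i f by (intro integral_mono norm_diff_triangle_le[OF order_refl order_refl]) auto
  also have "\<dots> = (\<integral>x. cmod (p (path x) - Fk k (path x)) \<partial>M) + (\<integral>x. cmod (Fk k (path x) - f x) \<partial>M)"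
    using i f by (intro Bochner_Integration.integral_add) auto
  finally show ?thesis using 1 k p(1) by (intro exI[of _ n] bexI[of _ p]) auto
qed

text \<open>The last claim is what allows inner integrals to be added. For integrable functions it
  holds only almost everywhere, in contrast to \<open>wk_poly\<close>.\<close>

lemma wk_L1:
  assumes ab: "a\<^sup>2 + b\<^sup>2 = 1" and m [measurable]: "F \<in> borel_measurable paths" "G \<in> borel_measurable paths"
    and i: "integrable M (\<lambda>x. F (path x))" "integrable M (\<lambda>x. G (path x))"
  shows "integrable M (\<lambda>x. wk a b F G (path x))"
    "(\<integral>x. cmod (wk a b F G (path x)) \<partial>M) \<le> (\<integral>x. cmod (F (path x)) \<partial>M) * (\<integral>x. cmod (G (path x)) \<partial>M)"
    "AE x in M. integrable M (\<lambda>y. F (mix a b (path x) (path y)) * G (mix b (-a) (path x) (path y)))"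
proof -
  interpret MM: pair_prob_space M M ..
  have le: "(\<integral>\<^sup>+x. ennreal (cmod (wk a b F G (path x))) \<partial>M) \<le> ennreal ((\<integral>x. cmod (F (path x)) \<partial>M) * (\<integral>x. cmod (G (path x)) \<partial>M))"
    using wk_nn_norm_le[OF ab m] i by (simp add: nn_integral_eq_integral ennreal_mult)
  show wi: "integrable M (\<lambda>x. wk a b F G (path x))"
    by (intro integrableI_bounded) (auto intro: le_less_trans[OF le])
  show "(\<integral>x. cmod (wk a b F G (path x)) \<partial>M) \<le> (\<integral>x. cmod (F (path x)) \<partial>M) * (\<integral>x. cmod (G (path x)) \<partial>M)"
    using le wi by (simp add: nn_integral_eq_integral)
  have "integrable (M \<Otimes>\<^sub>M M) (\<lambda>(x, y). F (mix a b (path x) (path y)) * G (mix b (-a) (path x) (path y)))"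
    using integrable_rotate[OF ab, of "\<lambda>(\<xi>, \<eta>). F \<xi> * G \<eta>"] integral_pair_mult(1)[OF i] by simp
  from MM.AE_integrable_fst[OF this]
  show "AE x in M. integrable M (\<lambda>y. F (mix a b (path x) (path y)) * G (mix b (-a) (path x) (path y)))" .
qed

lemma wk_L1_diff_le:
  assumes ab: "a\<^sup>2 + b\<^sup>2 = 1"
    and m [measurable]: "F \<in> borel_measurable paths" "G \<in> borel_measurable paths" "F' \<in> borel_measurable paths" "G' \<in> borel_measurable paths"
    and i: "integrable M (\<lambda>x. F (path x))" "integrable M (\<lambda>x. G (path x))" "integrable M (\<lambda>x. F' (path x))" "integrable M (\<lambda>x. G' (path x))"
  shows "(\<integral>x. cmod (wk a b F G (path x) - wk a b F' G' (path x)) \<partial>M)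
     \<le> (\<integral>x. cmod (F (path x) - F' (path x)) \<partial>M) * (\<integral>x. cmod (G (path x)) \<partial>M)
       + (\<integral>x. cmod (F' (path x)) \<partial>M) * (\<integral>x. cmod (G (path x) - G' (path x)) \<partial>M)"
proof -
  define A where "A = (\<lambda>\<xi>. F \<xi> - F' \<xi>)"
  define B where "B = (\<lambda>\<xi>. G \<xi> - G' \<xi>)"
  have [measurable]: "A \<in> borel_measurable paths" "B \<in> borel_measurable paths" unfolding A_def B_def by measurable
  have AB: "integrable M (\<lambda>x. A (path x))" "integrable M (\<lambda>x. B (path x))" unfolding A_def B_def using i by auto
  note w = wk_L1[OF ab, of F G] wk_L1[OF ab, of F' G'] wk_L1[OF ab, of A G] wk_L1[OF ab, of F' B]
  \<comment> \<open>Telescope \<open>F G - F' G' = (F - F') G + F' (G - G')\<close> under the inner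
    integral; the products \<open>F G\<close>, \<open>F' G\<close> and \<open>F' G'\<close> are
    integrable for almost every \<open>x\<close>.\<close>
  have "AE x in M. wk a b F G (path x) - wk a b F' G' (path x) = wk a b A G (path x) + wk a b F' B (path x)"
    using wk_L1(3)[OF ab m(1,2) i(1,2)] wk_L1(3)[OF ab m(3,2) i(3,2)] wk_L1(3)[OF ab m(3,4) i(3,4)]
  proof eventually_elim
    case (elim x)
    then show ?case
      unfolding wk_def A_def B_def left_diff_distrib right_diff_distrib by simp
  qed
  then have "(\<integral>x. cmod (wk a b F G (path x) - wk a b F' G' (path x)) \<partial>M) = (\<integral>x. cmod (wk a b A G (path x) + wk a b F' B (path x)) \<partial>M)"
    by (intro integral_cong_AE) auto
  also have "\<dots> \<le> (\<integral>x. cmod (wk a b A G (path x)) + cmod (wk a b F' B (path x)) \<partial>M)"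
    using w(7,10) AB i by (intro integral_mono norm_triangle_ineq) auto
  also have "\<dots> = (\<integral>x. cmod (wk a b A G (path x)) \<partial>M) + (\<integral>x. cmod (wk a b F' B (path x)) \<partial>M)"
    using w(7,10) AB i by (intro Bochner_Integration.integral_add) auto
  also have "\<dots> \<le> (\<integral>x. cmod (A (path x)) \<partial>M) * (\<integral>x. cmod (G (path x)) \<partial>M)
       + (\<integral>x. cmod (F' (path x)) \<partial>M) * (\<integral>x. cmod (B (path x)) \<partial>M)"
    using w(8,11) AB i by (intro add_mono) auto
  finally show ?thesis by (simp add: A_def B_def)
qed

text \<open>Stated for merely integrable functions, so that it closes both the L2 case and the
  extension.\<close>

lemma char_imp_eq_wk:
  assumes ab: "a\<^sup>2 + b\<^sup>2 = 1" and w: "integrable M w" "adapted w"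
    and m [measurable]: "F \<in> borel_measurable paths" "G \<in> borel_measurable paths" "\<phi> \<in> borel_measurable M" "\<psi> \<in> borel_measurable M"
    and i: "integrable M \<phi>" "integrable M \<psi>"
    and AE: "AE x in M. \<phi> x = F (path x)" "AE x in M. \<psi> x = G (path x)"
    and char: "\<And>h. h \<in> H \<Longrightarrow> (\<integral>x. w x * cis (h x) \<partial>M) = (\<integral>x. \<phi> x * cis (a * h x) \<partial>M) * (\<integral>x. \<psi> x * cis (b * h x) \<partial>M)"
  shows "AE x in M. w x = wk a b F G (path x)"
proof -
  have Fi: "integrable M (\<lambda>x. F (path x))" using i(1) AE(1) by (subst integrable_cong_AE[where g=\<phi>]) auto
  have Gi: "integrable M (\<lambda>x. G (path x))" using i(2) AE(2) by (subst integrable_cong_AE[where g=\<psi>]) auto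
  note wki = wk_L1(1)[OF ab m(1,2) Fi Gi]
  have "AE x in M. w x - wk a b F G (path x) = 0"
  proof (rule fourier_unique[OF Bochner_Integration.integrable_diff[OF w(1) wki] adapted_diff[OF w(2) adapted_comp[OF wk_measurable[OF m(1,2)]]]])
    fix h assume h: "h \<in> H"
    have [measurable]: "h \<in> borel_measurable M" "w \<in> borel_measurable M" using h H_meas w by auto
    have "(\<integral>x. F (path x) * cis (a * h x) \<partial>M) = (\<integral>x. \<phi> x * cis (a * h x) \<partial>M)"
      using AE(1) by (intro integral_cong_AE) auto
    moreover have "(\<integral>x. G (path x) * cis (b * h x) \<partial>M) = (\<integral>x. \<psi> x * cis (b * h x) \<partial>M)"
      using AE(2) by (intro integral_cong_AE) auto
    ultimately show "(\<integral>x. (w x - wk a b F G (path x)) * cis (h x) \<partial>M) = 0"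
      using integrable_mult_cis[OF w(1) H_meas[OF h]] integrable_mult_cis[OF wki H_meas[OF h]] char[OF h] integral_wk_cis[OF ab h m(1,2) Fi Gi] by (simp add: left_diff_distrib)
  qed
  then show ?thesis by eventually_elim simp
qed

lemma wick2_eq_wk:
  assumes ab: "a\<^sup>2 + b\<^sup>2 = 1" and \<phi>: "\<phi> \<in> L2c M" and \<psi>: "\<psi> \<in> L2c M"
    and w: "wick2_rel M H a b \<phi> \<psi> w"
    and m: "F \<in> borel_measurable paths" "G \<in> borel_measurable paths"
    and AE: "AE x in M. \<phi> x = F (path x)" "AE x in M. \<psi> x = G (path x)"
  shows "AE x in M. w x = wk a b F G (path x)"
proof -
  have wL: "w \<in> L2c M" and d: "(\<lambda>N. dist2 M (wick_partial M H a b \<phi> \<psi> N) w) \<longlonglongrightarrow> 0" using w by (auto simp: wick2_rel_def)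
  have "(\<lambda>N. norm2 M (\<lambda>x. wick_partial M H a b \<phi> \<psi> N x - w x)) \<longlonglongrightarrow> 0"
    using tendsto_real_sqrt[OF d] by (simp add: dist2_norm2)
  \<comment> \<open>Adaptedness is not part of \<open>wick2_rel\<close>; \<open>w\<close> inherits
    it from the partial sums, which lie in closures of polynomials.\<close>
  then have "adapted w"
    by (rule adapted_L2_limit[OF Qbar_L2c[OF wick_partial_Qbar[OF ab \<phi> \<psi>]] adapted_Qbar[OF wick_partial_Qbar[OF ab \<phi> \<psi>]] wL])
  then show ?thesis
    by (rule char_imp_eq_wk[OF ab L2c_integrable[OF wL] _ m L2cD(1)[OF \<phi>] L2cD(1)[OF \<psi>] L2c_integrable[OF \<phi>] L2c_integrable[OF \<psi>] AE
          wick2_char[OF ab \<phi> \<psi> w]])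
qed

section \<open>Wick products of polynomials\<close>

lemma chaos_proj_high:
  assumes "p \<in> Q i"
  shows "AE x in M. chaos_proj M H i (\<lambda>x. p (path x)) x = 0"
proof (rule chaos_proj_unique[OF Q_L2c[OF assms] closed_subspaceD(2)[OF closed_subspace_chaos]])
  fix h assume "h \<in> chaos M H i"
  from chaosD(3)[OF this Q_Qbar[OF assms]] show "inner2 M (\<lambda>x. p (path x) - 0) h = 0"
    using inner2_commute[of M _ h] by simp
qed

lemma AE_0_L2c:
  assumes [measurable]: "f \<in> borel_measurable M" and AE: "AE x in M. f x = 0"
  shows "f \<in> L2c M"
proof -
  have "integrable M (\<lambda>x. (cmod (f x))\<^sup>2) \<longleftrightarrow> integrable M (\<lambda>x. 0 :: real)"
    using AE by (intro integrable_cong_AE) auto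
  then show ?thesis by (simp add: L2c_def)
qed

text \<open>\<open>chaos_proj\<close> picks a representative by choice, so even for a null function
  its value is known only almost everywhere.\<close>

lemma chaos_proj_null:
  assumes f [measurable]: "f \<in> borel_measurable M" and AE: "AE x in M. f x = 0"
  shows "AE x in M. chaos_proj M H k f x = 0"
proof (rule chaos_proj_unique[OF AE_0_L2c[OF f AE] closed_subspaceD(2)[OF closed_subspace_chaos]])
  fix h assume "h \<in> chaos M H k"
  then have [measurable]: "h \<in> borel_measurable M" using chaosD(2) L2cD(1) by blast
  have "inner2 M (\<lambda>x. f x - 0) h = inner2 M (\<lambda>x. 0) h"
    by (rule inner2_cong_AE) (use AE in auto)
  then show "inner2 M (\<lambda>x. f x - 0) h = 0" by (simp add: inner2_def)
qed

text \<open>For \<open>k > m + n\<close> and \<open>i \<le> k\<close>, either \<open>i > m\<close>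
  or \<open>k - i > n\<close>, so one of the two projections is null and the series stops at
  \<open>m + n\<close>. This provides arguments at which a Wick value exists outright.\<close>

lemma wick2_poly:
  assumes ab: "a\<^sup>2 + b\<^sup>2 = 1" and p: "p \<in> Q (Suc m)" and q: "q \<in> Q (Suc n)"
  shows "wick2_rel M H a b (\<lambda>x. p (path x)) (\<lambda>x. q (path x)) (wick_partial M H a b (\<lambda>x. p (path x)) (\<lambda>x. q (path x)) (m + n))"
proof -
  let ?\<phi> = "\<lambda>x. p (path x)" and ?\<psi> = "\<lambda>x. q (path x)"
  note pL = Q_L2c[OF p] and qL = Q_L2c[OF q]
  define t where "t k i = chaos_proj M H k (\<lambda>y. (complex_of_real a ^ i * chaos_proj M H i ?\<phi> y) *
                             (complex_of_real b ^ (k - i) * chaos_proj M H (k - i) ?\<psi> y))" for k i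
  have wp: "wick_partial M H a b ?\<phi> ?\<psi> N = (\<lambda>x. \<Sum>k\<le>N. \<Sum>i\<le>k. t k i x)" for N
    by (simp add: wick_partial_def t_def)
  have t0: "AE x in M. t k i x = 0" if k: "k > m + n" "i \<le> k" for k i
    unfolding t_def
  proof (rule chaos_proj_null)
    have [measurable]: "chaos_proj M H i ?\<phi> \<in> borel_measurable M" "chaos_proj M H (k - i) ?\<psi> \<in> borel_measurable M"
      using chaos_proj_L2c[OF pL] chaos_proj_L2c[OF qL] L2cD(1) by blast+
    show "(\<lambda>y. (complex_of_real a ^ i * chaos_proj M H i ?\<phi> y) * (complex_of_real b ^ (k - i) * chaos_proj M H (k - i) ?\<psi> y)) \<in> borel_measurable M"
      by measurable
    consider "i \<ge> Suc m" | "k - i \<ge> Suc n" using k by linarith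
    then show "AE y in M. (complex_of_real a ^ i * chaos_proj M H i ?\<phi> y) * (complex_of_real b ^ (k - i) * chaos_proj M H (k - i) ?\<psi> y) = 0"
    proof cases
      case 1
      from chaos_proj_high[OF Q_mono[OF p 1]] show ?thesis by eventually_elim simp
    next
      case 2
      from chaos_proj_high[OF Q_mono[OF q 2]] show ?thesis by eventually_elim simp
    qed
  qed
  have "dist2 M (wick_partial M H a b ?\<phi> ?\<psi> N) (wick_partial M H a b ?\<phi> ?\<psi> (m + n)) = 0" if N: "N \<ge> m + n" for N
  proof -
    have "AE x in M. \<forall>k\<in>{m + n<..N}. \<forall>i\<in>{..k}. t k i x = 0"
      using t0 by (intro AE_finite_allI) auto
    then have "AE x in M. wick_partial M H a b ?\<phi> ?\<psi> N x - wick_partial M H a b ?\<phi> ?\<psi> (m + n) x = 0"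
    proof (rule AE_mp, intro AE_I2 impI)
      fix x assume z: "\<forall>k\<in>{m + n<..N}. \<forall>i\<in>{..k}. t k i x = 0"
      have "{..N} = {..m + n} \<union> {m + n<..N}" using N by auto
      then have "(\<Sum>k\<le>N. \<Sum>i\<le>k. t k i x) = (\<Sum>k\<le>m + n. \<Sum>i\<le>k. t k i x) + (\<Sum>k\<in>{m + n<..N}. \<Sum>i\<le>k. t k i x)"
        by (simp only:) (rule sum.union_disjoint; auto)
      also have "(\<Sum>k\<in>{m + n<..N}. \<Sum>i\<le>k. t k i x) = 0" using z by (intro sum.neutral ballI) auto
      finally show "wick_partial M H a b ?\<phi> ?\<psi> N x - wick_partial M H a b ?\<phi> ?\<psi> (m + n) x = 0" unfolding wp by simp
    qed
    then show ?thesis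
      using norm2_eq_0_AE[OF L2c_diff[OF Qbar_L2c[OF wick_partial_Qbar[OF ab pL qL]] Qbar_L2c[OF wick_partial_Qbar[OF ab pL qL]]]]
      unfolding dist2_norm2 by simp
  qed
  then have "(\<lambda>N. dist2 M (wick_partial M H a b ?\<phi> ?\<psi> N) (wick_partial M H a b ?\<phi> ?\<psi> (m + n))) \<longlonglongrightarrow> 0"
    by (intro tendsto_eventually eventually_sequentiallyI)
  then show ?thesis
    unfolding wick2_rel_def using Qbar_L2c[OF wick_partial_Qbar[OF ab pL qL]] by blast
qed

section \<open>Values of the extension and their norms\<close>

lemma FH_measurable_adapted:
  assumes "g \<in> borel_measurable (FH M H)" "AE x in M. f x = g x"
  shows "adapted f"
proof -
  obtain G where G: "G \<in> borel_measurable paths" "\<And>x. x \<in> space M \<Longrightarrow> g x = G (path x)"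
    by (rule FH_factor[OF assms(1)]) (rule that)
  have "AE x in M. f x = G (path x)"
    by (rule AE_mp[OF assms(2)], intro AE_I2 impI) (simp add: G(2))
  with G(1) show ?thesis unfolding adapted_def by blast
qed

lemma in_Lp_adapted: "in_Lp M H p f \<Longrightarrow> adapted f"
  unfolding in_Lp_def using FH_measurable_adapted by blast

lemma enn2real_ge_1: assumes "1 \<le> p" "p \<noteq> (\<infinity> :: ennreal)" shows "1 \<le> enn2real p"
  using enn2real_mono[OF assms(1)] assms(2) by (simp add: less_top)

lemma esssup_finite_AE:
  assumes "esssup M (\<lambda>x. ennreal (cmod (f x))) < \<infinity>"
  shows "AE x in M. cmod (f x) \<le> enn2real (esssup M (\<lambda>x. ennreal (cmod (f x))))"
  using esssup_AE[of "\<lambda>x. ennreal (cmod (f x))" M]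
proof eventually_elim
  case (elim x)
  then have "enn2real (ennreal (cmod (f x))) \<le> enn2real (esssup M (\<lambda>x. ennreal (cmod (f x))))"
    using assms by (intro enn2real_mono) auto
  then show ?case by simp
qed

lemma in_Lp_integrable:
  assumes f: "in_Lp M H p f" and p: "1 \<le> p"
  shows "integrable M f"
proof (cases "p = \<infinity>")
  case True
  then have "esssup M (\<lambda>x. ennreal (cmod (f x))) < \<infinity>" and [measurable]: "f \<in> borel_measurable M"
    using f by (auto simp: in_Lp_def)
  from integrable_const_bound[OF esssup_finite_AE[OF this(1)]] show ?thesis by simp
next
  case False
  then have i: "integrable M (\<lambda>x. cmod (f x) powr enn2real p)" and [measurable]: "f \<in> borel_measurable M"
    using f by (auto simp: in_Lp_def)
  have "cmod (f x) \<le> 1 + cmod (f x) powr enn2real p" for x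
  proof (cases "cmod (f x) \<le> 1")
    case F: False
    then have "cmod (f x) powr 1 \<le> cmod (f x) powr enn2real p" using enn2real_ge_1[OF p False] by (intro powr_mono) auto
    then show ?thesis using F by simp
  qed (auto intro: add_increasing2)
  then show ?thesis
    by (intro Bochner_Integration.integrable_bound[OF Bochner_Integration.integrable_add[OF integrable_const[of 1] i]]) auto
qed

lemma in_L2_iff: "in_Lp M H 2 f \<longleftrightarrow> f \<in> L2c M \<and> (\<exists>g \<in> borel_measurable (FH M H). AE x in M. f x = g x)"
  by (auto simp: in_Lp_def L2c_def powr_numeral)

text \<open>The Fourier identity passes to the limit along whatever sequences witness the relation,
  so the value does not depend on them.\<close>

lemma wick_ext_eq_wk:
  assumes ab: "a\<^sup>2 + b\<^sup>2 = 1" and m [measurable]: "F \<in> borel_measurable paths" "G \<in> borel_measurable paths"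
    and i: "integrable M \<phi>" "integrable M \<psi>"
    and AE: "AE x in M. \<phi> x = F (path x)" "AE x in M. \<psi> x = G (path x)"
    and w: "wick_ext_rel M H a b \<phi> \<psi> w"
  shows "AE x in M. w x = wk a b F G (path x)"
proof -
  obtain \<phi>s \<psi>s ws where wi: "integrable M w" and S: "\<And>n. in_Lp M H 2 (\<phi>s n)" "\<And>n. in_Lp M H 2 (\<psi>s n)"
      "\<And>n. wick2_rel M H a b (\<phi>s n) (\<psi>s n) (ws n)"
    and lim: "(\<lambda>n. dist1 M (\<phi>s n) \<phi>) \<longlonglongrightarrow> 0" "(\<lambda>n. dist1 M (\<psi>s n) \<psi>) \<longlonglongrightarrow> 0" "(\<lambda>n. dist1 M (ws n) w) \<longlonglongrightarrow> 0"
    using w unfolding wick_ext_rel_def by blast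
  have [measurable]: "\<phi> \<in> borel_measurable M" "\<psi> \<in> borel_measurable M" using i by auto
  have L: "\<phi>s n \<in> L2c M" "\<psi>s n \<in> L2c M" "ws n \<in> L2c M" for n
    using S[of n] by (auto simp: in_L2_iff wick2_rel_def)
  note Li = L2c_integrable[OF L(1)] L2c_integrable[OF L(2)] L2c_integrable[OF L(3)]
  \<comment> \<open>Each \<open>ws n\<close> agrees almost everywhere with some \<open>wk\<close>, a
    function of the path; adaptedness of the limit \<open>w\<close> is derived from this.\<close>
  have "adapted (ws n)" for n
  proof -
    obtain F' G' where FG: "F' \<in> borel_measurable paths" "AE x in M. \<phi>s n x = F' (path x)"
       "G' \<in> borel_measurable paths" "AE x in M. \<psi>s n x = G' (path x)"
      using in_Lp_adapted[OF S(1)[of n]] in_Lp_adapted[OF S(2)[of n]] unfolding adapted_def by blast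
    from wick2_eq_wk[OF ab L(1,2) S(3) FG(1,3,2,4)] show ?thesis
      unfolding adapted_def using wk_measurable[OF FG(1,3)] by blast
  qed
  from adapted_limit[OF Li(3) this wi] lim(3) have ad: "adapted w" by (simp add: dist1_def)
  have conv: "(\<lambda>n. \<integral>x. fs n x * cis (h x) \<partial>M) \<longlonglongrightarrow> (\<integral>x. f x * cis (h x) \<partial>M)"
    if fs: "\<And>n. integrable M (fs n)" and f: "integrable M f" and l: "(\<lambda>n. dist1 M (fs n) f) \<longlonglongrightarrow> 0" and h: "h \<in> H"
    for fs :: "nat \<Rightarrow> 'a \<Rightarrow> complex" and f h
  proof (rule LIM_zero_cancel, rule Lim_null_comparison[OF _ l], rule always_eventually, rule allI)
    fix n
    have "norm ((\<integral>x. fs n x * cis (h x) \<partial>M) - (\<integral>x. f x * cis (h x) \<partial>M)) = norm (\<integral>x. (fs n x - f x) * cis (h x) \<partial>M)"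
      using integrable_mult_cis[OF fs[of n] H_meas[OF h]] integrable_mult_cis[OF f H_meas[OF h]] by (simp add: left_diff_distrib)
    also have "\<dots> \<le> (\<integral>x. norm ((fs n x - f x) * cis (h x)) \<partial>M)" by (rule integral_norm_bound)
    finally show "norm ((\<integral>x. fs n x * cis (h x) \<partial>M) - (\<integral>x. f x * cis (h x) \<partial>M)) \<le> dist1 M (fs n) f"
      by (simp add: norm_mult dist1_def)
  qed
  show ?thesis
  proof (rule char_imp_eq_wk[OF ab wi ad m _ _ i AE])
    fix h assume h: "h \<in> H"
    have "(\<integral>x. ws n x * cis (h x) \<partial>M) = (\<integral>x. \<phi>s n x * cis (a * h x) \<partial>M) * (\<integral>x. \<psi>s n x * cis (b * h x) \<partial>M)" for n
      by (rule wick2_char[OF ab L(1,2) S(3) h])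
    then have "(\<lambda>n. \<integral>x. ws n x * cis (h x) \<partial>M) \<longlonglongrightarrow> (\<integral>x. \<phi> x * cis (a * h x) \<partial>M) * (\<integral>x. \<psi> x * cis (b * h x) \<partial>M)"
      using tendsto_mult[OF conv[OF Li(1) i(1) lim(1) H_scale[OF h, of a]] conv[OF Li(2) i(2) lim(2) H_scale[OF h, of b]]] by simp
    with conv[OF Li(3) wi lim(3) h]
    show "(\<integral>x. w x * cis (h x) \<partial>M) = (\<integral>x. \<phi> x * cis (a * h x) \<partial>M) * (\<integral>x. \<psi> x * cis (b * h x) \<partial>M)"
      by (rule LIMSEQ_unique)
  qed measurable
qed

text \<open>Along polynomial approximations the Wick series are finite and equal to
  \<open>wk\<close>, and the L1 continuity of \<open>wk\<close> makes them converge.\<close>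

lemma wick_ext_exists:
  assumes ab: "a\<^sup>2 + b\<^sup>2 = 1" and m [measurable]: "F \<in> borel_measurable paths" "G \<in> borel_measurable paths"
    and i: "integrable M \<phi>" "integrable M \<psi>"
    and AE: "AE x in M. \<phi> x = F (path x)" "AE x in M. \<psi> x = G (path x)"
  shows "wick_ext_rel M H a b \<phi> \<psi> (\<lambda>x. wk a b F G (path x))"
proof -
  have [measurable]: "\<phi> \<in> borel_measurable M" "\<psi> \<in> borel_measurable M" using i by auto
  have Fi: "integrable M (\<lambda>x. F (path x))" using i(1) AE(1) by (subst integrable_cong_AE[where g=\<phi>]) auto
  have Gi: "integrable M (\<lambda>x. G (path x))" using i(2) AE(2) by (subst integrable_cong_AE[where g=\<psi>]) auto
  \<comment> \<open>The degrees grow along the sequence, so \<open>ns\<close> is chosen together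
    with the polynomials.\<close>
  have dense: "\<exists>ns ps. \<forall>l. ps l \<in> Q (Suc (ns l)) \<and> (\<integral>x. cmod (ps l (path x) - f x) \<partial>M) < inverse (real (Suc l))"
    if "integrable M f" "adapted f" for f
    using poly_dense_L1[OF that, of "inverse (real (Suc l))" for l] by (simp add: choice_iff[symmetric]) metis
  obtain ms ps where ps: "\<And>l. ps l \<in> Q (Suc (ms l))" "\<And>l. (\<integral>x. cmod (ps l (path x) - F (path x)) \<partial>M) < inverse (real (Suc l))"
    using dense[OF Fi adapted_comp[OF m(1)]] by blast
  obtain ns qs where qs: "\<And>l. qs l \<in> Q (Suc (ns l))" "\<And>l. (\<integral>x. cmod (qs l (path x) - G (path x)) \<partial>M) < inverse (real (Suc l))"
    using dense[OF Gi adapted_comp[OF m(2)]] by blast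
  have pm [measurable]: "ps l \<in> borel_measurable paths" and qm [measurable]: "qs l \<in> borel_measurable paths" for l
    using Q_measurable[OF ps(1)] Q_measurable[OF qs(1)] by auto
  note pL = Q_L2c[OF ps(1)] and qL = Q_L2c[OF qs(1)]
  note pi = L2c_integrable[OF pL] and qi = L2c_integrable[OF qL]
  have small: "(\<lambda>l. d l) \<longlonglongrightarrow> 0" if "\<And>l. 0 \<le> d l" "\<And>l. d l < inverse (real (Suc l))" for d :: "nat \<Rightarrow> real"
    by (rule Lim_null_comparison[OF _ LIMSEQ_inverse_real_of_nat]) (use that in \<open>auto intro!: always_eventually less_imp_le\<close>)
  have lp: "(\<lambda>l. \<integral>x. cmod (ps l (path x) - F (path x)) \<partial>M) \<longlonglongrightarrow> 0"
    by (rule small[OF _ ps(2)]) simp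
  have lq: "(\<lambda>l. \<integral>x. cmod (qs l (path x) - G (path x)) \<partial>M) \<longlonglongrightarrow> 0"
    by (rule small[OF _ qs(2)]) simp
  define ws where "ws l = wick_partial M H a b (\<lambda>x. ps l (path x)) (\<lambda>x. qs l (path x)) (ms l + ns l)" for l
  have W: "wick2_rel M H a b (\<lambda>x. ps l (path x)) (\<lambda>x. qs l (path x)) (ws l)" for l
    unfolding ws_def by (rule wick2_poly[OF ab ps(1) qs(1)])
  have wsm [measurable]: "ws l \<in> borel_measurable M" for l using W[of l] by (auto simp: wick2_rel_def dest: L2cD)
  have wsAE: "AE x in M. ws l x = wk a b (ps l) (qs l) (path x)" for l
    by (rule wick2_eq_wk[OF ab pL qL W pm qm]) auto
  have d1: "dist1 M (\<lambda>x. ps l (path x)) \<phi> = (\<integral>x. cmod (ps l (path x) - F (path x)) \<partial>M)" for l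
    unfolding dist1_def using AE(1) by (intro integral_cong_AE) auto
  have d2: "dist1 M (\<lambda>x. qs l (path x)) \<psi> = (\<integral>x. cmod (qs l (path x) - G (path x)) \<partial>M)" for l
    unfolding dist1_def using AE(2) by (intro integral_cong_AE) auto
  have d3: "dist1 M (ws l) (\<lambda>x. wk a b F G (path x)) = (\<integral>x. cmod (wk a b (ps l) (qs l) (path x) - wk a b F G (path x)) \<partial>M)" for l
    unfolding dist1_def using wsAE[of l] by (intro integral_cong_AE) auto
  \<comment> \<open>The difference estimate multiplies the first error by the norm of
    \<open>qs l\<close>, which must stay bounded; every approximation error is at most 1.\<close>
  have nq: "(\<integral>x. cmod (qs l (path x)) \<partial>M) \<le> 1 + (\<integral>x. cmod (G (path x)) \<partial>M)" for l
  proof -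
    have "(\<integral>x. cmod (qs l (path x)) \<partial>M) \<le> (\<integral>x. cmod (qs l (path x) - G (path x)) + cmod (G (path x)) \<partial>M)"
      using qi[of l] Gi by (intro integral_mono) (auto intro: norm_triangle_sub[THEN order_trans] simp: add.commute)
    also have "\<dots> = (\<integral>x. cmod (qs l (path x) - G (path x)) \<partial>M) + (\<integral>x. cmod (G (path x)) \<partial>M)"
      using qi[of l] Gi by (intro Bochner_Integration.integral_add) auto
    also have "inverse (real (Suc l)) \<le> 1" by (simp add: field_simps)
    then have "(\<integral>x. cmod (qs l (path x) - G (path x)) \<partial>M) \<le> 1" using qs(2)[of l] by linarith
    finally show ?thesis by simp
  qed
  let ?I = "\<lambda>f. \<integral>x. cmod (f x) \<partial>M"
  have "(\<lambda>l. dist1 M (ws l) (\<lambda>x. wk a b F G (path x))) \<longlonglongrightarrow> 0"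
  proof (rule Lim_null_comparison)
    have "dist1 M (ws l) (\<lambda>x. wk a b F G (path x)) \<le> (\<integral>x. cmod (ps l (path x) - F (path x)) \<partial>M) * (1 + ?I (\<lambda>x. G (path x)))
        + ?I (\<lambda>x. F (path x)) * (\<integral>x. cmod (qs l (path x) - G (path x)) \<partial>M)" for l
      unfolding d3
      by (rule order_trans[OF wk_L1_diff_le[OF ab pm qm m pi qi Fi Gi]]) (intro add_mono mult_left_mono nq order_refl; simp)
    moreover have "0 \<le> dist1 M (ws l) (\<lambda>x. wk a b F G (path x))" for l by (simp add: dist1_def)
    ultimately show "\<forall>\<^sub>F l in sequentially. norm (dist1 M (ws l) (\<lambda>x. wk a b F G (path x)))
       \<le> (\<integral>x. cmod (ps l (path x) - F (path x)) \<partial>M) * (1 + ?I (\<lambda>x. G (path x)))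
        + ?I (\<lambda>x. F (path x)) * (\<integral>x. cmod (qs l (path x) - G (path x)) \<partial>M)" by simp
    show "(\<lambda>l. (\<integral>x. cmod (ps l (path x) - F (path x)) \<partial>M) * (1 + ?I (\<lambda>x. G (path x)))
        + ?I (\<lambda>x. F (path x)) * (\<integral>x. cmod (qs l (path x) - G (path x)) \<partial>M)) \<longlonglongrightarrow> 0"
      using tendsto_add[OF tendsto_mult_left_zero[OF lp] tendsto_mult_right_zero[OF lq]] by simp
  qed
  moreover have "in_Lp M H 2 (\<lambda>x. p (path x))" if "p \<in> Q k" for p k
    unfolding in_L2_iff using Q_L2c[OF that] measurable_compose[OF path_measurable_FH Q_measurable[OF that]] by auto
  ultimately show ?thesis
    unfolding wick_ext_rel_def using wk_L1(1)[OF ab m Fi Gi] ps(1) qs(1) W lp lq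
    by (intro conjI exI[of _ "\<lambda>l x. ps l (path x)"] exI[of _ "\<lambda>l x. qs l (path x)"] exI[of _ ws])
       (auto simp: d1 d2)
qed

text \<open>Exceptional sets are pushed through \<open>mix\<close>: a single mixed path has the law
  of \<open>path\<close>, so a null set stays null for almost every \<open>x\<close> and then almost
  every \<open>y\<close>. The integrand is then bounded by \<open>A * B\<close>.\<close>

lemma wk_bounded:
  assumes ab: "a\<^sup>2 + b\<^sup>2 = 1" and m [measurable]: "F \<in> borel_measurable paths" "G \<in> borel_measurable paths"
    and AE: "AE x in M. cmod (F (path x)) \<le> A" "AE x in M. cmod (G (path x)) \<le> B"
  shows "AE x in M. cmod (wk a b F G (path x)) \<le> A * B"
proof -
  have mixAE: "AE x in M. AE y in M. cmod (K (mix c d (path x) (path y))) \<le> C"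
    if cd: "c\<^sup>2 + d\<^sup>2 = 1" and [measurable]: "K \<in> borel_measurable paths" and K: "AE x in M. cmod (K (path x)) \<le> C" for c d K C
  proof -
    define S where "S = {\<xi> \<in> space paths. cmod (K \<xi>) > C}"
    have [measurable]: "S \<in> sets paths" unfolding S_def by measurable
    have mixS: "mix c d (path x) (path y) \<in> space paths" for x y by (auto simp: mix_def space_PiM)
    have "(\<integral>\<^sup>+x. \<integral>\<^sup>+y. indicator S (mix c d (path x) (path y)) \<partial>M \<partial>M) = (\<integral>\<^sup>+x. indicator S (path x) \<partial>M)"
      by (rule nn_integral_mix[OF cd]) measurable
    also have "\<dots> = (\<integral>\<^sup>+x. 0 \<partial>M)"
    proof (rule nn_integral_cong_AE, rule AE_mp[OF K], intro AE_I2 impI)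
      fix x assume "cmod (K (path x)) \<le> C"
      then show "indicator S (path x) = (0 :: ennreal)" by (auto simp: S_def indicator_def)
    qed
    finally have "(\<integral>\<^sup>+x. \<integral>\<^sup>+y. indicator S (mix c d (path x) (path y)) \<partial>M \<partial>M) = 0" by simp
    then have "AE x in M. (\<integral>\<^sup>+y. indicator S (mix c d (path x) (path y)) \<partial>M) = 0"
      by (subst (asm) nn_integral_0_iff_AE) auto
    note mp = AE_mp[OF this]
    show ?thesis
    proof (rule mp, rule AE_I2, rule impI)
      fix x assume x: "x \<in> space M" and z: "(\<integral>\<^sup>+y. indicator S (mix c d (path x) (path y)) \<partial>M) = 0"
      have [measurable]: "path x \<in> space paths" using path_space[OF x] .
      have "(\<lambda>y. indicator S (mix c d (path x) (path y)) :: ennreal) \<in> borel_measurable M" by measurable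
      from nn_integral_0_iff_AE[OF this] z have "AE y in M. indicator S (mix c d (path x) (path y)) = (0 :: ennreal)" by simp
      then show "AE y in M. cmod (K (mix c d (path x) (path y))) \<le> C"
        by eventually_elim (use mixS in \<open>auto simp: S_def indicator_def not_less split: if_splits\<close>)
    qed
  qed
  have ba: "b\<^sup>2 + (-a)\<^sup>2 = 1" using ab by simp
  show ?thesis
    using mixAE[OF ab m(1) AE(1)] mixAE[OF ba m(2) AE(2)]
  proof eventually_elim
    case (elim x)
    have "AE y in M. cmod (F (mix a b (path x) (path y)) * G (mix b (-a) (path x) (path y))) \<le> A * B"
      using elim
    proof eventually_elim
      case (elim y)
      then show ?case unfolding norm_mult by (intro mult_mono order_trans[OF norm_ge_zero elim(1)]) auto
    qed
    note le = this
    \<comment> \<open>\<open>ennreal\<close> sends negative numbers to 0, so the sign of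
      \<open>A * B\<close> has to be known before returning to reals; a single \<open>y\<close>
      satisfying the bound settles it.\<close>
    have AB: "0 \<le> A * B"
    proof -
      obtain y where "cmod (F (mix a b (path x) (path y)) * G (mix b (-a) (path x) (path y))) \<le> A * B"
        using eventually_happens'[OF ae_filter_bot le] by auto
      then show ?thesis using norm_ge_zero order_trans by blast
    qed
    have "ennreal (cmod (wk a b F G (path x))) \<le> (\<integral>\<^sup>+y. ennreal (cmod (F (mix a b (path x) (path y)) * G (mix b (-a) (path x) (path y)))) \<partial>M)"
      unfolding wk_def by (rule ennreal_norm_integral_le)
    also have "\<dots> \<le> (\<integral>\<^sup>+y. ennreal (A * B) \<partial>M)"
      using le by (intro nn_integral_mono_AE) (auto elim!: eventually_mono intro: ennreal_leI)
    also have "\<dots> = ennreal (A * B)" by (simp add: emeasure_space_1)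
    finally show ?case using AB by simp
  qed
qed

text \<open>\<open>w\<close> is an arbitrary measurable representative because the extension fixes
  values only almost everywhere. The essential supremum needs the separate bound
  \<open>wk_bounded\<close>; finite exponents come from \<open>wk_powr_le\<close>.\<close>

lemma wk_Lp:
  assumes ab: "a\<^sup>2 + b\<^sup>2 = 1" and p: "1 \<le> p" and m [measurable]: "F \<in> borel_measurable paths" "G \<in> borel_measurable paths"
    and \<phi>: "in_Lp M H p \<phi>" and \<psi>: "in_Lp M H p \<psi>"
    and AE: "AE x in M. \<phi> x = F (path x)" "AE x in M. \<psi> x = G (path x)"
    and w [measurable]: "w \<in> borel_measurable M" and wAE: "AE x in M. w x = wk a b F G (path x)"
  shows "in_Lp M H p w \<and> lp_norm M p w \<le> lp_norm M p \<phi> * lp_norm M p \<psi>"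
proof -
  have [measurable]: "\<phi> \<in> borel_measurable M" "\<psi> \<in> borel_measurable M" using \<phi> \<psi> by (auto simp: in_Lp_def)
  have FHm: "\<exists>g \<in> borel_measurable (FH M H). AE x in M. w x = g x"
    using wAE measurable_compose[OF path_measurable_FH wk_measurable[OF m]] by (intro bexI[of _ "\<lambda>x. wk a b F G (path x)"])
  show ?thesis
  proof (cases "p = \<infinity>")
    case True
    define A where "A = enn2real (esssup M (\<lambda>x. ennreal (cmod (\<phi> x))))"
    define B where "B = enn2real (esssup M (\<lambda>x. ennreal (cmod (\<psi> x))))"
    have "AE x in M. cmod (\<phi> x) \<le> A" "AE x in M. cmod (\<psi> x) \<le> B"
      unfolding A_def B_def using \<phi> \<psi> True by (auto simp: in_Lp_def intro!: esssup_finite_AE)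
    then have "AE x in M. cmod (F (path x)) \<le> A" "AE x in M. cmod (G (path x)) \<le> B"
      using AE by (auto elim!: eventually_elim2)
    from wk_bounded[OF ab m this] wAE have wb: "AE x in M. ennreal (cmod (w x)) \<le> ennreal (A * B)"
      by eventually_elim (simp add: ennreal_leI)
    then have le: "esssup M (\<lambda>x. ennreal (cmod (w x))) \<le> ennreal (A * B)" by (intro esssup_I) auto
    then have fin: "esssup M (\<lambda>x. ennreal (cmod (w x))) < \<infinity>" using le_less_trans[OF le] by simp
    have "enn2real (esssup M (\<lambda>x. ennreal (cmod (w x)))) \<le> A * B"
      using enn2real_mono[OF le] by (simp add: A_def B_def)
    then show ?thesis using True fin FHm by (simp add: in_Lp_def lp_norm_def A_def B_def)
  next
    case False
    define q where "q = enn2real p"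
    have q: "1 \<le> q" unfolding q_def by (rule enn2real_ge_1[OF p False])
    have i: "integrable M (\<lambda>x. cmod (\<phi> x) powr q)" "integrable M (\<lambda>x. cmod (\<psi> x) powr q)"
      using \<phi> \<psi> False by (auto simp: in_Lp_def q_def)
    have e1: "(\<integral>\<^sup>+x. ennreal (cmod (F (path x)) powr q) \<partial>M) = ennreal (\<integral>x. cmod (\<phi> x) powr q \<partial>M)"
      unfolding nn_integral_eq_integral[OF i(1), symmetric, simplified] using AE(1) by (intro nn_integral_cong_AE) auto
    have e2: "(\<integral>\<^sup>+x. ennreal (cmod (G (path x)) powr q) \<partial>M) = ennreal (\<integral>x. cmod (\<psi> x) powr q \<partial>M)"
      unfolding nn_integral_eq_integral[OF i(2), symmetric, simplified] using AE(2) by (intro nn_integral_cong_AE) auto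
    have e3: "(\<integral>\<^sup>+x. ennreal (cmod (w x) powr q) \<partial>M) = (\<integral>\<^sup>+x. ennreal (cmod (wk a b F G (path x)) powr q) \<partial>M)"
      using wAE by (intro nn_integral_cong_AE) auto
    have le: "(\<integral>\<^sup>+x. ennreal (cmod (w x) powr q) \<partial>M) \<le> ennreal ((\<integral>x. cmod (\<phi> x) powr q \<partial>M) * (\<integral>x. cmod (\<psi> x) powr q \<partial>M))"
      using wk_powr_le[OF ab q m] unfolding e1 e2 e3 by (simp add: ennreal_mult)
    have wi: "integrable M (\<lambda>x. cmod (w x) powr q)"
      by (intro integrableI_nonneg) (auto intro: le_less_trans[OF le])
    have "(\<integral>x. cmod (w x) powr q \<partial>M) \<le> (\<integral>x. cmod (\<phi> x) powr q \<partial>M) * (\<integral>x. cmod (\<psi> x) powr q \<partial>M)"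
      using le wi by (simp add: nn_integral_eq_integral)
    then have "(\<integral>x. cmod (w x) powr q \<partial>M) powr (1 / q) \<le> ((\<integral>x. cmod (\<phi> x) powr q \<partial>M) * (\<integral>x. cmod (\<psi> x) powr q \<partial>M)) powr (1 / q)"
      using q by (intro powr_mono2) auto
    also have "\<dots> = (\<integral>x. cmod (\<phi> x) powr q \<partial>M) powr (1 / q) * (\<integral>x. cmod (\<psi> x) powr q \<partial>M) powr (1 / q)"
      by (rule powr_mult)
    finally show ?thesis using False FHm wi by (simp add: in_Lp_def lp_norm_def q_def)
  qed
qed

end

theorem theorem4p2:
  fixes M :: "'a measure" and H :: "('a \<Rightarrow> real) set"
    and p :: ennreal and u v :: real
    and \<phi> \<psi> :: "'a \<Rightarrow> complex"
  assumes "prob_space M"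
    and "gaussian_hilbert_space M H"
    and "separable_ghs M H"
    and "1 \<le> p"
    and "u > 0" and "v > 0" and "1 / u + 1 / v = 1"
    and "in_Lp M H p \<phi>" and "in_Lp M H p \<psi>"
  shows "(\<exists>w. wick_ext_rel M H (1 / sqrt u) (1 / sqrt v) \<phi> \<psi> w) \<and>
         (\<forall>w. wick_ext_rel M H (1 / sqrt u) (1 / sqrt v) \<phi> \<psi> w \<longrightarrow>
               in_Lp M H p w \<and> lp_norm M p w \<le> lp_norm M p \<phi> * lp_norm M p \<psi>)"
proof -
  interpret gaussian_space M H
    using assms(1,2) by (simp add: gaussian_space_def gaussian_space_axioms_def)
  have ab: "(1 / sqrt u)\<^sup>2 + (1 / sqrt v)\<^sup>2 = 1" using assms(5-7) by (simp add: power_divide)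
  obtain F G where m: "F \<in> borel_measurable paths" "G \<in> borel_measurable paths"
    and AE: "AE x in M. \<phi> x = F (path x)" "AE x in M. \<psi> x = G (path x)"
    using in_Lp_adapted[OF assms(8)] in_Lp_adapted[OF assms(9)] unfolding adapted_def by blast
  \<comment> \<open>On a probability space, p-integrable functions with \<open>1 \<le> p\<close> are
    integrable, so the L1 extension applies to \<open>\<phi>\<close> and
    \<open>\<psi>\<close>.\<close>
  note i = in_Lp_integrable[OF assms(8,4)] in_Lp_integrable[OF assms(9,4)]
  show ?thesis
  proof (intro conjI allI impI)
    show "\<exists>w. wick_ext_rel M H (1 / sqrt u) (1 / sqrt v) \<phi> \<psi> w"
      using wick_ext_exists[OF ab m i AE] by blast
    fix w assume w: "wick_ext_rel M H (1 / sqrt u) (1 / sqrt v) \<phi> \<psi> w"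
    then have wm: "w \<in> borel_measurable M" by (simp add: wick_ext_rel_def)
    have "in_Lp M H p w \<and> lp_norm M p w \<le> lp_norm M p \<phi> * lp_norm M p \<psi>"
      by (rule wk_Lp[OF ab assms(4) m assms(8,9) AE wm wick_ext_eq_wk[OF ab m i AE w]])
    then show "in_Lp M H p w" "lp_norm M p w \<le> lp_norm M p \<phi> * lp_norm M p \<psi>" by auto
  qed
qed

end
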